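(* Let $p>1$, $-d<\gamma<0$, and let $f_0\in L^1_s(\mathbb{R}^d)\cap L^p(\mathbb{R}^d)$ be a non-negative function with unit mass, for some $s\ge s_{p,d,\gamma}$. Assume that the angular kernel $b$ is bounded and let $f=f(t)$ be the solution to $\partial_t f=\boldsymbol{L}_\gamma f$ with $f(0)=f_0$. Given $k>0$, there exists $\beta>k$, depending only on $k,d,s,\gamma$, such that if additionally $M_\beta(f_0)<+\infty$, then $$M_k(f(t))\le C_k\qquad\text{for all }t\ge0,$$ for some constant $C_k>0$ that depends only on $k,p,s,d,\gamma,M_\beta(f_0),\|f_0\|_p$ (and on the fixed angular kernel $b$).
   Context: Setting: $d\ge2$, $\gamma\in(-d,0)$; $b:[-1,1]\to[0,\infty)$ is an even function with $\|b\|_1:=\int_{\mathbb{S}^{d-1}}b(\cos\theta)\,d\sigma=|\mathbb{S}^{d-2}|\int_{-1}^1 b(x)(1-x^2)^{\frac{d-3}{2}}dx=1$. The Maxwellian is $\mathcal{M}(v)=(2\pi)^{-d/2}e^{-|v|^2/2}$. For $v,v_*\in\mathbb{R}^d$, $\sigma\in\mathbb{S}^{d-1}$: $v'=\frac{v+v_*}{2}+\frac{|v-v_*|}{2}\sigma$, $v_*'=\frac{v+v_*}{2}-\frac{|v-v_*|}{2}\sigma$, $\cos\theta=\frac{v-v_*}{|v-v_*|}\cdot\sigma$. The linear Boltzmann operator is $$\boldsymbol{L}_\gamma f(v)=\int_{\mathbb{R}^d\times\mathbb{S}^{d-1}}|v-v_*|^\gamma b(\cos\theta)\big(f(v')\mathcal{M}(v_*')-f(v)\mathcal{M}(v_*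 )\big)\,dv_*\,d\sigma .$$ It is bounded on $L^1(\mathbb{R}^d)$; the solution with initial datum $f_0\in L^1(\mathbb{R}^d)$ is $f(t)=U(t)f_0$, where $(U(t))_{t\ge0}$ is the positive, mass-preserving $C_0$-semigroup on $L^1(\mathbb{R}^d)$ generated by $\boldsymbol{L}_\gamma$. Notation: $\langle v\rangle=\sqrt{1+|v|^2}$, $M_k(f)=\int_{\mathbb{R}^d}\langle v\rangle^kf(v)\,dv$, $\|f\|_{L^1_s}=M_s(|f|)$, $L^1_s(\mathbb{R}^d)=\{f:\|f\|_{L^1_s}<\infty\}$; $H(f|\mathcal{M})=\int f\log\frac{f}{\mathcal{M}}\,dv$ for non-negative $f$ of unit mass. The constant $s_{p,d,\gamma}>2+|\gamma|$ is an explicit constant, depending only on $p,d,\gamma$, for which the following decay result holds: if $b$ is bounded, $s\ge s_{p,d,\gamma}$ and $f_0\in L^1_s\cap L^p$ is non-negative with unit mass, then for every $\sigma<-1+\frac{s-2}{|\gamma|}$ there is $C_0>0$ depending only on $d,\gamma,p,s,\sigma,\|f_0\|_{L^1_s},\|f_0\|_p,H(f_0|\mathcal{M})$ (and $b$) such that $H(f(t)|\mathcal{M})\le C_0(1+t)^{-\sigma}$ for all $t\ge0$. *)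

theory Defs
  imports "HOL-Analysis.Analysis"
begin

section \<open>Surface measure and the collision geometry\<close>

text \<open>Surface measure on the unit sphere, through polar coordinates: the measure of a Borel
  subset \<open>A\<close> of the sphere is \<open>d\<close> times the volume of the cone
  \<open>{r \<omega> | 0 < r < 1, \<omega> \<in> A}\<close>.\<close>

definition sphere_measure :: "(real ^ 'n) measure" where
  "sphere_measure = scale_measure (ennreal (real CARD('n)))
     (distr (restrict_space lborel (ball 0 1 - {0})) (restrict_space borel (sphere 0 1)) sgn)"

definition post_v :: "real ^ 'n \<Rightarrow> real ^ 'n \<Rightarrow> real ^ 'n \<Rightarrow> real ^ 'n" where
  "post_v v vs \<sigma> = (v + vs) /\<^sub>R 2 + (norm (v - vs) / 2) *\<^sub>R \<sigma>"

definition post_vs :: "real ^ 'n \<Rightarrow> real ^ 'n \<Rightarrow> real ^ 'n \<Rightarrow> real ^ 'n" where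
  "post_vs v vs \<sigma> = (v + vs) /\<^sub>R 2 - (norm (v - vs) / 2) *\<^sub>R \<sigma>"

definition cos_dev :: "real ^ 'n \<Rightarrow> real ^ 'n \<Rightarrow> real ^ 'n \<Rightarrow> real" where
  "cos_dev v vs \<sigma> = ((v - vs) /\<^sub>R norm (v - vs)) \<bullet> \<sigma>"

definition Maxwellian :: "real ^ 'n \<Rightarrow> real" where
  "Maxwellian v = (2 * pi) powr (- real CARD('n) / 2) * exp (- (norm v)\<^sup>2 / 2)"

text \<open>The type argument only carries the dimension. Values of \<open>b\<close> outside \<open>[-1, 1]\<close> are
  irrelevant. By rotation invariance the normalisation does not depend on the unit vector \<open>e\<close>.\<close>

definition angular_kernel :: "'n::finite itself \<Rightarrow> (real \<Rightarrow> real) \<Rightarrow> bool" where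
  "angular_kernel T b \<longleftrightarrow>
     b \<in> borel_measurable (restrict_space borel {-1..1}) \<and>
     (\<forall>x\<in>{-1..1}. 0 \<le> b x) \<and>
     (\<forall>x\<in>{-1..1}. b (- x) = b x) \<and>
     (\<forall>e\<in>sphere (0 :: real ^ 'n) 1.
        has_bochner_integral sphere_measure (\<lambda>\<sigma>. b (e \<bullet> \<sigma>)) 1)"

definition linear_Boltzmann ::
    "real \<Rightarrow> (real \<Rightarrow> real) \<Rightarrow> (real ^ 'n \<Rightarrow> real) \<Rightarrow> real ^ 'n \<Rightarrow> real" where
  "linear_Boltzmann \<gamma> b f v =
     (\<integral>(vs, \<sigma>). norm (v - vs) powr \<gamma> * b (cos_dev v vs \<sigma>) *
        (f (post_v v vs \<sigma>) * Maxwellian (post_vs v vs \<sigma>) - f v * Maxwellian vs)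
      \<partial>(lborel \<Otimes>\<^sub>M sphere_measure))"


section \<open>Semigroups on \<open>L\<^sup>1\<close>\<close>

text \<open>Elements of \<open>L\<^sup>1\<close> are represented by integrable functions, so all identities hold
  almost everywhere and every operator has to respect almost-everywhere equality.\<close>

definition L1_norm :: "(real ^ 'n \<Rightarrow> real) \<Rightarrow> real" where
  "L1_norm f = (\<integral>v. \<bar>f v\<bar> \<partial>lborel)"

definition bounded_linear_L1 :: "((real ^ 'n \<Rightarrow> real) \<Rightarrow> (real ^ 'n \<Rightarrow> real)) \<Rightarrow> bool" where
  "bounded_linear_L1 A \<longleftrightarrow>
     (\<forall>f. integrable lborel f \<longrightarrow> integrable lborel (A f)) \<and>
     (\<forall>f g. integrable lborel f \<longrightarrow> integrable lborel g \<longrightarrow>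
        (AE v in lborel. f v = g v) \<longrightarrow> (AE v in lborel. A f v = A g v)) \<and>
     (\<forall>f g x y. integrable lborel f \<longrightarrow> integrable lborel g \<longrightarrow>
        (AE v in lborel. A (\<lambda>w. x * f w + y * g w) v = x * A f v + y * A g v)) \<and>
     (\<exists>K. \<forall>f. integrable lborel f \<longrightarrow> L1_norm (A f) \<le> K * L1_norm f)"

definition C0_semigroup_L1 ::
    "(real \<Rightarrow> (real ^ 'n \<Rightarrow> real) \<Rightarrow> (real ^ 'n \<Rightarrow> real)) \<Rightarrow> bool" where
  "C0_semigroup_L1 U \<longleftrightarrow>
     (\<forall>t\<ge>0. bounded_linear_L1 (U t)) \<and>
     (\<forall>f. integrable lborel f \<longrightarrow> (AE v in lborel. U 0 f v = f v)) \<and>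
     (\<forall>r\<ge>0. \<forall>t\<ge>0. \<forall>f. integrable lborel f \<longrightarrow>
        (AE v in lborel. U (r + t) f v = U r (U t f) v)) \<and>
     (\<forall>f. integrable lborel f \<longrightarrow>
        ((\<lambda>t. L1_norm (\<lambda>v. U t f v - f v)) \<longlongrightarrow> 0) (at_right 0))"

text \<open>The generator is \<open>A\<close>, with all of \<open>L\<^sup>1\<close> as its domain.\<close>

definition generated_by_L1 ::
    "(real \<Rightarrow> (real ^ 'n \<Rightarrow> real) \<Rightarrow> (real ^ 'n \<Rightarrow> real)) \<Rightarrow>
     ((real ^ 'n \<Rightarrow> real) \<Rightarrow> (real ^ 'n \<Rightarrow> real)) \<Rightarrow> bool" where
  "generated_by_L1 U A \<longleftrightarrow>
     (\<forall>f. integrable lborel f \<longrightarrow> integrable lborel (A f) \<and>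
        ((\<lambda>h. L1_norm (\<lambda>v. (U h f v - f v) / h - A f v)) \<longlongrightarrow> 0) (at_right 0))"

definition positive_L1 :: "(real \<Rightarrow> (real ^ 'n \<Rightarrow> real) \<Rightarrow> (real ^ 'n \<Rightarrow> real)) \<Rightarrow> bool" where
  "positive_L1 U \<longleftrightarrow>
     (\<forall>t\<ge>0. \<forall>f. integrable lborel f \<longrightarrow> (AE v in lborel. 0 \<le> f v) \<longrightarrow>
        (AE v in lborel. 0 \<le> U t f v))"

definition mass_preserving_L1 ::
    "(real \<Rightarrow> (real ^ 'n \<Rightarrow> real) \<Rightarrow> (real ^ 'n \<Rightarrow> real)) \<Rightarrow> bool" where
  "mass_preserving_L1 U \<longleftrightarrow>
     (\<forall>t\<ge>0. \<forall>f. integrable lborel f \<longrightarrow> (\<integral>v. U t f v \<partial>lborel) = (\<integral>v. f v \<partial>lborel))"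

text \<open>\<open>f t\<close> is a representative of \<open>U(t) f0\<close>.\<close>

definition linear_Boltzmann_solution ::
    "real \<Rightarrow> (real \<Rightarrow> real) \<Rightarrow> (real ^ 'n \<Rightarrow> real) \<Rightarrow> (real \<Rightarrow> real ^ 'n \<Rightarrow> real) \<Rightarrow> bool" where
  "linear_Boltzmann_solution \<gamma> b f0 f \<longleftrightarrow>
     (\<exists>U. C0_semigroup_L1 U \<and> positive_L1 U \<and> mass_preserving_L1 U \<and>
        generated_by_L1 U (linear_Boltzmann \<gamma> b) \<and>
        (\<forall>t\<ge>0. f t \<in> borel_measurable lborel \<and> (AE v in lborel. f t v = U t f0 v)))"


section \<open>Weighted spaces, moments and relative entropy\<close>

definition bracket :: "real ^ 'n \<Rightarrow> real" where
  "bracket v = sqrt (1 + (norm v)\<^sup>2)"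

text \<open>A Bochner integral over a non-integrable function is \<open>0\<close>, so finiteness of \<open>moment k f\<close>
  is \<open>finite_moment k f\<close>, and likewise for the entropy below.\<close>

definition finite_moment :: "real \<Rightarrow> (real ^ 'n \<Rightarrow> real) \<Rightarrow> bool" where
  "finite_moment k f \<longleftrightarrow> integrable lborel (\<lambda>v. bracket v powr k * f v)"

definition moment :: "real \<Rightarrow> (real ^ 'n \<Rightarrow> real) \<Rightarrow> real" where
  "moment k f = (\<integral>v. bracket v powr k * f v \<partial>lborel)"

definition L1w :: "real \<Rightarrow> (real ^ 'n \<Rightarrow> real) set" where
  "L1w s = {f. f \<in> borel_measurable lborel \<and> finite_moment s (\<lambda>v. \<bar>f v\<bar>)}"

definition L1w_norm :: "real \<Rightarrow> (real ^ 'n \<Rightarrow> real) \<Rightarrow> real" where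
  "L1w_norm s f = moment s (\<lambda>v. \<bar>f v\<bar>)"

definition Lp :: "real \<Rightarrow> (real ^ 'n \<Rightarrow> real) set" where
  "Lp p = {f. f \<in> borel_measurable lborel \<and> integrable lborel (\<lambda>v. \<bar>f v\<bar> powr p)}"

definition Lp_norm :: "real \<Rightarrow> (real ^ 'n \<Rightarrow> real) \<Rightarrow> real" where
  "Lp_norm p f = (\<integral>v. \<bar>f v\<bar> powr p \<partial>lborel) powr (1 / p)"

definition nonneg_unit_mass :: "(real ^ 'n \<Rightarrow> real) \<Rightarrow> bool" where
  "nonneg_unit_mass f \<longleftrightarrow>
     (AE v in lborel. 0 \<le> f v) \<and> integrable lborel f \<and> (\<integral>v. f v \<partial>lborel) = 1"

definition finite_entropy :: "(real ^ 'n \<Rightarrow> real) \<Rightarrow> bool" where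
  "finite_entropy f \<longleftrightarrow> integrable lborel (\<lambda>v. f v * ln (f v / Maxwellian v))"

definition rel_entropy :: "(real ^ 'n \<Rightarrow> real) \<Rightarrow> real" where
  "rel_entropy f = (\<integral>v. f v * ln (f v / Maxwellian v) \<partial>lborel)"

text \<open>\<open>s0\<close> is an admissible value of the constant \<open>s\<^sub>p\<^sub>,\<^sub>d\<^sub>,\<^sub>\<gamma>\<close>: it exceeds \<open>2 + |\<gamma>|\<close> and the
  algebraic decay of the relative entropy holds from it on. The constant \<open>C0\<close> depends on the
  initial datum only through the values \<open>A\<close>, \<open>N\<close>, \<open>E\<close> of its norms and entropy.\<close>

definition entropy_decay_threshold :: "'n::finite itself \<Rightarrow> real \<Rightarrow> real \<Rightarrow> real \<Rightarrow> bool" where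
  "entropy_decay_threshold T p \<gamma> s0 \<longleftrightarrow>
     2 + \<bar>\<gamma>\<bar> < s0 \<and>
     (\<forall>b. angular_kernel T b \<longrightarrow> bounded (b ` {-1..1}) \<longrightarrow>
       (\<forall>s\<ge>s0. \<forall>\<sigma>. \<sigma> < - 1 + (s - 2) / \<bar>\<gamma>\<bar> \<longrightarrow>
         (\<forall>A N E. \<exists>C0>0. \<forall>(f0 :: real ^ 'n \<Rightarrow> real) f.
            f0 \<in> L1w s \<inter> Lp p \<longrightarrow> nonneg_unit_mass f0 \<longrightarrow>
            L1w_norm s f0 = A \<longrightarrow> Lp_norm p f0 = N \<longrightarrow> rel_entropy f0 = E \<longrightarrow>
            linear_Boltzmann_solution \<gamma> b f0 f \<longrightarrow>
            (\<forall>t\<ge>0. finite_entropy (f t) \<and>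
               rel_entropy (f t) \<le> C0 * (1 + t) powr (- \<sigma>)))))"

end

theory Submission
  imports Defs "HOL-Probability.Probability"
begin

text \<open>
  The solution relaxes to the Maxwellian \<open>M\<close>: by hypothesis its relative entropy decays like
  \<open>(1 + t) powr (- \<sigma>)\<close> for some \<open>\<sigma> > 0\<close>, hence \<open>f(t) - M\<close> is small in \<open>L\<^sup>1\<close>. A moment of order \<open>k\<close> can
  then become large only through high velocities, and these are controlled by a moment of much
  higher order \<open>\<beta>\<close>. That moment may grow in time, but at most linearly, and with a slope that does
  not depend on the solution. As the growth is linear for every order, choosing \<open>\<beta>\<close> large makes
  the interpolation between the two facts uniform in time; \<open>\<beta> \<ge> k + 2 k / \<sigma>\<close> suffices
  (\<open>moment_interpolation_pointwise\<close>, \<open>moment_bound_of_decay\<close>).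

  Linear growth (\<open>finite_moment_growth\<close>) rests on the weak form of the operator. The collision
  conserves energy and \<open>b\<close> is even, so averaging \<open>\<langle>v'\<rangle>\<^sup>\<beta>\<close> over \<open>\<sigma>\<close> produces at most \<open>\<langle>v\<rangle>\<^sup>\<beta>\<close>, which the
  loss term cancels, plus a multiple of \<open>\<langle>v\<^sub>*\<rangle>\<^sup>\<beta>\<close>, and \<open>v\<^sub>*\<close> has a Gaussian law. The singularity of
  the kernel is harmless, since \<open>|v - v\<^sub>*|\<^sup>\<gamma>\<close> is integrable against \<open>\<langle>v\<^sub>*\<rangle>\<^sup>\<beta> M(v\<^sub>*)\<close>, uniformly in \<open>v\<close>.
  The weak form is the exchange of pre- and post-collisional velocities
  (\<open>collision_change_of_variables\<close>); in polar coordinates for the relative velocity it is the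
  exchange of two independent directions. Weights are truncated throughout, because only bounded
  test functions can be paired with the generator (\<open>weighted_linear_Boltzmann_le\<close>,
  \<open>weighted_integral_growth\<close>).

  The constant in the decay of entropy depends in an uncontrolled way on the norm of the datum in
  \<open>L\<^sup>1\<^sub>s\<close> and on its entropy, whereas the bound to be proved may depend only on \<open>M\<^sub>\<beta>(f\<^sub>0)\<close> and \<open>\<parallel>f\<^sub>0\<parallel>\<^sub>p\<close>. The
  argument above is therefore applied to one datum at a time, and uniformity follows by
  condensation of singularities (\<open>moment_bound_condensation\<close>): a sequence of data that violates
  every bound can be summed, with weights, to a single datum without any bound. This uses that
  the evolution is linear and positive, and that the generator determines the semigroup
  (\<open>stochastic_semigroup_unique\<close>).
\<close>

section \<open>Polar coordinates and the sphere\<close>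

lemma nn_integral_lborel_scaleR:
  fixes h :: "'a::euclidean_space \<Rightarrow> ennreal"
  assumes [measurable]: "h \<in> borel_measurable borel" and c: "c \<noteq> 0"
  shows "(\<integral>\<^sup>+x. h x \<partial>lborel) = ennreal (\<bar>c\<bar> ^ DIM('a)) * (\<integral>\<^sup>+x. h (t + c *\<^sub>R x) \<partial>lborel)"
  by (subst lborel_affine[OF c, of t])
     (simp add: nn_integral_density nn_integral_distr nn_integral_cmult)

lemma nn_integral_lborel_translate:
  fixes h :: "'a::euclidean_space \<Rightarrow> ennreal"
  assumes [measurable]: "h \<in> borel_measurable borel"
  shows "(\<integral>\<^sup>+x. h (t + x) \<partial>lborel) = (\<integral>\<^sup>+x. h x \<partial>lborel)"
  using nn_integral_lborel_scaleR[of h 1 t] by simp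

lemma nn_integral_lborel_uminus:
  fixes h :: "'a::euclidean_space \<Rightarrow> ennreal"
  assumes [measurable]: "h \<in> borel_measurable borel"
  shows "(\<integral>\<^sup>+x. h (- x) \<partial>lborel) = (\<integral>\<^sup>+x. h x \<partial>lborel)"
  using nn_integral_lborel_scaleR[of h "-1" 0] by simp

abbreviation punctured_ball :: "'a::euclidean_space set" where
  "punctured_ball \<equiv> ball 0 1 - {0}"

text \<open>The law of the direction of a point of the unit ball: surface measure of the sphere up to the
  factor \<open>d\<close>, but living on all Borel sets of the space, so that measurability of integrands
  never has to be restricted to the sphere.\<close>

definition direction_measure :: "'a::euclidean_space measure" where
  "direction_measure = distr (density lborel (indicator punctured_ball)) borel sgn"

lemma sets_direction_measure [measurable_cong, simp]: "sets direction_measure = sets borel"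
  by (simp add: direction_measure_def)

lemma nn_integral_direction_measure:
  fixes h :: "'a::euclidean_space \<Rightarrow> ennreal"
  assumes [measurable]: "h \<in> borel_measurable borel"
  shows "(\<integral>\<^sup>+\<omega>. h \<omega> \<partial>direction_measure)
    = (\<integral>\<^sup>+w. indicator punctured_ball w * h (sgn w) \<partial>lborel)"
proof -
  have [measurable]: "(indicator punctured_ball :: 'a \<Rightarrow> ennreal) \<in> borel_measurable borel"
    by (intro borel_measurable_indicator) auto
  show ?thesis by (simp add: direction_measure_def nn_integral_distr nn_integral_density)
qed

lemma finite_direction_measure: "finite_measure (direction_measure :: 'a::euclidean_space measure)"
proof
  have "emeasure direction_measure (space (direction_measure :: 'a measure))
      = (\<integral>\<^sup>+\<omega>. 1 \<partial>(direction_measure :: 'a measure))" by simp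
  also have "\<dots> = emeasure lborel (punctured_ball :: 'a set)"
    by (subst nn_integral_direction_measure) simp_all
  also have "\<dots> \<le> emeasure lborel (ball (0::'a) 1)"
    by (intro emeasure_mono) auto
  also have "\<dots> < \<infinity>" by (rule emeasure_lborel_ball_finite)
  finally show "emeasure direction_measure (space (direction_measure :: 'a measure)) \<noteq> \<infinity>" by simp
qed

lemma emeasure_punctured_ball:
  "emeasure lborel (punctured_ball :: 'a::euclidean_space set) = emeasure lborel (ball (0::'a) 1)"
  by (subst emeasure_Diff) auto

lemma punctured_ball_pos: "0 < emeasure lborel (punctured_ball :: 'a::euclidean_space set)"
  unfolding emeasure_punctured_ball by (simp add: emeasure_ball unit_ball_vol_pos)

lemma punctured_ball_finite: "emeasure lborel (punctured_ball :: 'a::euclidean_space set) < \<infinity>"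
  unfolding emeasure_punctured_ball by (rule emeasure_lborel_ball_finite)

text \<open>Dilating the unit ball by \<open>r\<close> preserves directions and multiplies volume by \<open>r\<^sup>d\<close>.\<close>

lemma emeasure_cone:
  fixes B :: "'a::euclidean_space set"
  assumes [measurable]: "B \<in> sets borel" and r: "0 < r"
  shows "emeasure lborel {u. norm u < r \<and> u \<noteq> 0 \<and> sgn u \<in> B}
    = ennreal (r ^ DIM('a)) * emeasure direction_measure B"
proof -
  have "emeasure lborel {u. norm u < r \<and> u \<noteq> 0 \<and> sgn u \<in> B}
      = (\<integral>\<^sup>+u. indicator {u. norm u < r \<and> u \<noteq> 0 \<and> sgn u \<in> B} u \<partial>lborel)"
    by simp
  also have "\<dots> = ennreal (r ^ DIM('a)) *
     (\<integral>\<^sup>+u. indicator {u. norm u < r \<and> u \<noteq> 0 \<and> sgn u \<in> B} (0 + r *\<^sub>R u) \<partial>lborel)"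
    using r by (subst nn_integral_lborel_scaleR[of _ r 0]) auto
  also have "(\<integral>\<^sup>+u. indicator {u. norm u < r \<and> u \<noteq> 0 \<and> sgn u \<in> B} (0 + r *\<^sub>R u) \<partial>lborel)
     = (\<integral>\<^sup>+u. indicator punctured_ball u * indicator B (sgn u) \<partial>lborel)"
    using r by (intro nn_integral_cong) (auto simp: indicator_def sgn_scaleR)
  also have "\<dots> = (\<integral>\<^sup>+\<omega>. indicator B \<omega> \<partial>direction_measure)"
    by (subst nn_integral_direction_measure) simp_all
  finally show ?thesis by simp
qed

text \<open>Norm and direction are independent under Lebesgue measure: on balls this is the scaling of
  cones, and balls generate the Borel sets of norms. The factor \<open>V\<close> appears because the total
  mass of the direction measure is the volume of the ball.\<close>

lemma polar_measure:
  fixes V :: ennreal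
  defines "V \<equiv> emeasure lborel (punctured_ball :: 'a::euclidean_space set)"
  shows "distr lborel borel (norm :: 'a \<Rightarrow> real) \<Otimes>\<^sub>M (direction_measure :: 'a measure)
    = scale_measure V (distr lborel (borel \<Otimes>\<^sub>M borel) (\<lambda>u::'a. (norm u, sgn u)))"
    (is "?N \<Otimes>\<^sub>M ?D = ?T")
proof (rule pair_measure_eqI)
  interpret D: finite_measure ?D by (rule finite_direction_measure)
  show "sigma_finite_measure ?D" by unfold_locales
  have ball: "{u::'a. norm u < r} = ball 0 r" "norm -` {..<r} = ball (0::'a) r" for r
    by auto
  show "sigma_finite_measure ?N"
  proof
    show "\<exists>A. countable A \<and> A \<subseteq> sets ?N \<and> \<Union> A = space ?N \<and> (\<forall>a\<in>A. emeasure ?N a \<noteq> \<infinity>)"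
    proof (intro exI[of _ "range (\<lambda>n::nat. {..<real n})"] conjI ballI)
      show "\<Union> (range (\<lambda>n::nat. {..<real n})) = space ?N"
        by (auto simp: reals_Archimedean2)
      fix a assume "a \<in> range (\<lambda>n::nat. {..<real n})"
      then obtain n :: nat where a: "a = {..<real n}" by auto
      have "emeasure ?N a = emeasure lborel (ball (0::'a) (real n))"
        unfolding a by (subst emeasure_distr) (simp_all add: ball)
      also have "\<dots> < \<infinity>" by (rule emeasure_lborel_ball_finite)
      finally show "emeasure ?N a \<noteq> \<infinity>" by simp
    qed auto
  qed
  show "sets (?N \<Otimes>\<^sub>M ?D) = sets ?T"
    by (simp cong: sets_pair_measure_cong)
  fix A :: "real set" and B :: "'a set"
  assume "A \<in> sets ?N" and "B \<in> sets ?D"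
  then have [measurable]: "A \<in> sets borel" "B \<in> sets borel" by auto
  have DU: "emeasure ?D UNIV = V"
  proof -
    have "emeasure ?D UNIV = (\<integral>\<^sup>+\<omega>. indicator UNIV \<omega> \<partial>?D)"
      by (subst nn_integral_indicator) auto
    also have "\<dots> = V" unfolding V_def by (subst nn_integral_direction_measure) simp_all
    finally show ?thesis .
  qed
  have null: "emeasure lborel {u::'a. norm u < r \<and> sgn u \<in> B'}
     = emeasure lborel {u. norm u < r \<and> u \<noteq> 0 \<and> sgn u \<in> B'}" if [measurable]: "B' \<in> sets borel" for r B'
    by (rule emeasure_eq_AE) (use AE_lborel_singleton[of "0::'a"] in \<open>auto elim!: eventually_mono\<close>)
  \<comment> \<open>Fix the set of directions and compare both sides as measures of the norm.\<close>
  define M1 where "M1 = scale_measure (emeasure ?D B) ?N"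
  define M2 where "M2 = scale_measure V (distr (density lborel (\<lambda>u::'a. indicator B (sgn u))) borel norm)"
  have s1: "sets M1 = sets borel" "sets M2 = sets borel" by (simp_all add: M1_def M2_def)
  have e1: "emeasure M1 X = emeasure ?N X * emeasure ?D B" for X
    by (simp add: M1_def mult.commute)
  have e2: "emeasure M2 X = V * emeasure lborel {u. norm u \<in> X \<and> sgn u \<in> B}"
    if [measurable]: "X \<in> sets borel" for X
  proof -
    have "emeasure (density lborel (\<lambda>u::'a. indicator B (sgn u))) (norm -` X)
       = (\<integral>\<^sup>+u. indicator B (sgn u) * indicator (norm -` X) u \<partial>lborel)"
      by (rule emeasure_density) (auto intro: measurable_sets_borel[of _ borel])
    also have "\<dots> = (\<integral>\<^sup>+u. indicator {u. norm u \<in> X \<and> sgn u \<in> B} u \<partial>lborel)"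
      by (intro nn_integral_cong) (auto simp: indicator_def)
    also have "\<dots> = emeasure lborel {u. norm u \<in> X \<and> sgn u \<in> B}" by simp
    finally show ?thesis by (simp add: M2_def emeasure_distr)
  qed
  have "M1 = M2"
  proof (rule measure_eqI_generator_eq[where E="range lessThan" and \<Omega>=UNIV and A="\<lambda>n::nat. {..<real n}"])
    show "Int_stable (range (lessThan :: real \<Rightarrow> _))"
    proof -
      have "{..<a} \<inter> {..<b} = {..<min a b}" for a b :: real by auto
      then show ?thesis by (auto simp: Int_stable_def)
    qed
    show "sets M1 = sigma_sets UNIV (range lessThan)" "sets M2 = sigma_sets UNIV (range lessThan)"
      unfolding s1 by (simp_all add: borel_Iio)
    show "(\<Union>n::nat. {..<real n}) = UNIV" by (auto simp: reals_Archimedean2)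
    have fb: "emeasure ?N {..<r} = emeasure lborel (ball (0::'a) r)" for r
      by (subst emeasure_distr) (simp_all add: ball)
    show "emeasure M1 {..<real n} \<noteq> \<infinity>" for n
      using emeasure_lborel_ball_finite[of "0::'a" "real n"] D.emeasure_finite[of B]
      by (simp add: e1 fb ennreal_mult_eq_top_iff)
    fix X :: "real set" assume "X \<in> range lessThan"
    then obtain r where X: "X = {..<r}" by auto
    show "emeasure M1 X = emeasure M2 X"
    proof (cases "0 < r")
      case False
      then have "ball (0::'a) r = {}" by auto
      then have "emeasure lborel (ball (0::'a) r) = 0" by (simp only: emeasure_empty)
      moreover have "\<And>u::'a. \<not> norm u < r" using False by (meson norm_ge_zero not_less order_trans)
      ultimately show ?thesis by (simp add: X e1 e2 fb)
    next
      case True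
      have "emeasure ?N {..<r} = emeasure lborel {u::'a. norm u < r \<and> sgn u \<in> UNIV}"
        unfolding fb ball[symmetric] by simp
      also have "\<dots> = ennreal (r ^ DIM('a)) * V"
        by (subst null, simp, subst emeasure_cone[OF _ True]) (simp_all add: DU)
      finally have "emeasure ?N {..<r} = ennreal (r ^ DIM('a)) * V" .
      moreover have "emeasure lborel {u. norm u < r \<and> sgn u \<in> B} = ennreal (r ^ DIM('a)) * emeasure ?D B"
        by (subst null, simp, subst emeasure_cone[OF _ True]) simp_all
      ultimately show ?thesis by (simp add: X e1 e2 ac_simps)
    qed
  qed auto
  then have "emeasure ?N A * emeasure ?D B = V * emeasure lborel {u. norm u \<in> A \<and> sgn u \<in> B}"
    by (metis e1 e2 \<open>A \<in> sets borel\<close>)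
  also have "\<dots> = emeasure ?T (A \<times> B)"
    by (simp add: emeasure_distr vimage_def)
  finally show "emeasure ?N A * emeasure ?D B = emeasure ?T (A \<times> B)" .
qed

lemma nn_integral_polar:
  fixes g :: "real \<times> 'a::euclidean_space \<Rightarrow> ennreal"
  assumes [measurable]: "g \<in> borel_measurable (borel \<Otimes>\<^sub>M borel)"
  shows "emeasure lborel (punctured_ball :: 'a set) * (\<integral>\<^sup>+u. g (norm u, sgn u) \<partial>lborel)
    = (\<integral>\<^sup>+r. (\<integral>\<^sup>+\<omega>. g (r, \<omega>) \<partial>direction_measure) \<partial>distr lborel borel (norm :: 'a \<Rightarrow> real))"
proof -
  interpret D: finite_measure "direction_measure :: 'a measure" by (rule finite_direction_measure)
  have "(\<integral>\<^sup>+r. (\<integral>\<^sup>+\<omega>. g (r, \<omega>) \<partial>direction_measure) \<partial>distr lborel borel (norm :: 'a \<Rightarrow> real))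
     = integral\<^sup>N (distr lborel borel (norm :: 'a \<Rightarrow> real) \<Otimes>\<^sub>M direction_measure) g"
    by (rule D.nn_integral_fst) (simp cong: measurable_cong_sets sets_pair_measure_cong)
  then show ?thesis
    unfolding polar_measure by (simp add: nn_integral_scale_measure nn_integral_distr)
qed

text \<open>The map \<open>(u, \<sigma>) \<mapsto> (|u| \<sigma>, u / |u|)\<close>, which exchanges the direction of \<open>u\<close> with \<open>\<sigma>\<close>, preserves
  measure: by independence of norm and direction, it is an exchange of two independent
  directions with the same law. This is the heart of the pre- and post-collisional change of
  variables.\<close>

lemma nn_integral_swap_directions:
  fixes H :: "'a::euclidean_space \<times> 'a \<Rightarrow> ennreal"
  assumes [measurable]: "H \<in> borel_measurable (borel \<Otimes>\<^sub>M borel)"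
  shows "(\<integral>\<^sup>+u. (\<integral>\<^sup>+\<sigma>. H (norm u *\<^sub>R \<sigma>, sgn u) \<partial>direction_measure) \<partial>lborel)
    = (\<integral>\<^sup>+u. (\<integral>\<^sup>+\<sigma>. H (u, \<sigma>) \<partial>direction_measure) \<partial>lborel)"
proof -
  have norm_sgn_eq: "norm u *\<^sub>R sgn u = u" for u :: 'a
    by (cases "u = 0") (simp_all add: sgn_div_norm)
  let ?D = "direction_measure :: 'a measure" and ?V = "emeasure lborel (punctured_ball :: 'a set)"
  let ?N = "distr lborel borel (norm :: 'a \<Rightarrow> real)"
  interpret D: finite_measure ?D by (rule finite_direction_measure)
  interpret DD: pair_sigma_finite ?D ?D ..
  have 1: "?V * (\<integral>\<^sup>+u. (\<integral>\<^sup>+\<sigma>. H (norm u *\<^sub>R \<sigma>, sgn u) \<partial>?D) \<partial>lborel)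
     = (\<integral>\<^sup>+r. (\<integral>\<^sup>+\<omega>. (\<integral>\<^sup>+\<sigma>. H (r *\<^sub>R \<sigma>, \<omega>) \<partial>?D) \<partial>?D) \<partial>?N)"
    using nn_integral_polar[of "\<lambda>(r, \<omega>). (\<integral>\<^sup>+\<sigma>. H (r *\<^sub>R \<sigma>, \<omega>) \<partial>?D)"] by simp
  have 2: "?V * (\<integral>\<^sup>+u. (\<integral>\<^sup>+\<sigma>. H (u, \<sigma>) \<partial>?D) \<partial>lborel)
     = (\<integral>\<^sup>+r. (\<integral>\<^sup>+\<omega>. (\<integral>\<^sup>+\<sigma>. H (r *\<^sub>R \<omega>, \<sigma>) \<partial>?D) \<partial>?D) \<partial>?N)"
    using nn_integral_polar[of "\<lambda>(r, \<omega>). (\<integral>\<^sup>+\<sigma>. H (r *\<^sub>R \<omega>, \<sigma>) \<partial>?D)"]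
    by (simp add: norm_sgn_eq)
  have "(\<integral>\<^sup>+\<omega>. (\<integral>\<^sup>+\<sigma>. H (r *\<^sub>R \<sigma>, \<omega>) \<partial>?D) \<partial>?D) = (\<integral>\<^sup>+\<omega>. (\<integral>\<^sup>+\<sigma>. H (r *\<^sub>R \<omega>, \<sigma>) \<partial>?D) \<partial>?D)" for r
    using DD.Fubini'[of "\<lambda>\<sigma> \<omega>. H (r *\<^sub>R \<sigma>, \<omega>)"] by simp
  with 1 2 have "?V * (\<integral>\<^sup>+u. (\<integral>\<^sup>+\<sigma>. H (norm u *\<^sub>R \<sigma>, sgn u) \<partial>?D) \<partial>lborel)
    = ?V * (\<integral>\<^sup>+u. (\<integral>\<^sup>+\<sigma>. H (u, \<sigma>) \<partial>?D) \<partial>lborel)" by simp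
  then show ?thesis
    using punctured_ball_pos[where 'a='a] punctured_ball_finite[where 'a='a]
    by (auto simp: ennreal_mult_cancel_left)
qed

lemma direction_measure_uminus:
  fixes h :: "'a::euclidean_space \<Rightarrow> ennreal"
  assumes [measurable]: "h \<in> borel_measurable borel"
  shows "(\<integral>\<^sup>+\<sigma>. h (- \<sigma>) \<partial>direction_measure) = (\<integral>\<^sup>+\<sigma>. h \<sigma> \<partial>direction_measure)"
  using nn_integral_lborel_uminus[of "\<lambda>w::'a. indicator punctured_ball w * h (sgn w)"]
  by (simp add: nn_integral_direction_measure sgn_minus indicator_def)

lemma nn_integral_sphere_measure:
  fixes h :: "real ^ 'n \<Rightarrow> ennreal"
  assumes [measurable]: "h \<in> borel_measurable borel"
  shows "(\<integral>\<^sup>+\<sigma>. h \<sigma> \<partial>sphere_measure) = ennreal (real CARD('n)) * (\<integral>\<^sup>+\<sigma>. h \<sigma> \<partial>direction_measure)"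
proof -
  have [measurable]: "sgn \<in> restrict_space lborel (punctured_ball :: (real^'n) set)
      \<rightarrow>\<^sub>M restrict_space borel (sphere 0 1)"
    by (intro measurable_restrict_space3) (auto simp: norm_sgn)
  have "h \<in> borel_measurable (restrict_space borel (sphere 0 1))"
    by (rule measurable_restrict_space1) simp
  then have "(\<integral>\<^sup>+\<sigma>. h \<sigma> \<partial>sphere_measure) = ennreal (real CARD('n)) *
     (\<integral>\<^sup>+w. h (sgn w) \<partial>(restrict_space lborel (punctured_ball :: (real^'n) set)))"
    unfolding sphere_measure_def
    by (simp add: nn_integral_scale_measure nn_integral_distr)
  then show ?thesis
    by (subst (asm) nn_integral_restrict_space)
       (auto simp: nn_integral_direction_measure mult.commute)
qed

lemma space_sphere_measure: "space (sphere_measure :: (real^'n) measure) = sphere 0 1"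
  by (simp add: sphere_measure_def space_restrict_space space_scale_measure)

lemma sets_sphere_measure [measurable_cong]:
  "sets (sphere_measure :: (real^'n) measure) = sets (restrict_space borel (sphere 0 1))"
  by (simp add: sphere_measure_def)

lemma finite_sphere_measure: "finite_measure (sphere_measure :: (real^'n) measure)"
proof
  interpret D: finite_measure "direction_measure :: (real^'n) measure" by (rule finite_direction_measure)
  have "emeasure sphere_measure (space (sphere_measure :: (real^'n) measure))
     = (\<integral>\<^sup>+\<sigma>. 1 \<partial>(sphere_measure :: (real^'n) measure))" by simp
  also have "\<dots> = ennreal (real CARD('n)) * emeasure direction_measure (space (direction_measure :: (real^'n) measure))"
    by (subst nn_integral_sphere_measure) simp_all
  also have "\<dots> \<noteq> \<infinity>" using D.emeasure_finite by (simp add: ennreal_mult_eq_top_iff)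
  finally show "emeasure sphere_measure (space (sphere_measure :: (real^'n) measure)) \<noteq> \<infinity>" .
qed

section \<open>The Maxwellian and the singular kernel\<close>

lemma Maxwellian_pos: "0 < Maxwellian v"
  by (simp add: Maxwellian_def)

lemma borel_measurable_Maxwellian [measurable]: "Maxwellian \<in> borel_measurable borel"
  unfolding Maxwellian_def by measurable

lemma borel_measurable_bracket [measurable]: "bracket \<in> borel_measurable borel"
  unfolding bracket_def by measurable

lemma bracket_ge_1: "1 \<le> bracket v"
  by (simp add: bracket_def)

text \<open>The Maxwellian is a product of one-dimensional standard normal densities, which gives its
  unit mass. That mass enters the entropy estimate through \<open>\<integral> (M - f) = 0\<close>.\<close>

lemma Maxwellian_eq_prod:
  "Maxwellian (v :: real^'n) = (\<Prod>e\<in>Basis. std_normal_density (v \<bullet> e))"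
proof -
  have "(norm v)\<^sup>2 = (\<Sum>e\<in>Basis. (v \<bullet> e)\<^sup>2)"
    unfolding power2_norm_eq_inner by (subst euclidean_inner) (simp add: power2_eq_square)
  then have "exp (- (norm v)\<^sup>2 / 2) = (\<Prod>e\<in>Basis. exp (- (v \<bullet> e)\<^sup>2 / 2))"
    by (simp add: exp_sum[symmetric] sum_negf sum_divide_distrib[symmetric])
  moreover have "(2 * pi) powr (- real CARD('n) / 2) = (1 / sqrt (2 * pi)) ^ CARD('n)"
  proof -
    have "(2 * pi) powr (- real CARD('n) / 2) = ((2 * pi) powr (-1/2)) powr real CARD('n)"
      by (simp add: powr_powr)
    also have "(2 * pi) powr (-1/2) = 1 / sqrt (2 * pi)"
      by (simp add: powr_minus_divide powr_half_sqrt)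
    finally show ?thesis by (simp add: powr_realpow)
  qed
  ultimately show ?thesis
    by (simp add: Maxwellian_def std_normal_density_def prod_dividef power_divide)
qed

lemma nn_integral_Maxwellian: "(\<integral>\<^sup>+v. ennreal (Maxwellian v) \<partial>lborel) = 1"
proof -
  have "(\<integral>\<^sup>+x. ennreal (std_normal_density x) \<partial>lborel) = 1"
    by (subst nn_integral_eq_integral) auto
  then show ?thesis
    using nn_integral_lborel_prod[of "\<lambda>(_::real^'n) x. ennreal (std_normal_density x)"]
    by (simp add: Maxwellian_eq_prod prod_ennreal)
qed

lemma has_bochner_integral_Maxwellian: "has_bochner_integral lborel Maxwellian 1"
  by (rule has_bochner_integral_nn_integral)
     (auto simp: nn_integral_Maxwellian less_imp_le[OF Maxwellian_pos])

lemma Maxwellian_le_1: "Maxwellian v \<le> 1"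
proof -
  have "(2 * pi) powr (- real CARD('n) / 2) \<le> (2 * pi) powr 0"
    using pi_ge_two by (intro powr_mono) auto
  then show ?thesis unfolding Maxwellian_def by (intro mult_le_one) auto
qed

text \<open>The tangent of the logarithm at \<open>4 q\<close>: \<open>ln y \<le> y / (4 q) - 1 + ln (4 q)\<close>, multiplied by \<open>q\<close>.\<close>

lemma powr_le_exp:
  fixes x q :: real
  assumes "0 \<le> x" "0 < q"
  shows "(1 + x) powr q \<le> exp (1 / 4 - q + q * ln (4 * q)) * exp (x / 4)"
proof -
  have "ln ((1 + x) / (4 * q)) \<le> (1 + x) / (4 * q) - 1"
    using assms by (intro ln_le_minus_one) auto
  then have "ln (1 + x) \<le> (1 + x) / (4 * q) - 1 + ln (4 * q)"
    using assms by (simp add: ln_div)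
  then have "q * ln (1 + x) \<le> q * ((1 + x) / (4 * q) - 1 + ln (4 * q))"
    using assms by (intro mult_left_mono) auto
  also have "\<dots> = (1 / 4 - q + q * ln (4 * q)) + x / 4"
    using assms by (simp add: field_simps)
  finally show ?thesis
    using assms by (simp add: powr_def exp_add[symmetric])
qed

lemma bracket_powr: "bracket v powr \<beta> = (1 + (norm v)\<^sup>2) powr (\<beta> / 2)"
  by (simp add: bracket_def powr_half_sqrt[symmetric] powr_powr)

text \<open>Half of the Gaussian decay absorbs any power weight, and what remains is again a Maxwellian,
  with dilated argument; so weighted Maxwellians inherit boundedness and integrability.\<close>

lemma weighted_Maxwellian_le:
  assumes "0 < \<beta>"
  obtains C where "0 < C"
    "\<And>v :: real^'n. bracket v powr \<beta> * Maxwellian v \<le> C * Maxwellian ((1 / sqrt 2) *\<^sub>R v)"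
proof
  define C where "C = exp (1 / 4 - \<beta>/2 + \<beta>/2 * ln (4 * (\<beta>/2)))"
  show "0 < C" by (simp add: C_def)
  fix v :: "real^'n"
  have "(1 + (norm v)\<^sup>2) powr (\<beta>/2) * exp (- (norm v)\<^sup>2 / 2) \<le> (C * exp ((norm v)\<^sup>2 / 4)) * exp (- (norm v)\<^sup>2 / 2)"
    unfolding C_def using assms by (intro mult_right_mono powr_le_exp) auto
  also have "\<dots> = C * exp (- (norm v)\<^sup>2 / 4)"
    by (simp add: exp_add[symmetric] mult.assoc)
  also have "\<dots> = C * exp (- (norm ((1 / sqrt 2) *\<^sub>R v))\<^sup>2 / 2)"
    by (simp add: power_divide)
  finally show "bracket v powr \<beta> * Maxwellian v \<le> C * Maxwellian ((1 / sqrt 2) *\<^sub>R v)"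
    unfolding bracket_powr Maxwellian_def
    by (simp add: mult.left_commute mult_left_mono)
qed

lemma nn_integral_weighted_Maxwellian:
  assumes "0 < \<beta>"
  shows "(\<integral>\<^sup>+(v::real^'n). ennreal (bracket v powr \<beta> * Maxwellian v) \<partial>lborel) < \<infinity>"
proof -
  obtain C where C: "0 < C"
    "\<And>v :: real^'n. bracket v powr \<beta> * Maxwellian v \<le> C * Maxwellian ((1 / sqrt 2) *\<^sub>R v)"
    using weighted_Maxwellian_le[OF assms] by blast
  let ?J = "\<integral>\<^sup>+(v::real^'n). ennreal (Maxwellian (0 + (1 / sqrt 2) *\<^sub>R v)) \<partial>lborel"
  have "1 = ennreal (\<bar>1 / sqrt 2\<bar> ^ DIM(real^'n)) * ?J"
    unfolding nn_integral_Maxwellian[symmetric, where 'a='n]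
    by (rule nn_integral_lborel_scaleR) auto
  then have J: "?J < \<infinity>"
    by (auto simp: top.not_eq_extremum[symmetric] ennreal_mult_top)
  have "(\<integral>\<^sup>+(v::real^'n). ennreal (bracket v powr \<beta> * Maxwellian v) \<partial>lborel)
    \<le> (\<integral>\<^sup>+(v::real^'n). ennreal C * ennreal (Maxwellian (0 + (1 / sqrt 2) *\<^sub>R v)) \<partial>lborel)"
    using C by (intro nn_integral_mono) (auto simp: ennreal_mult[symmetric] less_imp_le Maxwellian_pos intro!: ennreal_leI)
  also have "\<dots> = ennreal C * ?J"
    by (subst nn_integral_cmult) auto
  also have "\<dots> < \<infinity>" using J by (simp add: ennreal_mult_less_top)
  finally show ?thesis .
qed

text \<open>The dyadic shell \<open>1 / 2 ^ (n + 1) \<le> x < 1 / 2 ^ n\<close> that contains \<open>x\<close>.\<close>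

lemma powr_dyadic_le:
  fixes x \<gamma> :: real
  assumes "0 < x" "x < 1" "\<gamma> < 0"
  shows "\<exists>n::nat. x < 1 / 2 ^ n \<and> x powr \<gamma> \<le> 2 powr (- \<gamma>) * (2 powr (- \<gamma>)) ^ n"
proof -
  define n where "n = (LEAST n::nat. 1 / 2 ^ Suc n \<le> x)"
  have "\<exists>n::nat. 1 / 2 ^ Suc n \<le> x"
  proof -
    obtain n where "(1/2) ^ n < x" using real_arch_pow_inv[of x "1/2"] assms by auto
    then have "1 / 2 ^ Suc n \<le> x" by (simp add: power_one_over field_simps)
      then show ?thesis by blast
  qed
  then have n: "1 / 2 ^ Suc n \<le> x" unfolding n_def by (rule LeastI_ex)
  have "x < 1 / 2 ^ n"
  proof (cases n)
    case (Suc m)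
    then have "\<not> 1 / 2 ^ Suc m \<le> x" using not_less_Least[of m "\<lambda>n. 1 / 2 ^ Suc n \<le> x"] n_def by auto
    then show ?thesis using Suc by simp
  qed (use assms in simp)
  moreover have "x powr \<gamma> \<le> (1 / 2 ^ Suc n) powr \<gamma>"
    using assms n by (intro powr_mono2') auto
  moreover have "(1 / 2 ^ Suc n :: real) = 2 powr (- real (Suc n))"
    by (subst powr_minus_divide, subst powr_realpow) auto
  then have "(1 / 2 ^ Suc n :: real) powr \<gamma> = 2 powr (- \<gamma>) * (2 powr (- \<gamma>)) ^ n"
    by (simp add: powr_powr powr_add[symmetric] powr_realpow[symmetric] algebra_simps)
  ultimately show ?thesis by auto
qed

text \<open>Dyadic decomposition: the shell of radius \<open>2\<^sup>-\<^sup>n\<close> contributes at most a constant times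
  \<open>2 powr (- n (\<gamma> + d))\<close>, a convergent geometric series because \<open>\<gamma> > - d\<close>. This is the only place
  where the lower bound on \<open>\<gamma>\<close> matters.\<close>

lemma nn_integral_norm_powr_ball:
  assumes "- real DIM('a) < \<gamma>" "\<gamma> < 0"
  shows "(\<integral>\<^sup>+(u::'a::euclidean_space). ennreal (norm u powr \<gamma>) * indicator (ball 0 1) u \<partial>lborel) < \<infinity>"
proof -
  let ?B = "\<lambda>n::nat. ball (0::'a) (1 / 2 ^ n)" and ?p = "(2::real) powr (- \<gamma>)"
  let ?c = "\<lambda>n::nat. ?p * ?p ^ n"
  have "ennreal (norm u powr \<gamma>) * indicator (ball 0 1) u \<le> (\<Sum>n. ennreal (?c n) * indicator (?B n) u)" for u :: 'a
  proof (cases "u \<noteq> 0 \<and> norm u < 1")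
    case True
    then obtain n :: nat where n: "norm u < 1 / 2 ^ n" "norm u powr \<gamma> \<le> ?c n"
      using powr_dyadic_le[of "norm u" \<gamma>] assms by auto
    have "ennreal (norm u powr \<gamma>) * indicator (ball 0 1) u \<le> ennreal (?c n) * indicator (?B n) u"
      using n True by (auto intro: ennreal_leI)
    also have "\<dots> \<le> (\<Sum>n. ennreal (?c n) * indicator (?B n) u)"
    proof -
      have "F n \<le> suminf F" for F :: "nat \<Rightarrow> ennreal"
        using sum_le_suminf[of F "{n}"] by simp
      then show ?thesis .
    qed
    finally show ?thesis .
  qed auto
  then have "(\<integral>\<^sup>+(u::'a). ennreal (norm u powr \<gamma>) * indicator (ball 0 1) u \<partial>lborel)
    \<le> (\<integral>\<^sup>+u. (\<Sum>n. ennreal (?c n) * indicator (?B n) u) \<partial>lborel)"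
    by (intro nn_integral_mono) auto
  also have "\<dots> = (\<Sum>n. (\<integral>\<^sup>+u. ennreal (?c n) * indicator (?B n) u \<partial>lborel))"
    by (rule nn_integral_suminf) (intro borel_measurable_times_ennreal borel_measurable_const borel_measurable_indicator; simp)
  also have "\<dots> = (\<Sum>n. ennreal (?p * unit_ball_vol DIM('a) * (2 powr (- \<gamma> - real DIM('a))) ^ n))"
  proof (intro suminf_cong)
    fix n :: nat
    have e: "(2 powr (- \<gamma> - real DIM('a))) ^ n = ?p ^ n * (1 / 2 ^ n) ^ DIM('a)"
    proof -
      have "2 powr (- \<gamma> - real DIM('a)) = ?p * (1 / 2 ^ DIM('a))"
        by (subst diff_conv_add_uminus, subst powr_add) (simp add: powr_minus_divide powr_realpow)
      then show ?thesis
        by (simp add: power_mult_distrib power_divide power_mult[symmetric] mult.commute)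
    qed
    have "(\<integral>\<^sup>+u. ennreal (?c n) * indicator (?B n) u \<partial>lborel) = ennreal (?c n) * emeasure lborel (?B n)"
      by (subst nn_integral_cmult_indicator) auto
    also have "\<dots> = ennreal (?c n * (unit_ball_vol DIM('a) * (1 / 2 ^ n) ^ DIM('a)))"
      by (simp add: emeasure_ball ennreal_mult)
    finally show "(\<integral>\<^sup>+u. ennreal (?c n) * indicator (?B n) u \<partial>lborel)
       = ennreal (?p * unit_ball_vol DIM('a) * (2 powr (- \<gamma> - real DIM('a))) ^ n)"
      by (simp add: e ac_simps)
  qed
  also have "\<dots> < \<infinity>"
  proof -
    have "2 powr (- \<gamma> - real DIM('a)) < 2 powr (0::real)"
      using assms by (intro powr_less_mono) auto
    then have "summable (\<lambda>n. ?p * unit_ball_vol DIM('a) * (2 powr (- \<gamma> - real DIM('a))) ^ n)"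
      by (intro summable_mult summable_geometric) auto
    then show ?thesis
      by (subst suminf_ennreal2) auto
  qed
  finally show ?thesis .
qed

text \<open>Near the singularity \<open>g\<close> is bounded and the kernel is integrable; at distance at least \<open>1\<close> the
  kernel is at most \<open>1\<close> and \<open>g\<close> is integrable.\<close>

lemma nn_integral_kernel_bounded:
  fixes g :: "'a::euclidean_space \<Rightarrow> real"
  assumes "- real DIM('a) < \<gamma>" "\<gamma> < 0"
    and [measurable]: "g \<in> borel_measurable borel"
    and g: "\<And>x. 0 \<le> g x" "\<And>x. g x \<le> G" "(\<integral>\<^sup>+x. ennreal (g x) \<partial>lborel) < \<infinity>"
  obtains K where "0 \<le> K"
    "\<And>v. (\<integral>\<^sup>+x. ennreal (norm (v - x) powr \<gamma> * g x) \<partial>lborel) \<le> ennreal K"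
proof -
  define J where "J = (\<integral>\<^sup>+(u::'a). ennreal (norm u powr \<gamma>) * indicator (ball 0 1) u \<partial>lborel)"
  have G: "0 \<le> G" using g(1,2) order_trans by blast
  have J: "J < \<infinity>" unfolding J_def using nn_integral_norm_powr_ball assms by blast
  define T where "T = ennreal G * J + (\<integral>\<^sup>+x. ennreal (g x) \<partial>lborel)"
  have T: "T < \<infinity>" using J g(3) by (simp add: T_def ennreal_mult_less_top)
  have "(\<integral>\<^sup>+x. ennreal (norm (v - x) powr \<gamma> * g x) \<partial>lborel) \<le> T" for v
  proof -
    define h where "h = (\<lambda>u::'a. ennreal (norm u powr \<gamma>) * indicator (ball 0 1) u)"
    have [measurable]: "h \<in> borel_measurable borel"
      unfolding h_def by (intro borel_measurable_times_ennreal borel_measurable_indicator) simp_all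
    have "(\<integral>\<^sup>+x. ennreal (norm (v - x) powr \<gamma> * g x) \<partial>lborel)
      \<le> (\<integral>\<^sup>+x. ennreal G * h (v - x) + ennreal (g x) \<partial>lborel)"
    proof (rule nn_integral_mono)
      fix x
      show "ennreal (norm (v - x) powr \<gamma> * g x)
        \<le> ennreal G * h (v - x) + ennreal (g x)"
      proof (cases "norm (v - x) < 1")
        case True
        then have "ennreal (norm (v - x) powr \<gamma> * g x)
          \<le> ennreal G * h (v - x)"
          using g G by (auto simp: h_def ennreal_mult[symmetric] mult.commute intro!: ennreal_leI mult_right_mono)
        then show ?thesis by (simp add: add_increasing2)
      next
        case False
        then have "norm (v - x) powr \<gamma> \<le> norm (v - x) powr 0"
          using assms by (intro powr_mono) auto
        then have "norm (v - x) powr \<gamma> * g x \<le> 1 * g x"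
          using g by (intro mult_right_mono) (auto split: if_splits)
        then show ?thesis using False by (auto simp: h_def intro!: ennreal_leI)
      qed
    qed
    also have "\<dots> = ennreal G * (\<integral>\<^sup>+x. h (v - x) \<partial>lborel)
       + (\<integral>\<^sup>+x. ennreal (g x) \<partial>lborel)"
      by (subst nn_integral_add) (auto simp: nn_integral_cmult)
    also have "(\<integral>\<^sup>+x. h (v - x) \<partial>lborel) = J"
    proof -
      have "(\<integral>\<^sup>+x. h (v - x) \<partial>lborel) = (\<integral>\<^sup>+x. h (v + x) \<partial>lborel)"
        using nn_integral_lborel_uminus[of "\<lambda>x. h (v + x)"] by simp
      also have "\<dots> = J" unfolding J_def h_def[symmetric] by (rule nn_integral_lborel_translate) measurable
      finally show ?thesis .
    qed
    finally show ?thesis by (simp add: T_def)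
  qed
  moreover obtain K where "0 \<le> K" "T = ennreal K" using T by (cases T) auto
  ultimately show ?thesis using that by metis
qed

lemma weighted_Maxwellian_kernel:
  assumes "- real CARD('n) < \<gamma>" "\<gamma> < 0" "0 < \<beta>"
  obtains K where "0 \<le> K"
    "\<And>v :: real^'n. (\<integral>\<^sup>+x. ennreal (norm (v - x) powr \<gamma> * (bracket x powr \<beta> * Maxwellian x)) \<partial>lborel) \<le> ennreal K"
proof -
  obtain C where C: "0 < C"
    "\<And>v :: real^'n. bracket v powr \<beta> * Maxwellian v \<le> C * Maxwellian ((1 / sqrt 2) *\<^sub>R v)"
    using weighted_Maxwellian_le[OF assms(3)] by blast
  have le_C: "bracket v powr \<beta> * Maxwellian v \<le> C" for v :: "real^'n"
    using C(2)[of v] Maxwellian_le_1[of "(1 / sqrt 2) *\<^sub>R v"] C(1)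
    by (meson mult_left_le less_imp_le order_trans)
  show ?thesis
  proof (rule nn_integral_kernel_bounded[of \<gamma> "\<lambda>x::real^'n. bracket x powr \<beta> * Maxwellian x" C])
    show "- real DIM(real^'n) < \<gamma>" using assms by simp
    show "0 \<le> bracket x powr \<beta> * Maxwellian x" for x :: "real^'n"
      by (simp add: less_imp_le[OF Maxwellian_pos])
  qed (use that assms le_C nn_integral_weighted_Maxwellian[OF assms(3)] in simp_all)
qed

section \<open>Velocity weights in a collision\<close>

lemma collision_energy:
  assumes "norm \<sigma> = 1"
  shows "(norm (post_v v vs \<sigma>))\<^sup>2 + (norm (post_vs v vs \<sigma>))\<^sup>2 = (norm v)\<^sup>2 + (norm vs)\<^sup>2"
proof -
  have par: "(norm (a + b))\<^sup>2 + (norm (a - b))\<^sup>2 = 2 * (norm a)\<^sup>2 + 2 * (norm b)\<^sup>2" for a b :: "real^'n"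
    by (simp add: power2_norm_eq_inner inner_add_left inner_add_right inner_diff_left inner_diff_right inner_commute)
  have "(norm (post_v v vs \<sigma>))\<^sup>2 + (norm (post_vs v vs \<sigma>))\<^sup>2
    = 2 * (norm ((v + vs) /\<^sub>R 2))\<^sup>2 + 2 * (norm ((norm (v - vs) / 2) *\<^sub>R \<sigma>))\<^sup>2"
    unfolding post_v_def post_vs_def by (rule par)
  also have "\<dots> = ((norm (v + vs))\<^sup>2 + (norm (v - vs))\<^sup>2) / 2"
  proof -
    have "norm ((v + vs) /\<^sub>R 2) = norm (v + vs) / 2" by simp
    then show ?thesis using assms by (simp only: norm_scaleR) (simp add: power_divide)
  qed
  also have "\<dots> = (norm v)\<^sup>2 + (norm vs)\<^sup>2"
    unfolding par by simp
  finally show ?thesis .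
qed

lemma powr_superadditive:
  fixes x y q :: real
  assumes "0 \<le> x" "0 \<le> y" "1 \<le> q"
  shows "x powr q + y powr q \<le> (x + y) powr q"
proof -
  have *: "a powr q \<le> a * (x + y) powr (q - 1)" if "0 \<le> a" "a \<le> x + y" for a
  proof (cases "a = 0")
    case False
    then have "a powr q = a * a powr (q - 1)"
      using that by (simp add: powr_mult_base)
    also have "\<dots> \<le> a * (x + y) powr (q - 1)"
      using that assms by (intro mult_left_mono powr_mono2) auto
    finally show ?thesis .
  qed simp
  have "x powr q + y powr q \<le> (x + y) * (x + y) powr (q - 1)"
    using *[of x] *[of y] assms by (simp add: algebra_simps)
  also have "\<dots> = (x + y) powr q"
    using assms by (simp add: powr_mult_base)
  finally show ?thesis .
qed

lemma powr_add_le_twice: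
  fixes q :: real
  assumes "0 < q"
  obtains C where "0 < C"
    "\<And>x y. 0 \<le> x \<Longrightarrow> 0 \<le> y \<Longrightarrow> (x + y) powr q \<le> 2 * x powr q + C * y powr q"
proof
  \<comment> \<open>Chosen so that \<open>(1 + \<delta>) powr q = 2\<close>, for the case \<open>y \<le> \<delta> x\<close>.\<close>
  define \<delta> :: real where "\<delta> = 2 powr (1 / q) - 1"
  have "2 powr 0 < (2::real) powr (1 / q)" using assms by (intro powr_less_mono) auto
  then have \<delta>: "0 < \<delta>" by (simp add: \<delta>_def)
  have "0 < 1 / \<delta> + 1" using \<delta> by (simp add: add_pos_pos)
  then show "0 < (1 / \<delta> + 1) powr q" by (metis powr_gt_zero less_irrefl)
  fix x y :: real assume xy: "0 \<le> x" "0 \<le> y"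
  show "(x + y) powr q \<le> 2 * x powr q + (1 / \<delta> + 1) powr q * y powr q"
  proof (cases "y \<le> \<delta> * x")
    case True
    then have "(x + y) powr q \<le> (2 powr (1 / q) * x) powr q"
      using xy assms by (intro powr_mono2) (auto simp: \<delta>_def algebra_simps)
    also have "\<dots> = 2 * x powr q"
      using xy assms by (simp add: powr_mult powr_powr)
    finally show ?thesis by (simp add: add_increasing2)
  next
    case False
    then have "x \<le> y / \<delta>" using \<delta> by (simp add: field_simps)
    then have "(x + y) powr q \<le> ((1 / \<delta> + 1) * y) powr q"
      using xy assms by (intro powr_mono2) (auto simp: algebra_simps)
    also have "\<dots> = (1 / \<delta> + 1) powr q * y powr q"
      using xy \<delta> by (simp add: powr_mult)
    finally show ?thesis by (simp add: add_increasing)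
  qed
qed


text \<open>A collision cannot raise the sum of the weights of both particles by much: as \<open>\<beta> / 2 \<ge> 1\<close>,
  \<open>\<langle>v'\<rangle>\<^sup>\<beta> + \<langle>v\<^sub>*'\<rangle>\<^sup>\<beta>\<close> is at most \<open>(\<langle>v'\<rangle>\<^sup>2 + \<langle>v\<^sub>*'\<rangle>\<^sup>2) powr (\<beta> / 2)\<close>, the energy is conserved, and
  \<open>(\<langle>v\<rangle>\<^sup>2 + \<langle>v\<^sub>*\<rangle>\<^sup>2) powr (\<beta> / 2) \<le> 2 \<langle>v\<rangle>\<^sup>\<beta> + C \<langle>v\<^sub>*\<rangle>\<^sup>\<beta>\<close>. The factor \<open>2\<close> is exactly what the loss term
  compensates after averaging over \<open>\<sigma>\<close> and \<open>- \<sigma>\<close>. The estimate survives truncation at any level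
  \<open>R\<close> with the same \<open>C\<close>: if \<open>\<langle>v\<rangle>\<^sup>\<beta> \<ge> R\<close> the right-hand side is at least \<open>2 R\<close>.\<close>

lemma truncated_weight_collision:
  assumes "2 \<le> \<beta>"
  obtains C where "0 < C"
    "\<And>R v vs (\<sigma> :: real^'n). norm \<sigma> = 1 \<Longrightarrow>
       min R (bracket (post_v v vs \<sigma>) powr \<beta>) + min R (bracket (post_vs v vs \<sigma>) powr \<beta>)
       \<le> 2 * min R (bracket v powr \<beta>) + 2 * (C * bracket vs powr \<beta>)"
proof -
  obtain C where C: "0 < C"
    "\<And>x y. 0 \<le> x \<Longrightarrow> 0 \<le> y \<Longrightarrow> (x + y) powr (\<beta>/2) \<le> 2 * x powr (\<beta>/2) + C * y powr (\<beta>/2)"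
    using powr_add_le_twice[of "\<beta>/2"] assms by auto
  have "min R (bracket (post_v v vs \<sigma>) powr \<beta>) + min R (bracket (post_vs v vs \<sigma>) powr \<beta>)
       \<le> 2 * min R (bracket v powr \<beta>) + 2 * (C / 2 * bracket vs powr \<beta>)"
    if "norm \<sigma> = 1" for R v vs and \<sigma> :: "real^'n"
  proof -
    have w: "0 \<le> C * bracket vs powr \<beta>" using C by simp
    have "bracket (post_v v vs \<sigma>) powr \<beta> + bracket (post_vs v vs \<sigma>) powr \<beta>
      \<le> ((1 + (norm (post_v v vs \<sigma>))\<^sup>2) + (1 + (norm (post_vs v vs \<sigma>))\<^sup>2)) powr (\<beta>/2)"
      unfolding bracket_powr using assms by (intro powr_superadditive) auto
    also have "\<dots> = ((1 + (norm v)\<^sup>2) + (1 + (norm vs)\<^sup>2)) powr (\<beta>/2)"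
      using collision_energy[OF that, of v vs] by (simp add: algebra_simps)
    also have "\<dots> \<le> 2 * bracket v powr \<beta> + C * bracket vs powr \<beta>"
      unfolding bracket_powr by (rule C(2)) auto
    finally show ?thesis using w by (auto simp: min_def)
  qed
  then show ?thesis using that[of "C/2"] C(1) by auto
qed

section \<open>The pre- and post-collisional change of variables\<close>

text \<open>Centre of mass \<open>V = (v + v\<^sub>*) / 2\<close> and relative velocity \<open>u = v - v\<^sub>*\<close>; the Jacobian is \<open>1\<close>
  because each of the two steps is a translation.\<close>

lemma nn_integral_relative_coordinates:
  fixes G :: "'a::euclidean_space \<times> 'a \<Rightarrow> ennreal"
  assumes [measurable]: "G \<in> borel_measurable (borel \<Otimes>\<^sub>M borel)"
  shows "(\<integral>\<^sup>+v. (\<integral>\<^sup>+vs. G (v, vs) \<partial>lborel) \<partial>lborel)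
    = (\<integral>\<^sup>+V. (\<integral>\<^sup>+u. G (V + (1/2) *\<^sub>R u, V - (1/2) *\<^sub>R u) \<partial>lborel) \<partial>lborel)"
proof -
  have "(\<integral>\<^sup>+v. (\<integral>\<^sup>+vs. G (v, vs) \<partial>lborel) \<partial>lborel) = (\<integral>\<^sup>+vs. (\<integral>\<^sup>+v. G (v, vs) \<partial>lborel) \<partial>lborel)"
    by (rule lborel_pair.Fubini'[symmetric]) simp
  also have "\<dots> = (\<integral>\<^sup>+vs. (\<integral>\<^sup>+u. G (vs + u, vs) \<partial>lborel) \<partial>lborel)"
    by (intro nn_integral_cong nn_integral_lborel_translate[symmetric]) simp
  also have "\<dots> = (\<integral>\<^sup>+u. (\<integral>\<^sup>+vs. G (vs + u, vs) \<partial>lborel) \<partial>lborel)"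
    by (rule lborel_pair.Fubini'[symmetric]) simp
  also have "\<dots> = (\<integral>\<^sup>+u. (\<integral>\<^sup>+V. G (V + (1/2) *\<^sub>R u, V - (1/2) *\<^sub>R u) \<partial>lborel) \<partial>lborel)"
  proof (rule nn_integral_cong)
    fix u :: 'a
    have "(1/2) *\<^sub>R u + (1/2) *\<^sub>R u = u" by (simp flip: scaleR_add_left)
    then have eq: "- ((1/2) *\<^sub>R u) + V = V - (1/2) *\<^sub>R u" "V - (1/2) *\<^sub>R u + u = V + (1/2) *\<^sub>R u" for V
      by (simp_all add: algebra_simps)
    have "(\<lambda>vs. G (vs + u, vs)) \<in> borel_measurable borel" by measurable
    note this[THEN nn_integral_lborel_translate, of "- ((1/2) *\<^sub>R u)", symmetric]
    then show "(\<integral>\<^sup>+vs. G (vs + u, vs) \<partial>lborel) = (\<integral>\<^sup>+V. G (V + (1/2) *\<^sub>R u, V - (1/2) *\<^sub>R u) \<partial>lborel)"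
      unfolding eq .
  qed
  also have "\<dots> = (\<integral>\<^sup>+V. (\<integral>\<^sup>+u. G (V + (1/2) *\<^sub>R u, V - (1/2) *\<^sub>R u) \<partial>lborel) \<partial>lborel)"
    by (rule lborel_pair.Fubini') simp
  finally show ?thesis .
qed

lemma AE_direction_measure: "AE \<sigma> in (direction_measure :: 'a::euclidean_space measure). norm \<sigma> = 1"
proof -
  have [measurable]: "(indicator punctured_ball :: 'a \<Rightarrow> ennreal) \<in> borel_measurable borel"
    by (intro borel_measurable_indicator) auto
  have "AE x in density lborel (indicator punctured_ball). norm (sgn x :: 'a) = 1"
    by (subst AE_density) (auto simp: norm_sgn indicator_def)
  then show ?thesis unfolding direction_measure_def by (subst AE_distr_iff) auto
qed

lemma nn_integral_direction_cong:
  assumes "\<And>\<sigma>. norm \<sigma> = 1 \<Longrightarrow> f \<sigma> = g \<sigma>"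
  shows "(\<integral>\<^sup>+\<sigma>. f \<sigma> \<partial>direction_measure) = (\<integral>\<^sup>+\<sigma>. g \<sigma> \<partial>direction_measure)"
  by (rule nn_integral_cong_AE) (use AE_direction_measure in \<open>auto elim!: eventually_mono simp: assms\<close>)

lemma borel_measurable_post_v [measurable (raw)]:
  assumes [measurable]: "f \<in> borel_measurable M" "g \<in> borel_measurable M" "h \<in> borel_measurable M"
  shows "(\<lambda>x. post_v (f x) (g x) (h x)) \<in> borel_measurable M"
  unfolding post_v_def by measurable

lemma borel_measurable_post_vs [measurable (raw)]:
  assumes [measurable]: "f \<in> borel_measurable M" "g \<in> borel_measurable M" "h \<in> borel_measurable M"
  shows "(\<lambda>x. post_vs (f x) (g x) (h x)) \<in> borel_measurable M"
  unfolding post_vs_def by measurable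

lemma cos_dev_eq: "cos_dev v vs \<sigma> = sgn (v - vs) \<bullet> \<sigma>"
  by (simp add: cos_dev_def sgn_div_norm)

lemma borel_measurable_cos_dev [measurable (raw)]:
  assumes [measurable]: "f \<in> borel_measurable M" "g \<in> borel_measurable M" "h \<in> borel_measurable M"
  shows "(\<lambda>x. cos_dev (f x) (g x) (h x)) \<in> borel_measurable M"
  unfolding cos_dev_eq by measurable

definition collision_rate ::
    "real \<Rightarrow> (real \<Rightarrow> real) \<Rightarrow> real ^ 'n \<Rightarrow> real ^ 'n \<Rightarrow> real ^ 'n \<Rightarrow> real" where
  "collision_rate \<gamma> c v vs \<sigma> = norm (v - vs) powr \<gamma> * c (cos_dev v vs \<sigma>)"

lemma borel_measurable_collision_rate [measurable (raw)]:
  assumes [measurable]: "f \<in> borel_measurable M" "g \<in> borel_measurable M" "h \<in> borel_measurable M"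
    "c \<in> borel_measurable borel"
  shows "(\<lambda>x. collision_rate \<gamma> c (f x) (g x) (h x)) \<in> borel_measurable M"
  unfolding collision_rate_def by measurable

text \<open>In the variables \<open>V\<close>, \<open>u\<close> the collision keeps \<open>V\<close> and \<open>|u|\<close> and replaces the direction of \<open>u\<close>
  by \<open>\<sigma>\<close>, so passing from pre- to post-collisional velocities is the exchange of directions
  above. The collision rate depends only on \<open>|u|\<close> and on the angle between both directions, and
  is therefore invariant.\<close>

lemma collision_change_of_variables:
  fixes \<Phi> :: "(real^'n) \<times> (real^'n) \<times> (real^'n) \<times> (real^'n) \<Rightarrow> ennreal"
  assumes [measurable]: "c \<in> borel_measurable borel"
    "\<Phi> \<in> borel_measurable (borel \<Otimes>\<^sub>M borel \<Otimes>\<^sub>M borel \<Otimes>\<^sub>M borel)"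
  shows "(\<integral>\<^sup>+v. (\<integral>\<^sup>+vs. (\<integral>\<^sup>+\<sigma>. ennreal (collision_rate \<gamma> c v vs \<sigma>) *
            \<Phi> (post_v v vs \<sigma>, post_vs v vs \<sigma>, v, vs) \<partial>direction_measure) \<partial>lborel) \<partial>lborel)
    = (\<integral>\<^sup>+v. (\<integral>\<^sup>+vs. (\<integral>\<^sup>+\<sigma>. ennreal (collision_rate \<gamma> c v vs \<sigma>) *
            \<Phi> (v, vs, post_v v vs \<sigma>, post_vs v vs \<sigma>) \<partial>direction_measure) \<partial>lborel) \<partial>lborel)"
proof -
  interpret D: finite_measure "direction_measure :: (real^'n) measure" by (rule finite_direction_measure)
  define Z where "Z V u \<sigma> = ennreal (norm u powr \<gamma> * c (sgn u \<bullet> \<sigma>)) *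
     \<Phi> (V + (1/2) *\<^sub>R u, V - (1/2) *\<^sub>R u, V + (norm u / 2) *\<^sub>R \<sigma>, V - (norm u / 2) *\<^sub>R \<sigma>)" for V u \<sigma>
  have half: "(V + (1/2) *\<^sub>R u) + (V - (1/2) *\<^sub>R u) = 2 *\<^sub>R V" "(V + (1/2) *\<^sub>R u) - (V - (1/2) *\<^sub>R u) = u" for V u :: "real^'n"
    by (simp_all add: scaleR_2 scaleR_half_double flip: scaleR_add_left)
  have post: "post_v (V + (1/2) *\<^sub>R u) (V - (1/2) *\<^sub>R u) \<sigma> = V + (norm u / 2) *\<^sub>R \<sigma>"
      "post_vs (V + (1/2) *\<^sub>R u) (V - (1/2) *\<^sub>R u) \<sigma> = V - (norm u / 2) *\<^sub>R \<sigma>"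
      "collision_rate \<gamma> c (V + (1/2) *\<^sub>R u) (V - (1/2) *\<^sub>R u) \<sigma> = norm u powr \<gamma> * c (sgn u \<bullet> \<sigma>)" for V u \<sigma> :: "real^'n"
    by (simp_all only: post_v_def post_vs_def collision_rate_def cos_dev_eq half) simp_all
  have [measurable]: "(\<lambda>(u, \<sigma>). Z V u \<sigma>) \<in> borel_measurable (borel \<Otimes>\<^sub>M borel)" for V
    unfolding Z_def by measurable
  have swap: "Z V (norm u *\<^sub>R \<sigma>) (sgn u) = ennreal (norm u powr \<gamma> * c (sgn u \<bullet> \<sigma>)) *
     \<Phi> (V + (norm u / 2) *\<^sub>R \<sigma>, V - (norm u / 2) *\<^sub>R \<sigma>, V + (1/2) *\<^sub>R u, V - (1/2) *\<^sub>R u)"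
    if "norm \<sigma> = 1" for V u \<sigma>
  proof (cases "u = 0")
    case True
    then show ?thesis by (simp add: Z_def)
  next
    case False
    then have eqs: "sgn (norm u *\<^sub>R \<sigma>) = \<sigma>" "norm (norm u *\<^sub>R \<sigma>) = norm u"
      "(norm u / 2) *\<^sub>R sgn u = (1/2) *\<^sub>R u" "(1/2) *\<^sub>R (norm u *\<^sub>R \<sigma>) = (norm u / 2) *\<^sub>R \<sigma>"
      using that by (simp_all add: sgn_div_norm)
    show ?thesis unfolding Z_def eqs inner_commute[of \<sigma>] ..
  qed
  have "(\<integral>\<^sup>+v. (\<integral>\<^sup>+vs. (\<integral>\<^sup>+\<sigma>. ennreal (collision_rate \<gamma> c v vs \<sigma>) *
            \<Phi> (post_v v vs \<sigma>, post_vs v vs \<sigma>, v, vs) \<partial>direction_measure) \<partial>lborel) \<partial>lborel)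
    = (\<integral>\<^sup>+V. (\<integral>\<^sup>+u. (\<integral>\<^sup>+\<sigma>. ennreal (norm u powr \<gamma> * c (sgn u \<bullet> \<sigma>)) *
     \<Phi> (V + (norm u / 2) *\<^sub>R \<sigma>, V - (norm u / 2) *\<^sub>R \<sigma>, V + (1/2) *\<^sub>R u, V - (1/2) *\<^sub>R u) \<partial>direction_measure) \<partial>lborel) \<partial>lborel)"
    using nn_integral_relative_coordinates[of "\<lambda>(v, vs). (\<integral>\<^sup>+\<sigma>. ennreal (collision_rate \<gamma> c v vs \<sigma>) *
            \<Phi> (post_v v vs \<sigma>, post_vs v vs \<sigma>, v, vs) \<partial>direction_measure)"]
    by (simp add: post del: scaleR_half_double)
  also have "\<dots> = (\<integral>\<^sup>+V. (\<integral>\<^sup>+u. (\<integral>\<^sup>+\<sigma>. Z V (norm u *\<^sub>R \<sigma>) (sgn u) \<partial>direction_measure) \<partial>lborel) \<partial>lborel)"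
    by (intro nn_integral_cong[where M=lborel] nn_integral_direction_cong[OF swap[symmetric]])
  also have "\<dots> = (\<integral>\<^sup>+V. (\<integral>\<^sup>+u. (\<integral>\<^sup>+\<sigma>. Z V u \<sigma> \<partial>direction_measure) \<partial>lborel) \<partial>lborel)"
  proof (rule nn_integral_cong)
    fix V :: "real^'n"
    show "(\<integral>\<^sup>+u. (\<integral>\<^sup>+\<sigma>. Z V (norm u *\<^sub>R \<sigma>) (sgn u) \<partial>direction_measure) \<partial>lborel)
      = (\<integral>\<^sup>+u. (\<integral>\<^sup>+\<sigma>. Z V u \<sigma> \<partial>direction_measure) \<partial>lborel)"
      using nn_integral_swap_directions[of "\<lambda>(u, \<sigma>). Z V u \<sigma>"] by simp
  qed
  also have "\<dots> = (\<integral>\<^sup>+v. (\<integral>\<^sup>+vs. (\<integral>\<^sup>+\<sigma>. ennreal (collision_rate \<gamma> c v vs \<sigma>) *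
            \<Phi> (v, vs, post_v v vs \<sigma>, post_vs v vs \<sigma>) \<partial>direction_measure) \<partial>lborel) \<partial>lborel)"
    using nn_integral_relative_coordinates[of "\<lambda>(v, vs). (\<integral>\<^sup>+\<sigma>. ennreal (collision_rate \<gamma> c v vs \<sigma>) *
            \<Phi> (v, vs, post_v v vs \<sigma>, post_vs v vs \<sigma>) \<partial>direction_measure)"]
    by (simp add: post Z_def)
  finally show ?thesis .
qed

text \<open>Replacing \<open>\<sigma>\<close> by \<open>- \<sigma>\<close> exchanges \<open>v'\<close> with \<open>v\<^sub>*'\<close>; an even kernel does not notice.\<close>

lemma collision_exchange:
  fixes \<psi> :: "real^'n \<Rightarrow> ennreal"
  assumes [measurable]: "c \<in> borel_measurable borel" "\<psi> \<in> borel_measurable borel"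
    and even: "\<And>x. c (- x) = c x"
  shows "(\<integral>\<^sup>+\<sigma>. ennreal (collision_rate \<gamma> c v vs \<sigma>) * \<psi> (post_vs v vs \<sigma>) \<partial>direction_measure)
    = (\<integral>\<^sup>+\<sigma>. ennreal (collision_rate \<gamma> c v vs \<sigma>) * \<psi> (post_v v vs \<sigma>) \<partial>direction_measure)"
proof -
  have "post_v v vs (- \<sigma>) = post_vs v vs \<sigma>" "collision_rate \<gamma> c v vs (- \<sigma>) = collision_rate \<gamma> c v vs \<sigma>" for \<sigma>
    by (simp_all add: post_v_def post_vs_def collision_rate_def cos_dev_eq even)
  then show ?thesis
    using direction_measure_uminus[of "\<lambda>\<sigma>. ennreal (collision_rate \<gamma> c v vs \<sigma>) * \<psi> (post_v v vs \<sigma>)"]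
    by simp
qed

section \<open>The weak form of the operator\<close>

text \<open>Extension by \<open>0\<close>, to have a kernel that is Borel measurable, non-negative and even on the
  whole line.\<close>

definition kernel_ext :: "(real \<Rightarrow> real) \<Rightarrow> real \<Rightarrow> real" where
  "kernel_ext b x = indicator {-1..1} x * b x"

lemma kernel_ext:
  assumes "angular_kernel TYPE('n::finite) b"
  shows "kernel_ext b \<in> borel_measurable borel" "0 \<le> kernel_ext b x" "kernel_ext b (- x) = kernel_ext b x"
proof -
  show "kernel_ext b \<in> borel_measurable borel"
    using assms borel_measurable_restrict_space_iff[of "{-1..1}" borel b]
    by (simp add: angular_kernel_def kernel_ext_def[abs_def])
  show "0 \<le> kernel_ext b x" "kernel_ext b (- x) = kernel_ext b x"
    using assms by (auto simp: kernel_ext_def angular_kernel_def indicator_def)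
qed

lemma kernel_ext_inner:
  fixes e \<sigma> :: "real^'n"
  assumes "norm e \<le> 1" "norm \<sigma> \<le> 1"
  shows "kernel_ext b (e \<bullet> \<sigma>) = b (e \<bullet> \<sigma>)"
proof -
  have "\<bar>e \<bullet> \<sigma>\<bar> \<le> norm e * norm \<sigma>" by (rule Cauchy_Schwarz_ineq2)
  also have "\<dots> \<le> 1" using assms by (simp add: mult_le_one)
  finally show ?thesis by (auto simp: kernel_ext_def indicator_def abs_le_iff)
qed

lemma kernel_ext_mass:
  fixes e :: "real^'n"
  assumes b: "angular_kernel TYPE('n) b" and e: "norm e = 1"
  shows "(\<integral>\<^sup>+\<sigma>. ennreal (kernel_ext b (e \<bullet> \<sigma>)) \<partial>sphere_measure) = 1"
proof -
  have h: "has_bochner_integral sphere_measure (\<lambda>\<sigma>. b (e \<bullet> \<sigma>)) 1"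
    using assms by (simp add: angular_kernel_def)
  have eq: "kernel_ext b (e \<bullet> \<sigma>) = b (e \<bullet> \<sigma>)" if "\<sigma> \<in> space sphere_measure" for \<sigma>
    using that e by (intro kernel_ext_inner) (auto simp: space_sphere_measure)
  have "has_bochner_integral sphere_measure (\<lambda>\<sigma>. kernel_ext b (e \<bullet> \<sigma>)) 1"
    using h by (subst has_bochner_integral_cong[OF refl eq refl])
  then show ?thesis
    using kernel_ext(2)[OF b] nn_integral_eq_integral[of sphere_measure "\<lambda>\<sigma>. kernel_ext b (e \<bullet> \<sigma>)"]
    by (auto simp: has_bochner_integral_iff)
qed

lemma measurable_sphere_triple:
  fixes F :: "(real^'n) \<times> (real^'n) \<times> (real^'n) \<Rightarrow> 'b::topological_space"
  assumes "F \<in> borel_measurable (borel \<Otimes>\<^sub>M borel \<Otimes>\<^sub>M borel)"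
  shows "F \<in> borel_measurable (lborel \<Otimes>\<^sub>M (lborel \<Otimes>\<^sub>M (sphere_measure :: (real^'n) measure)))"
proof -
  have "(\<lambda>x. x) \<in> restrict_space borel (sphere 0 1) \<rightarrow>\<^sub>M (borel :: (real^'n) measure)"
    by (rule measurable_restrict_space1) simp
  then have [measurable]: "(\<lambda>x. x) \<in> (sphere_measure :: (real^'n) measure) \<rightarrow>\<^sub>M borel"
    by (simp cong: measurable_cong_sets add: sets_sphere_measure)
  have id: "(\<lambda>x. x) \<in> (lborel \<Otimes>\<^sub>M (lborel \<Otimes>\<^sub>M (sphere_measure :: (real^'n) measure)))
    \<rightarrow>\<^sub>M ((borel :: (real^'n) measure) \<Otimes>\<^sub>M (borel :: (real^'n) measure) \<Otimes>\<^sub>M borel)"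
  proof (intro measurable_pair)
    have s: "(\<lambda>x. snd (snd x)) \<in> (lborel \<Otimes>\<^sub>M (lborel \<Otimes>\<^sub>M (sphere_measure :: (real^'n) measure))) \<rightarrow>\<^sub>M sphere_measure"
      by measurable
    show "snd \<circ> (snd \<circ> (\<lambda>x. x)) \<in> (lborel \<Otimes>\<^sub>M (lborel \<Otimes>\<^sub>M (sphere_measure :: (real^'n) measure))) \<rightarrow>\<^sub>M borel"
      using measurable_compose[OF s \<open>(\<lambda>x. x) \<in> sphere_measure \<rightarrow>\<^sub>M borel\<close>] by (simp add: comp_def)
  qed (simp_all add: comp_def)
  from measurable_compose[OF id assms] show ?thesis .
qed

lemma nn_integral_sphere_triple:
  fixes F :: "(real^'n) \<times> (real^'n) \<times> (real^'n) \<Rightarrow> ennreal"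
  assumes F: "F \<in> borel_measurable (borel \<Otimes>\<^sub>M borel \<Otimes>\<^sub>M borel)"
  shows "(\<integral>\<^sup>+x. F x \<partial>(lborel \<Otimes>\<^sub>M (lborel \<Otimes>\<^sub>M sphere_measure)))
    = (\<integral>\<^sup>+v. (\<integral>\<^sup>+vs. (\<integral>\<^sup>+\<sigma>. F (v, vs, \<sigma>) \<partial>sphere_measure) \<partial>lborel) \<partial>lborel)"
proof -
  interpret S: finite_measure "sphere_measure :: (real^'n) measure" by (rule finite_sphere_measure)
  interpret LS: pair_sigma_finite "lborel :: (real^'n) measure" "sphere_measure :: (real^'n) measure" ..
  note [measurable] = measurable_sphere_triple[OF F]
  show ?thesis
    by (simp add: LS.nn_integral_fst[symmetric] S.nn_integral_fst[symmetric])
qed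

lemma sphere_triple_eq_direction:
  fixes G :: "(real^'n) \<times> (real^'n) \<times> (real^'n) \<Rightarrow> ennreal"
  assumes [measurable]: "G \<in> borel_measurable (borel \<Otimes>\<^sub>M borel \<Otimes>\<^sub>M borel)"
  shows "(\<integral>\<^sup>+v. (\<integral>\<^sup>+vs. (\<integral>\<^sup>+\<sigma>. G (v, vs, \<sigma>) \<partial>sphere_measure) \<partial>lborel) \<partial>lborel)
    = ennreal (real CARD('n)) * (\<integral>\<^sup>+v. (\<integral>\<^sup>+vs. (\<integral>\<^sup>+\<sigma>. G (v, vs, \<sigma>) \<partial>direction_measure) \<partial>lborel) \<partial>lborel)"
proof -
  interpret D: finite_measure "direction_measure :: (real^'n) measure" by (rule finite_direction_measure)
  show ?thesis by (simp add: nn_integral_sphere_measure nn_integral_cmult)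
qed

lemma nn_integral_collision_rate:
  fixes v vs :: "real^'n"
  assumes b: "angular_kernel TYPE('n) b"
  shows "(\<integral>\<^sup>+\<sigma>. ennreal (collision_rate \<gamma> (kernel_ext b) v vs \<sigma>) \<partial>sphere_measure) = ennreal (norm (v - vs) powr \<gamma>)"
proof (cases "v = vs")
  case False
  note [measurable] = kernel_ext(1)[OF b]
  have m: "(\<lambda>\<sigma>. ennreal (kernel_ext b (sgn (v - vs) \<bullet> \<sigma>))) \<in> borel_measurable (sphere_measure :: (real^'n) measure)"
  proof -
    have "(\<lambda>\<sigma>. ennreal (kernel_ext b (sgn (v - vs) \<bullet> \<sigma>))) \<in> borel_measurable (restrict_space borel (sphere 0 1))"
      by (rule measurable_restrict_space1) measurable
    then show ?thesis by (simp cong: measurable_cong_sets add: sets_sphere_measure)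
  qed
  have "(\<integral>\<^sup>+\<sigma>. ennreal (collision_rate \<gamma> (kernel_ext b) v vs \<sigma>) \<partial>sphere_measure)
    = ennreal (norm (v - vs) powr \<gamma>) * (\<integral>\<^sup>+\<sigma>. ennreal (kernel_ext b (sgn (v - vs) \<bullet> \<sigma>)) \<partial>sphere_measure)"
    using kernel_ext(2)[OF b] m by (simp add: collision_rate_def cos_dev_eq ennreal_mult nn_integral_cmult)
  then show ?thesis using False by (simp add: kernel_ext_mass[OF b] norm_sgn)
qed (simp add: collision_rate_def)

text \<open>The angular integral of the rate is \<open>|v - v\<^sub>*|\<^sup>\<gamma>\<close>, by the normalisation of \<open>b\<close>; what is left is
  the convolution bound \<open>K\<close> against \<open>f\<close>.\<close>

lemma nn_integral_loss_le:
  fixes f g :: "real^'n \<Rightarrow> real"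
  assumes b: "angular_kernel TYPE('n) b"
    and [measurable]: "f \<in> borel_measurable borel" "g \<in> borel_measurable borel"
    and f: "\<And>v. 0 \<le> f v" and g: "\<And>v. 0 \<le> g v"
    and K: "\<And>v. (\<integral>\<^sup>+x. ennreal (norm (v - x) powr \<gamma> * g x) \<partial>lborel) \<le> ennreal K"
  shows "(\<integral>\<^sup>+v. (\<integral>\<^sup>+vs. (\<integral>\<^sup>+\<sigma>. ennreal (collision_rate \<gamma> (kernel_ext b) v vs \<sigma> * (f v * g vs)) \<partial>sphere_measure) \<partial>lborel) \<partial>lborel)
    \<le> ennreal K * (\<integral>\<^sup>+v. ennreal (f v) \<partial>lborel)"
proof -
  note [measurable] = kernel_ext(1)[OF b]
  have c: "0 \<le> collision_rate \<gamma> (kernel_ext b) v vs \<sigma>" for v vs \<sigma> :: "real^'n"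
    using kernel_ext(2)[OF b] by (simp add: collision_rate_def)
  have m: "(\<lambda>\<sigma>. ennreal (collision_rate \<gamma> (kernel_ext b) v vs \<sigma>)) \<in> borel_measurable (sphere_measure :: (real^'n) measure)" for v vs :: "real^'n"
  proof -
    have "(\<lambda>\<sigma>. ennreal (collision_rate \<gamma> (kernel_ext b) v vs \<sigma>)) \<in> borel_measurable (restrict_space borel (sphere 0 1))"
      by (rule measurable_restrict_space1) measurable
    then show ?thesis by (simp cong: measurable_cong_sets add: sets_sphere_measure)
  qed
  have "(\<integral>\<^sup>+v. (\<integral>\<^sup>+vs. (\<integral>\<^sup>+\<sigma>. ennreal (collision_rate \<gamma> (kernel_ext b) v vs \<sigma> * (f v * g vs)) \<partial>sphere_measure) \<partial>lborel) \<partial>lborel)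
    = (\<integral>\<^sup>+v. (\<integral>\<^sup>+vs. (\<integral>\<^sup>+\<sigma>. ennreal (collision_rate \<gamma> (kernel_ext b) v vs \<sigma>) * ennreal (f v * g vs) \<partial>sphere_measure) \<partial>lborel) \<partial>lborel)"
    using c f g by (simp add: ennreal_mult)
  also have "\<dots> = (\<integral>\<^sup>+v. (\<integral>\<^sup>+vs. ennreal (norm (v - vs) powr \<gamma>) * ennreal (f v * g vs) \<partial>lborel) \<partial>lborel)"
    by (simp add: nn_integral_multc[OF m] nn_integral_collision_rate[OF b])
  also have "\<dots> = (\<integral>\<^sup>+v. (\<integral>\<^sup>+vs. ennreal (f v) * ennreal (norm (v - vs) powr \<gamma> * g vs) \<partial>lborel) \<partial>lborel)"
    using f g by (simp add: ennreal_mult ac_simps)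
  also have "\<dots> = (\<integral>\<^sup>+v. ennreal (f v) * (\<integral>\<^sup>+vs. ennreal (norm (v - vs) powr \<gamma> * g vs) \<partial>lborel) \<partial>lborel)"
    by (simp add: nn_integral_cmult)
  also have "\<dots> \<le> (\<integral>\<^sup>+v. ennreal (f v) * ennreal K \<partial>lborel)"
    using K by (intro nn_integral_mono mult_left_mono) auto
  also have "\<dots> = ennreal K * (\<integral>\<^sup>+v. ennreal (f v) \<partial>lborel)"
    by (simp add: nn_integral_cmult mult.commute[of _ "ennreal K"])
  finally show ?thesis .
qed

lemma gain_eq:
  fixes f \<phi> :: "real^'n \<Rightarrow> real"
  assumes b: "angular_kernel TYPE('n) b"
    and [measurable]: "f \<in> borel_measurable borel" "\<phi> \<in> borel_measurable borel"
    and f: "\<And>v. 0 \<le> f v" and \<phi>: "\<And>v. 0 \<le> \<phi> v"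
  shows "(\<integral>\<^sup>+v. (\<integral>\<^sup>+vs. (\<integral>\<^sup>+\<sigma>. ennreal (\<phi> v * (collision_rate \<gamma> (kernel_ext b) v vs \<sigma> *
            (f (post_v v vs \<sigma>) * Maxwellian (post_vs v vs \<sigma>)))) \<partial>sphere_measure) \<partial>lborel) \<partial>lborel)
    = (\<integral>\<^sup>+v. (\<integral>\<^sup>+vs. (\<integral>\<^sup>+\<sigma>. ennreal (\<phi> (post_v v vs \<sigma>) * (collision_rate \<gamma> (kernel_ext b) v vs \<sigma> *
            (f v * Maxwellian vs))) \<partial>sphere_measure) \<partial>lborel) \<partial>lborel)"
proof -
  note [measurable] = kernel_ext(1)[OF b]
  have c: "0 \<le> collision_rate \<gamma> (kernel_ext b) v vs \<sigma>" for v vs \<sigma> :: "real^'n"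
    using kernel_ext(2)[OF b] by (simp add: collision_rate_def)
  have e: "ennreal (p * (collision_rate \<gamma> (kernel_ext b) v vs \<sigma> * (x * Maxwellian y)))
    = ennreal (collision_rate \<gamma> (kernel_ext b) v vs \<sigma>) * ennreal (p * (x * Maxwellian y))"
    if "0 \<le> p" "0 \<le> x" for p x y and v vs \<sigma> :: "real^'n"
    using that c by (simp add: ennreal_mult[symmetric] less_imp_le[OF Maxwellian_pos] mult.left_commute)
  have "(\<integral>\<^sup>+v. (\<integral>\<^sup>+vs. (\<integral>\<^sup>+\<sigma>. ennreal (\<phi> v * (collision_rate \<gamma> (kernel_ext b) v vs \<sigma> *
            (f (post_v v vs \<sigma>) * Maxwellian (post_vs v vs \<sigma>)))) \<partial>sphere_measure) \<partial>lborel) \<partial>lborel)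
    = ennreal (real CARD('n)) * (\<integral>\<^sup>+v. (\<integral>\<^sup>+vs. (\<integral>\<^sup>+\<sigma>. ennreal (\<phi> v * (collision_rate \<gamma> (kernel_ext b) v vs \<sigma> *
            (f (post_v v vs \<sigma>) * Maxwellian (post_vs v vs \<sigma>)))) \<partial>direction_measure) \<partial>lborel) \<partial>lborel)"
    using sphere_triple_eq_direction[of "\<lambda>(v, vs, \<sigma>). ennreal (\<phi> v * (collision_rate \<gamma> (kernel_ext b) v vs \<sigma> *
            (f (post_v v vs \<sigma>) * Maxwellian (post_vs v vs \<sigma>))))"] by simp
  also have "\<dots> = ennreal (real CARD('n)) * (\<integral>\<^sup>+v. (\<integral>\<^sup>+vs. (\<integral>\<^sup>+\<sigma>. ennreal (\<phi> (post_v v vs \<sigma>) * (collision_rate \<gamma> (kernel_ext b) v vs \<sigma> *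
            (f v * Maxwellian vs))) \<partial>direction_measure) \<partial>lborel) \<partial>lborel)"
    using collision_change_of_variables[of "kernel_ext b" "\<lambda>(v', vs', v, vs). ennreal (\<phi> v * (f v' * Maxwellian vs'))" \<gamma>] f \<phi>
    by (simp add: e)
  also have "\<dots> = (\<integral>\<^sup>+v. (\<integral>\<^sup>+vs. (\<integral>\<^sup>+\<sigma>. ennreal (\<phi> (post_v v vs \<sigma>) * (collision_rate \<gamma> (kernel_ext b) v vs \<sigma> *
            (f v * Maxwellian vs))) \<partial>sphere_measure) \<partial>lborel) \<partial>lborel)"
    using sphere_triple_eq_direction[of "\<lambda>(v, vs, \<sigma>). ennreal (\<phi> (post_v v vs \<sigma>) * (collision_rate \<gamma> (kernel_ext b) v vs \<sigma> *
            (f v * Maxwellian vs)))"] by simp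
  finally show ?thesis .
qed

text \<open>The averages of \<open>\<phi> (v')\<close> and of \<open>\<phi> (v\<^sub>*')\<close> over \<open>\<sigma>\<close> coincide, so a bound on the sum of both
  values bounds each average by half of it.\<close>

lemma symmetrised_average_le:
  fixes v vs :: "real^'n" and \<phi> :: "real^'n \<Rightarrow> real"
  assumes b: "angular_kernel TYPE('n) b" and [measurable]: "\<phi> \<in> borel_measurable borel"
    and \<phi>: "\<And>v. 0 \<le> \<phi> v" and y: "0 \<le> y" and m: "0 \<le> m"
    and le: "\<And>\<sigma>. norm \<sigma> = 1 \<Longrightarrow> \<phi> (post_v v vs \<sigma>) + \<phi> (post_vs v vs \<sigma>) \<le> 2 * y"
  shows "(\<integral>\<^sup>+\<sigma>. ennreal (\<phi> (post_v v vs \<sigma>) * (collision_rate \<gamma> (kernel_ext b) v vs \<sigma> * m)) \<partial>sphere_measure)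
    \<le> (\<integral>\<^sup>+\<sigma>. ennreal (y * (collision_rate \<gamma> (kernel_ext b) v vs \<sigma> * m)) \<partial>sphere_measure)"
    (is "?I \<le> ?J")
proof -
  note [measurable] = kernel_ext(1)[OF b]
  have [measurable]: "h \<in> borel_measurable (sphere_measure :: (real^'n) measure)" if "h \<in> borel_measurable borel" for h :: "real^'n \<Rightarrow> ennreal"
  proof -
    have "h \<in> borel_measurable (restrict_space borel (sphere 0 1))"
      by (rule measurable_restrict_space1) (simp add: that)
    then show ?thesis by (simp cong: measurable_cong_sets add: sets_sphere_measure)
  qed
  define r where "r \<sigma> = collision_rate \<gamma> (kernel_ext b) v vs \<sigma>" for \<sigma>
  have r: "0 \<le> r \<sigma>" for \<sigma>
    using kernel_ext(2)[OF b] by (simp add: collision_rate_def r_def)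
  have [measurable]: "r \<in> borel_measurable borel" unfolding r_def[abs_def] by measurable
  have "?I = (\<integral>\<^sup>+\<sigma>. ennreal (\<phi> (post_vs v vs \<sigma>) * (r \<sigma> * m)) \<partial>sphere_measure)"
    using collision_exchange[of "kernel_ext b" "\<lambda>v. ennreal (\<phi> v * m)" \<gamma> v vs] kernel_ext(3)[OF b] r m \<phi>
    by (simp add: nn_integral_sphere_measure r_def[symmetric] ennreal_mult[symmetric] mult.left_commute)
  then have "?I + ?I = (\<integral>\<^sup>+\<sigma>. ennreal (\<phi> (post_v v vs \<sigma>) * (r \<sigma> * m)) \<partial>sphere_measure)
    + (\<integral>\<^sup>+\<sigma>. ennreal (\<phi> (post_vs v vs \<sigma>) * (r \<sigma> * m)) \<partial>sphere_measure)"
    by (simp add: r_def)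
  also have "\<dots> = (\<integral>\<^sup>+\<sigma>. ennreal (\<phi> (post_v v vs \<sigma>) * (r \<sigma> * m)) + ennreal (\<phi> (post_vs v vs \<sigma>) * (r \<sigma> * m)) \<partial>sphere_measure)"
    by (rule nn_integral_add[symmetric]) measurable
  also have "\<dots> \<le> (\<integral>\<^sup>+\<sigma>. ennreal (y * (r \<sigma> * m)) + ennreal (y * (r \<sigma> * m)) \<partial>sphere_measure)"
  proof (rule nn_integral_mono)
    fix \<sigma> :: "real^'n" assume "\<sigma> \<in> space sphere_measure"
    then have "norm \<sigma> = 1" by (simp add: space_sphere_measure)
    from mult_right_mono[OF le[OF this], of "r \<sigma> * m"] r m
    have "\<phi> (post_v v vs \<sigma>) * (r \<sigma> * m) + \<phi> (post_vs v vs \<sigma>) * (r \<sigma> * m) \<le> y * (r \<sigma> * m) + y * (r \<sigma> * m)"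
      by (simp add: algebra_simps)
    then show "ennreal (\<phi> (post_v v vs \<sigma>) * (r \<sigma> * m)) + ennreal (\<phi> (post_vs v vs \<sigma>) * (r \<sigma> * m))
      \<le> ennreal (y * (r \<sigma> * m)) + ennreal (y * (r \<sigma> * m))"
      using r m y \<phi> by (simp add: ennreal_plus[symmetric] ennreal_leI del: ennreal_plus)
  qed
  also have "\<dots> = ?J + ?J"
    unfolding r_def[symmetric] by (rule nn_integral_add) measurable
  finally have "2 * ?I \<le> 2 * ?J" by (simp add: mult_2)
  then show ?thesis by (subst (asm) ennreal_mult_le_mult_iff) auto
qed

lemma (in pair_sigma_finite) integral_mult_fst:
  fixes F :: "'a \<times> 'b \<Rightarrow> real" and \<phi> :: "'a \<Rightarrow> real"
  assumes "integrable (M1 \<Otimes>\<^sub>M M2) (\<lambda>x. \<phi> (fst x) * F x)"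
  shows "integrable M1 (\<lambda>v. \<phi> v * (\<integral>y. F (v, y) \<partial>M2))"
    and "(\<integral>v. \<phi> v * (\<integral>y. F (v, y) \<partial>M2) \<partial>M1) = (\<integral>x. \<phi> (fst x) * F x \<partial>(M1 \<Otimes>\<^sub>M M2))"
  using integrable_fst'[OF assms] integral_fst'[OF assms] by simp_all

text \<open>The weak formulation tested with the truncated weight. After the change of variables the gain
  term is an average of the weight over post-collisional velocities. By symmetrisation it is at
  most the loss term, up to \<open>C \<langle>v\<^sub>*\<rangle>\<^sup>\<beta>\<close>, and this remainder is integrated against the
  Maxwellian, uniformly in \<open>v\<close>. Hence the bound depends neither on the truncation level \<open>R\<close> nor
  on a moment of \<open>f\<close> beyond its mass.\<close>

lemma weighted_linear_Boltzmann_le: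
  fixes f :: "real^'n \<Rightarrow> real"
  assumes b: "angular_kernel TYPE('n) b"
    and fm [measurable]: "f \<in> borel_measurable borel" and f: "\<And>v. 0 \<le> f v" and fi: "integrable lborel f"
    and \<beta>: "0 < \<beta>" and R: "0 \<le> R" and C: "0 \<le> C" and K: "0 \<le> K"
    and coll: "\<And>v vs (\<sigma> :: real^'n). norm \<sigma> = 1 \<Longrightarrow>
       min R (bracket (post_v v vs \<sigma>) powr \<beta>) + min R (bracket (post_vs v vs \<sigma>) powr \<beta>)
       \<le> 2 * min R (bracket v powr \<beta>) + 2 * (C * bracket vs powr \<beta>)"
    and ker: "\<And>v :: real^'n. (\<integral>\<^sup>+x. ennreal (norm (v - x) powr \<gamma> * (bracket x powr \<beta> * Maxwellian x)) \<partial>lborel) \<le> ennreal K"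
  shows "(\<integral>v. min R (bracket v powr \<beta>) * linear_Boltzmann \<gamma> b f v \<partial>lborel) \<le> C * K * (\<integral>v. f v \<partial>lborel)"
proof -
  let ?N = "lborel \<Otimes>\<^sub>M sphere_measure :: ((real^'n) \<times> (real^'n)) measure"
  let ?X = "lborel \<Otimes>\<^sub>M ?N"
  interpret S: finite_measure "sphere_measure :: (real^'n) measure" by (rule finite_sphere_measure)
  interpret LS: pair_sigma_finite "lborel :: (real^'n) measure" "sphere_measure :: (real^'n) measure" ..
  interpret N: sigma_finite_measure ?N by unfold_locales
  interpret X: pair_sigma_finite "lborel :: (real^'n) measure" ?N ..
  note [measurable] = kernel_ext(1)[OF b]
  define r :: "real^'n \<Rightarrow> real^'n \<Rightarrow> real^'n \<Rightarrow> real" where "r = collision_rate \<gamma> (kernel_ext b)"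
  have r: "0 \<le> r v vs \<sigma>" for v vs \<sigma> :: "real^'n"
    using kernel_ext(2)[OF b] by (simp add: collision_rate_def r_def)
  define \<phi> where "\<phi> v = min R (bracket v powr \<beta>)" for v :: "real^'n"
  define w where "w v = bracket v powr \<beta>" for v :: "real^'n"
  have [measurable]: "\<phi> \<in> borel_measurable borel" "w \<in> borel_measurable borel"
    by (simp_all add: \<phi>_def[abs_def] w_def[abs_def])
  have \<phi>: "0 \<le> \<phi> v" "\<phi> v \<le> R" for v using R by (auto simp: \<phi>_def)
  have w: "1 \<le> w v" for v unfolding w_def using bracket_ge_1 less_imp_le[OF \<beta>] by (rule ge_one_powr_ge_zero)
  have M: "0 \<le> Maxwellian v" for v :: "real^'n" by (simp add: less_imp_le[OF Maxwellian_pos])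
  define P where "P = (\<lambda>(v, vs, \<sigma>). r v vs \<sigma> * (f (post_v v vs \<sigma>) * Maxwellian (post_vs v vs \<sigma>)))"
  define Q where "Q = (\<lambda>(v, vs, \<sigma>). r v vs \<sigma> * (f v * Maxwellian vs))"
  have P: "0 \<le> P x" and Q: "0 \<le> Q x" for x
    by (auto simp: P_def Q_def r f M split: prod.split)
  have PB [measurable]: "P \<in> borel_measurable (borel \<Otimes>\<^sub>M borel \<Otimes>\<^sub>M borel)"
    and QB [measurable]: "Q \<in> borel_measurable (borel \<Otimes>\<^sub>M borel \<Otimes>\<^sub>M borel)"
    unfolding P_def Q_def r_def by measurable
  note [measurable] = measurable_sphere_triple[OF PB] measurable_sphere_triple[OF QB]
  have F: "(\<integral>\<^sup>+v. ennreal (f v) \<partial>lborel) = ennreal (\<integral>v. f v \<partial>lborel)"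
    using fi f by (intro nn_integral_eq_integral) auto
  have ker1: "(\<integral>\<^sup>+x. ennreal (norm (v - x) powr \<gamma> * Maxwellian x) \<partial>lborel) \<le> ennreal K" for v :: "real^'n"
  proof (rule order_trans[OF nn_integral_mono ker])
    fix x :: "real^'n"
    have "norm (v - x) powr \<gamma> * (1 * Maxwellian x) \<le> norm (v - x) powr \<gamma> * (bracket x powr \<beta> * Maxwellian x)"
      using w[of x] M by (intro mult_left_mono mult_right_mono) (auto simp: w_def)
    then show "ennreal (norm (v - x) powr \<gamma> * Maxwellian x)
       \<le> ennreal (norm (v - x) powr \<gamma> * (bracket x powr \<beta> * Maxwellian x))"
      by (intro ennreal_leI) simp
  qed
  have Q_fin: "(\<integral>\<^sup>+x. ennreal (Q x) \<partial>?X) < \<infinity>"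
  proof -
    have "(\<integral>\<^sup>+x. ennreal (Q x) \<partial>?X)
      = (\<integral>\<^sup>+v. (\<integral>\<^sup>+vs. (\<integral>\<^sup>+\<sigma>. ennreal (r v vs \<sigma> * (f v * Maxwellian vs)) \<partial>sphere_measure) \<partial>lborel) \<partial>lborel)"
      by (subst nn_integral_sphere_triple) (measurable, simp add: Q_def)
    also have "\<dots> \<le> ennreal K * (\<integral>\<^sup>+v. ennreal (f v) \<partial>lborel)"
      unfolding r_def by (rule nn_integral_loss_le[OF b]) (auto simp: f M ker1)
    also have "\<dots> < \<infinity>" by (simp add: F ennreal_mult_less_top)
    finally show ?thesis .
  qed
  \<comment> \<open>Gain and loss have the same total mass; with the loss finite, both are integrable.\<close>
  have P_eq: "(\<integral>\<^sup>+x. ennreal (P x) \<partial>?X) = (\<integral>\<^sup>+x. ennreal (Q x) \<partial>?X)"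
    using gain_eq[OF b fm, of "\<lambda>_. 1" \<gamma>] f
    by (simp add: nn_integral_sphere_triple P_def Q_def r_def)
  have iP: "integrable ?X P" and iQ: "integrable ?X Q"
    using Q_fin P Q P_eq by (auto intro!: integrableI_nonneg)
  have [measurable]: "(\<lambda>x. \<phi> (fst x)) \<in> borel_measurable ?X" by measurable
  have b\<phi>: "integrable ?X (\<lambda>x. \<phi> (fst x) * G x)" if "integrable ?X G" for G
  proof (rule Bochner_Integration.integrable_bound)
    show "integrable ?X (\<lambda>x. R * G x)" using that by simp
    show "(\<lambda>x. \<phi> (fst x) * G x) \<in> borel_measurable ?X" using that by measurable
    show "AE x in ?X. norm (\<phi> (fst x) * G x) \<le> norm (R * G x)"
      using \<phi> R by (auto simp: abs_mult intro!: AE_I2 mult_right_mono)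
  qed
  have bridge: "(\<integral>\<^sup>+x. ennreal (\<phi> (fst x) * P x) \<partial>?X)
     \<le> (\<integral>\<^sup>+x. ennreal (\<phi> (fst x) * Q x) \<partial>?X) + ennreal (C * K * (\<integral>v. f v \<partial>lborel))"
  proof -
    have "(\<integral>\<^sup>+x. ennreal (\<phi> (fst x) * P x) \<partial>?X)
       = (\<integral>\<^sup>+v. (\<integral>\<^sup>+vs. (\<integral>\<^sup>+\<sigma>. ennreal (\<phi> (post_v v vs \<sigma>) * (r v vs \<sigma> * (f v * Maxwellian vs))) \<partial>sphere_measure) \<partial>lborel) \<partial>lborel)"
      using gain_eq[OF b fm, of \<phi> \<gamma>] f \<phi>
      by (simp add: nn_integral_sphere_triple P_def r_def)
    also have "\<dots> \<le> (\<integral>\<^sup>+v. (\<integral>\<^sup>+vs. (\<integral>\<^sup>+\<sigma>. ennreal ((\<phi> v + C * w vs) * (r v vs \<sigma> * (f v * Maxwellian vs))) \<partial>sphere_measure) \<partial>lborel) \<partial>lborel)"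
    proof (intro nn_integral_mono[where M=lborel])
      fix v vs :: "real^'n"
      show "(\<integral>\<^sup>+\<sigma>. ennreal (\<phi> (post_v v vs \<sigma>) * (r v vs \<sigma> * (f v * Maxwellian vs))) \<partial>sphere_measure)
        \<le> (\<integral>\<^sup>+\<sigma>. ennreal ((\<phi> v + C * w vs) * (r v vs \<sigma> * (f v * Maxwellian vs))) \<partial>sphere_measure)"
        unfolding r_def
      proof (rule symmetrised_average_le[OF b])
        show "0 \<le> \<phi> v + C * w vs" using \<phi> C w[of vs] by simp
        show "\<phi> (post_v v vs \<sigma>) + \<phi> (post_vs v vs \<sigma>) \<le> 2 * (\<phi> v + C * w vs)" if "norm \<sigma> = 1" for \<sigma>
          using coll[OF that, of v vs] by (simp add: \<phi>_def w_def)
      qed (use f M \<phi> in auto)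
    qed
    also have "\<dots> = (\<integral>\<^sup>+x. ennreal (\<phi> (fst x) * Q x) + ennreal (C * (r (fst x) (fst (snd x)) (snd (snd x)) * (f (fst x) * (w (fst (snd x)) * Maxwellian (fst (snd x)))))) \<partial>?X)"
    proof (subst nn_integral_sphere_triple)
      show "(\<lambda>x. ennreal (\<phi> (fst x) * Q x) + ennreal (C * (r (fst x) (fst (snd x)) (snd (snd x)) * (f (fst x) * (w (fst (snd x)) * Maxwellian (fst (snd x))))))) \<in> borel_measurable (borel \<Otimes>\<^sub>M borel \<Otimes>\<^sub>M borel)"
        unfolding r_def by measurable
      have "ennreal ((\<phi> v + C * w vs) * (r v vs \<sigma> * (f v * Maxwellian vs)))
        = ennreal (\<phi> v * Q (v, vs, \<sigma>)) + ennreal (C * (r v vs \<sigma> * (f v * (w vs * Maxwellian vs))))" for v vs \<sigma>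
        using \<phi> C r f M w[of vs] by (subst ennreal_plus[symmetric]) (simp_all add: Q_def algebra_simps)
      then show "(\<integral>\<^sup>+v. (\<integral>\<^sup>+vs. (\<integral>\<^sup>+\<sigma>. ennreal ((\<phi> v + C * w vs) * (r v vs \<sigma> * (f v * Maxwellian vs))) \<partial>sphere_measure) \<partial>lborel) \<partial>lborel)
        = (\<integral>\<^sup>+v. (\<integral>\<^sup>+vs. (\<integral>\<^sup>+\<sigma>. ennreal (\<phi> (fst (v, vs, \<sigma>)) * Q (v, vs, \<sigma>)) + ennreal (C * (r (fst (v, vs, \<sigma>)) (fst (snd (v, vs, \<sigma>))) (snd (snd (v, vs, \<sigma>))) * (f (fst (v, vs, \<sigma>)) * (w (fst (snd (v, vs, \<sigma>))) * Maxwellian (fst (snd (v, vs, \<sigma>))))))) \<partial>sphere_measure) \<partial>lborel) \<partial>lborel)"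
        by simp
    qed
    also have "\<dots> = (\<integral>\<^sup>+x. ennreal (\<phi> (fst x) * Q x) \<partial>?X) + (\<integral>\<^sup>+x. ennreal (C * (r (fst x) (fst (snd x)) (snd (snd x)) * (f (fst x) * (w (fst (snd x)) * Maxwellian (fst (snd x)))))) \<partial>?X)"
    proof (rule nn_integral_add)
      show "(\<lambda>x. ennreal (C * (r (fst x) (fst (snd x)) (snd (snd x)) * (f (fst x) * (w (fst (snd x)) * Maxwellian (fst (snd x))))))) \<in> borel_measurable ?X"
        unfolding r_def by (rule measurable_sphere_triple) measurable
    qed measurable
    also have "(\<integral>\<^sup>+x. ennreal (C * (r (fst x) (fst (snd x)) (snd (snd x)) * (f (fst x) * (w (fst (snd x)) * Maxwellian (fst (snd x)))))) \<partial>?X)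
      = ennreal C * (\<integral>\<^sup>+x. ennreal (r (fst x) (fst (snd x)) (snd (snd x)) * (f (fst x) * (w (fst (snd x)) * Maxwellian (fst (snd x))))) \<partial>?X)"
    proof -
      have "(\<lambda>x. ennreal (r (fst x) (fst (snd x)) (snd (snd x)) * (f (fst x) * (w (fst (snd x)) * Maxwellian (fst (snd x)))))) \<in> borel_measurable ?X"
        unfolding r_def by (rule measurable_sphere_triple) measurable
      then show ?thesis using C by (simp add: ennreal_mult' nn_integral_cmult)
    qed
    also have "(\<integral>\<^sup>+x. ennreal (r (fst x) (fst (snd x)) (snd (snd x)) * (f (fst x) * (w (fst (snd x)) * Maxwellian (fst (snd x))))) \<partial>?X)
      = (\<integral>\<^sup>+v. (\<integral>\<^sup>+vs. (\<integral>\<^sup>+\<sigma>. ennreal (r v vs \<sigma> * (f v * (w vs * Maxwellian vs))) \<partial>sphere_measure) \<partial>lborel) \<partial>lborel)"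
      unfolding r_def by (subst nn_integral_sphere_triple) simp_all
    also have "\<dots> \<le> ennreal K * (\<integral>\<^sup>+v. ennreal (f v) \<partial>lborel)"
      unfolding r_def by (rule nn_integral_loss_le[OF b]) (use f M w ker in \<open>auto simp: w_def\<close>)
    finally show ?thesis
      using C K f by (simp add: F ennreal_mult'[symmetric] ennreal_mult[symmetric] mult_left_mono add_left_mono mult.assoc)
  qed
  have "AE v in lborel. integrable ?N (\<lambda>y. P (v, y))" "AE v in lborel. integrable ?N (\<lambda>y. Q (v, y))"
    using X.AE_integrable_fst'[OF iP] X.AE_integrable_fst'[OF iQ] by simp_all
  then have lB: "AE v in lborel. linear_Boltzmann \<gamma> b f v = (\<integral>y. P (v, y) \<partial>?N) - (\<integral>y. Q (v, y) \<partial>?N)"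
  proof eventually_elim
    case (elim v)
    have "linear_Boltzmann \<gamma> b f v = (\<integral>y. P (v, y) - Q (v, y) \<partial>?N)"
      unfolding linear_Boltzmann_def
    proof (rule Bochner_Integration.integral_cong[OF refl])
      fix y assume "y \<in> space ?N"
      then obtain vs \<sigma> where y: "y = (vs, \<sigma>)" "norm \<sigma> = 1"
        by (auto simp: space_pair_measure space_sphere_measure)
      have "kernel_ext b (cos_dev v vs \<sigma>) = b (cos_dev v vs \<sigma>)"
        unfolding cos_dev_eq using y by (intro kernel_ext_inner) (auto simp: norm_sgn)
      then show "(case y of (vs, \<sigma>) \<Rightarrow> norm (v - vs) powr \<gamma> * b (cos_dev v vs \<sigma>) *
        (f (post_v v vs \<sigma>) * Maxwellian (post_vs v vs \<sigma>) - f v * Maxwellian vs)) = P (v, y) - Q (v, y)"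
        by (simp add: y P_def Q_def r_def collision_rate_def algebra_simps)
    qed
    also have "\<dots> = (\<integral>y. P (v, y) \<partial>?N) - (\<integral>y. Q (v, y) \<partial>?N)"
      using elim by (rule Bochner_Integration.integral_diff)
    finally show ?case .
  qed
  have mP: "integrable lborel (\<lambda>v. \<phi> v * (\<integral>y. P (v, y) \<partial>?N))" and mQ: "integrable lborel (\<lambda>v. \<phi> v * (\<integral>y. Q (v, y) \<partial>?N))"
    using X.integral_mult_fst(1)[OF b\<phi>[OF iP]] X.integral_mult_fst(1)[OF b\<phi>[OF iQ]] .
  have key: "(\<integral>x. \<phi> (fst x) * P x \<partial>?X) \<le> (\<integral>x. \<phi> (fst x) * Q x \<partial>?X) + C * K * (\<integral>v. f v \<partial>lborel)"
  proof -
    have nn: "(\<integral>\<^sup>+x. ennreal (\<phi> (fst x) * G x) \<partial>?X) = ennreal (\<integral>x. \<phi> (fst x) * G x \<partial>?X)"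
      if "integrable ?X G" "\<And>x. 0 \<le> G x" for G
      using b\<phi>[OF that(1)] that(2) \<phi> by (intro nn_integral_eq_integral) auto
    have pos: "0 \<le> (\<integral>x. \<phi> (fst x) * Q x \<partial>?X)" "0 \<le> C * K * (\<integral>v. f v \<partial>lborel)"
      using \<phi> Q C K f by (auto intro!: integral_nonneg_AE mult_nonneg_nonneg)
    show ?thesis
      using bridge unfolding nn[OF iP P] nn[OF iQ Q] ennreal_plus[OF pos, symmetric]
      using pos by (subst (asm) ennreal_le_iff) auto
  qed
  show ?thesis
  proof (cases "integrable lborel (\<lambda>v. \<phi> v * linear_Boltzmann \<gamma> b f v)")
    case False
    then show ?thesis using C K f
      by (auto simp: \<phi>_def[symmetric] not_integrable_integral_eq intro!: integral_nonneg_AE mult_nonneg_nonneg)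
  next
    case True
    have "(\<integral>v. \<phi> v * linear_Boltzmann \<gamma> b f v \<partial>lborel)
      = (\<integral>v. \<phi> v * (\<integral>y. P (v, y) \<partial>?N) - \<phi> v * (\<integral>y. Q (v, y) \<partial>?N) \<partial>lborel)"
      using lB True mP mQ by (intro integral_cong_AE) (auto elim!: eventually_mono simp: right_diff_distrib)
    also have "\<dots> = (\<integral>x. \<phi> (fst x) * P x \<partial>?X) - (\<integral>x. \<phi> (fst x) * Q x \<partial>?X)"
      using mP mQ X.integral_mult_fst(2)[OF b\<phi>[OF iP]] X.integral_mult_fst(2)[OF b\<phi>[OF iQ]]
      by (subst Bochner_Integration.integral_diff) simp_all
    finally show ?thesis using key by (simp add: \<phi>_def)
  qed
qed

section \<open>Stochastic semigroups on \<open>L\<^sup>1\<close>\<close>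

text \<open>A continuous function whose upper right derivative never exceeds \<open>K\<close> grows at most with slope
  \<open>K\<close>: beyond the last time at which it is below a line of slope \<open>K + \<epsilon>\<close>, it would have to leave
  that line upwards. One-sided derivatives are all that strong continuity and the definition of
  the generator provide.\<close>

lemma right_dini_growth:
  fixes g :: "real \<Rightarrow> real"
  assumes cont: "continuous_on {0..T} g" and T: "0 \<le> T"
    and dini: "\<And>t \<epsilon>. 0 \<le> t \<Longrightarrow> 0 < \<epsilon> \<Longrightarrow> \<forall>\<^sub>F h in at_right 0. g (t + h) \<le> g t + (K + \<epsilon>) * h"
  shows "g T \<le> g 0 + K * T"
proof -
  have bound: "g T \<le> g 0 + (K + \<epsilon>) * T" if \<epsilon>: "0 < \<epsilon>" for \<epsilon>
  proof (rule ccontr)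
    assume contr: "\<not> g T \<le> g 0 + (K + \<epsilon>) * T"
    define \<phi> where "\<phi> t = g t - g 0 - (K + \<epsilon>) * t" for t
    define A where "A = {0..T} \<inter> \<phi> -` {..0}"
    have "continuous_on {0..T} \<phi>" unfolding \<phi>_def by (intro continuous_intros cont)
    then have "closed A" unfolding A_def
      by (rule continuous_closed_preimage) auto
    moreover have "bounded A" by (rule bounded_subset[of "{0..T}"]) (auto simp: A_def)
    ultimately have "compact A" by (simp add: compact_eq_bounded_closed)
    moreover have "0 \<in> A" using T by (simp add: A_def \<phi>_def)
    ultimately obtain t where t: "t \<in> A" "\<And>s. s \<in> A \<Longrightarrow> s \<le> t"
      using compact_attains_sup[of A] by blast
    have "t \<noteq> T" using t(1) contr by (auto simp: A_def \<phi>_def)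
    then have tT: "0 \<le> t" "t < T" "\<phi> t \<le> 0" using t(1) by (auto simp: A_def)
    have "\<forall>\<^sub>F h in at_right 0. h < T - t"
      using tT by (intro eventually_at_right_less[THEN eventually_mono] order_tendstoD[OF tendsto_ident_at]) auto
    with dini[OF tT(1) \<epsilon>] eventually_at_right_less[of "0::real"]
    have "\<forall>\<^sub>F h in at_right (0::real). False"
    proof eventually_elim
      case (elim h)
      then have "t + h \<in> A" using tT by (simp add: A_def \<phi>_def algebra_simps)
      from t(2)[OF this] elim show False by simp
    qed
    then show False by simp
  qed
  show ?thesis
  proof (rule field_le_epsilon)
    fix e :: real assume e: "0 < e"
    have "g T \<le> g 0 + (K + e / (T + 1)) * T" using e T by (intro bound) simp
    also have "\<dots> \<le> g 0 + K * T + e"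
    proof -
      have "e / (T + 1) * T \<le> e" using e T by (simp add: field_simps)
      then show ?thesis by (simp add: algebra_simps)
    qed
    finally show "g T \<le> g 0 + K * T + e" .
  qed
qed

lemma continuous_on_of_right_modulus:
  fixes g \<omega> :: "real \<Rightarrow> real"
  assumes \<omega>: "(\<omega> \<longlongrightarrow> 0) (at_right 0)"
    and le: "\<And>s h. 0 \<le> s \<Longrightarrow> 0 < h \<Longrightarrow> \<bar>g (s + h) - g s\<bar> \<le> \<omega> h"
  shows "continuous_on {0..T} g"
  unfolding continuous_on_iff
proof (intro ballI allI impI)
  fix t e :: real assume t: "t \<in> {0..T}" and e: "0 < e"
  have "\<forall>\<^sub>F h in at_right 0. \<omega> h < e" using \<omega> e by (rule order_tendstoD)
  then obtain d where d: "0 < d" "\<And>h. 0 < h \<Longrightarrow> h < d \<Longrightarrow> \<omega> h < e"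
    by (auto simp: eventually_at_right_field)
  have "dist (g s) (g t) < e" if "s \<in> {0..T}" "dist s t < d" for s
  proof (cases s t rule: linorder_cases)
    case less
    then show ?thesis using le[of s "t - s"] d(2)[of "t - s"] that t by (simp add: dist_real_def)
  next
    case greater
    then show ?thesis using le[of t "s - t"] d(2)[of "s - t"] that t by (simp add: dist_real_def)
  qed (use e in simp)
  then show "\<exists>d>0. \<forall>x'\<in>{0..T}. dist x' t < d \<longrightarrow> dist (g x') (g t) < e" using d(1) by blast
qed

lemma L1_norm_nonneg: "0 \<le> L1_norm f"
  by (simp add: L1_norm_def)

lemma L1_norm_cong_AE:
  assumes "integrable lborel f" "integrable lborel g" "AE v in lborel. f v = g v"
  shows "L1_norm f = L1_norm g"
  unfolding L1_norm_def using assms by (intro integral_cong_AE) auto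

lemma L1_norm_triangle:
  assumes "integrable lborel f" "integrable lborel g"
  shows "L1_norm (\<lambda>v. f v + g v) \<le> L1_norm f + L1_norm g"
proof -
  have "L1_norm (\<lambda>v. f v + g v) \<le> (\<integral>v. \<bar>f v\<bar> + \<bar>g v\<bar> \<partial>lborel)"
    unfolding L1_norm_def using assms by (intro integral_mono) auto
  also have "\<dots> = L1_norm f + L1_norm g"
    unfolding L1_norm_def using assms by simp
  finally show ?thesis .
qed

lemma L1_norm_scale: "L1_norm (\<lambda>v. c * f v) = \<bar>c\<bar> * L1_norm f"
  by (simp add: L1_norm_def abs_mult)

lemma L1_norm_minus_commute: "L1_norm (\<lambda>v. f v - g v) = L1_norm (\<lambda>v. g v - f v)"
  by (simp add: L1_norm_def abs_minus_commute)

text \<open>Positive, mass-preserving \<open>C\<^sub>0\<close>-semigroups whose generator is defined on all of \<open>L\<^sup>1\<close>. They are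
  contractions of \<open>L\<^sup>1\<close>, which takes the place of an operator bound on the generator below.\<close>

locale stochastic_semigroup =
  fixes U :: "real \<Rightarrow> (real ^ 'n \<Rightarrow> real) \<Rightarrow> (real ^ 'n \<Rightarrow> real)"
    and A :: "(real ^ 'n \<Rightarrow> real) \<Rightarrow> (real ^ 'n \<Rightarrow> real)"
  assumes C0: "C0_semigroup_L1 U" and pos: "positive_L1 U" and mass: "mass_preserving_L1 U"
    and gen: "generated_by_L1 U A"
begin

lemma bounded: "0 \<le> t \<Longrightarrow> bounded_linear_L1 (U t)"
  using C0 by (simp add: C0_semigroup_L1_def)

lemma integrable_U [simp, intro]: "0 \<le> t \<Longrightarrow> integrable lborel f \<Longrightarrow> integrable lborel (U t f)"
  using bounded by (simp add: bounded_linear_L1_def)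

lemma measurable_U [simp]: "0 \<le> t \<Longrightarrow> integrable lborel f \<Longrightarrow> U t f \<in> borel_measurable borel"
  using borel_measurable_integrable[OF integrable_U] by simp

lemma U_cong: "0 \<le> t \<Longrightarrow> integrable lborel f \<Longrightarrow> integrable lborel g \<Longrightarrow>
    AE v in lborel. f v = g v \<Longrightarrow> AE v in lborel. U t f v = U t g v"
  using bounded[of t] unfolding bounded_linear_L1_def by blast

lemma U_linear: "0 \<le> t \<Longrightarrow> integrable lborel f \<Longrightarrow> integrable lborel g \<Longrightarrow>
    AE v in lborel. U t (\<lambda>w. x * f w + y * g w) v = x * U t f v + y * U t g v"
  using bounded[of t] unfolding bounded_linear_L1_def by blast

lemma U_diff: "0 \<le> t \<Longrightarrow> integrable lborel f \<Longrightarrow> integrable lborel g \<Longrightarrow>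
    AE v in lborel. U t (\<lambda>w. f w - g w) v = U t f v - U t g v"
  using U_linear[of t f g 1 "-1"] by simp

lemma U_0: "integrable lborel f \<Longrightarrow> AE v in lborel. U 0 f v = f v"
  using C0 unfolding C0_semigroup_L1_def by blast

lemma U_add: "0 \<le> r \<Longrightarrow> 0 \<le> t \<Longrightarrow> integrable lborel f \<Longrightarrow> AE v in lborel. U (r + t) f v = U r (U t f) v"
  using C0 unfolding C0_semigroup_L1_def by blast

lemma U_nonneg: "0 \<le> t \<Longrightarrow> integrable lborel f \<Longrightarrow> AE v in lborel. 0 \<le> f v \<Longrightarrow> AE v in lborel. 0 \<le> U t f v"
  using pos unfolding positive_L1_def by blast

lemma U_mass: "0 \<le> t \<Longrightarrow> integrable lborel f \<Longrightarrow> (\<integral>v. U t f v \<partial>lborel) = (\<integral>v. f v \<partial>lborel)"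
  using mass unfolding mass_preserving_L1_def by blast

lemma U_mono:
  assumes "0 \<le> t" "integrable lborel f" "integrable lborel g" "AE v in lborel. f v \<le> g v"
  shows "AE v in lborel. U t f v \<le> U t g v"
proof -
  have "AE v in lborel. 0 \<le> U t (\<lambda>w. g w - f w) v"
    using assms by (intro U_nonneg) auto
  with U_diff[OF assms(1,3,2)] show ?thesis by eventually_elim simp
qed

lemma contraction:
  assumes t: "0 \<le> t" and f: "integrable lborel f"
  shows "L1_norm (U t f) \<le> L1_norm f"
proof -
  define p where "p v = max 0 (f v)" for v
  define n where "n v = max 0 (- f v)" for v
  have pn: "integrable lborel p" "integrable lborel n" "\<And>v. f v = p v - n v" "\<And>v. \<bar>f v\<bar> = p v + n v"
    using f by (auto simp: p_def[abs_def] n_def[abs_def])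
  have "AE v in lborel. U t f v = U t p v - U t n v"
    using U_diff[OF t pn(1,2)] by (simp flip: pn(3))
  moreover have "AE v in lborel. 0 \<le> U t p v" "AE v in lborel. 0 \<le> U t n v"
    using t pn by (auto intro!: U_nonneg simp: p_def n_def)
  ultimately have "AE v in lborel. \<bar>U t f v\<bar> \<le> U t p v + U t n v"
    by eventually_elim auto
  then have "L1_norm (U t f) \<le> (\<integral>v. U t p v + U t n v \<partial>lborel)"
    unfolding L1_norm_def using t f pn by (intro integral_mono_AE) auto
  also have "\<dots> = (\<integral>v. p v + n v \<partial>lborel)"
    using t pn by (simp add: integrable_U U_mass)
  also have "\<dots> = L1_norm f" by (simp add: L1_norm_def pn(4))
  finally show ?thesis .
qed

lemma contraction_diff:
  assumes "0 \<le> t" "integrable lborel f" "integrable lborel g"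
  shows "L1_norm (\<lambda>v. U t f v - U t g v) \<le> L1_norm (\<lambda>v. f v - g v)"
proof -
  have "L1_norm (\<lambda>v. U t f v - U t g v) = L1_norm (U t (\<lambda>v. f v - g v))"
    using U_diff[OF assms] assms by (intro L1_norm_cong_AE) (auto elim!: eventually_mono)
  also have "\<dots> \<le> L1_norm (\<lambda>v. f v - g v)"
    using assms by (intro contraction) auto
  finally show ?thesis .
qed

lemma time_modulus:
  assumes "0 \<le> t" "0 \<le> h" "integrable lborel f"
  shows "L1_norm (\<lambda>v. U (t + h) f v - U t f v) \<le> L1_norm (\<lambda>v. U h f v - f v)"
proof -
  have "L1_norm (\<lambda>v. U (t + h) f v - U t f v) = L1_norm (\<lambda>v. U t (U h f) v - U t f v)"
    using U_add[OF assms] assms by (intro L1_norm_cong_AE) (auto elim!: eventually_mono)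
  also have "\<dots> \<le> L1_norm (\<lambda>v. U h f v - f v)"
    using assms by (intro contraction_diff) auto
  finally show ?thesis .
qed

lemma strong_continuity:
  "integrable lborel f \<Longrightarrow> ((\<lambda>h. L1_norm (\<lambda>v. U h f v - f v)) \<longlongrightarrow> 0) (at_right 0)"
  using C0 unfolding C0_semigroup_L1_def by blast

lemma generator:
  assumes "integrable lborel f"
  shows "integrable lborel (A f)"
    and "((\<lambda>h. L1_norm (\<lambda>v. (U h f v - f v) / h - A f v)) \<longlongrightarrow> 0) (at_right 0)"
  using gen assms unfolding generated_by_L1_def by blast+

text \<open>For a bounded weight \<open>\<phi>\<close>, the right derivative of \<open>\<integral> \<phi> U(t) f\<close> is \<open>\<integral> \<phi> A U(t) f\<close>; the bound \<open>K\<close>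
  is required at every non-negative density with the mass of \<open>f\<close>, since \<open>U(t) f\<close> is one.\<close>

lemma weighted_integral_growth:
  fixes \<phi> :: "real^'n \<Rightarrow> real"
  assumes [measurable]: "\<phi> \<in> borel_measurable borel" and \<phi>: "\<And>v. 0 \<le> \<phi> v" "\<And>v. \<phi> v \<le> R"
    and f: "integrable lborel f" "AE v in lborel. 0 \<le> f v"
    and le: "\<And>g. g \<in> borel_measurable borel \<Longrightarrow> (\<And>v. 0 \<le> g v) \<Longrightarrow> integrable lborel g \<Longrightarrow>
      (\<integral>v. g v \<partial>lborel) = (\<integral>v. f v \<partial>lborel) \<Longrightarrow> (\<integral>v. \<phi> v * A g v \<partial>lborel) \<le> K"
    and T: "0 \<le> T"
  shows "(\<integral>v. \<phi> v * U T f v \<partial>lborel) \<le> (\<integral>v. \<phi> v * f v \<partial>lborel) + K * T"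
proof -
  have R: "0 \<le> R" using \<phi> order_trans by blast
  have int: "integrable lborel (\<lambda>v. \<phi> v * g v)" if g: "integrable lborel g" for g :: "real^'n \<Rightarrow> real"
  proof (rule Bochner_Integration.integrable_bound)
    show "integrable lborel (\<lambda>v. R * g v)" using g by simp
    show "(\<lambda>v. \<phi> v * g v) \<in> borel_measurable lborel" using g by measurable
    show "AE v in lborel. norm (\<phi> v * g v) \<le> norm (R * g v)"
      using \<phi> R by (auto simp: abs_mult intro!: AE_I2 mult_right_mono)
  qed
  have bnd: "\<bar>\<integral>v. \<phi> v * g v \<partial>lborel\<bar> \<le> R * L1_norm g" if g: "integrable lborel g" for g :: "real^'n \<Rightarrow> real"
  proof -
    have "\<bar>\<integral>v. \<phi> v * g v \<partial>lborel\<bar> \<le> (\<integral>v. \<bar>\<phi> v * g v\<bar> \<partial>lborel)" by (rule integral_abs_bound)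
    also have "\<dots> \<le> (\<integral>v. R * \<bar>g v\<bar> \<partial>lborel)"
      using g \<phi> by (intro integral_mono[OF integrable_abs[OF int[OF g]]]) (auto simp: abs_mult intro!: mult_right_mono)
    finally show ?thesis by (simp add: L1_norm_def)
  qed
  define G where "G t = (\<integral>v. \<phi> v * U t f v \<partial>lborel)" for t
  have "continuous_on {0..T} G"
  proof (rule continuous_on_of_right_modulus)
    show "((\<lambda>h. R * L1_norm (\<lambda>v. U h f v - f v)) \<longlongrightarrow> 0) (at_right 0)"
      using tendsto_mult_right_zero[OF strong_continuity[OF f(1)]] .
    fix s h :: real assume s: "0 \<le> s" "0 < h"
    have "G (s + h) - G s = (\<integral>v. \<phi> v * (U (s + h) f v - U s f v) \<partial>lborel)"
      unfolding G_def right_diff_distrib using s f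
      by (intro Bochner_Integration.integral_diff[symmetric] int) simp_all
    also have "\<bar>\<dots>\<bar> \<le> R * L1_norm (\<lambda>v. U (s + h) f v - U s f v)"
      using s f by (intro bnd) auto
    also have "\<dots> \<le> R * L1_norm (\<lambda>v. U h f v - f v)"
      using s f R by (intro mult_left_mono time_modulus) auto
    finally show "\<bar>G (s + h) - G s\<bar> \<le> R * L1_norm (\<lambda>v. U h f v - f v)" .
  qed
  then have "G T \<le> G 0 + K * T"
  proof (rule right_dini_growth[OF _ T])
    fix t \<epsilon> :: real assume t: "0 \<le> t" and \<epsilon>: "0 < \<epsilon>"
    \<comment> \<open>A representative of \<open>U(t) f\<close> that is non-negative everywhere.\<close>
    define g where "g v = max 0 (U t f v)" for v
    have gi: "integrable lborel g" unfolding g_def[abs_def] using t f by (intro integrable_max) auto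
    have gm: "g \<in> borel_measurable borel" using gi by (auto dest: borel_measurable_integrable)
    have gU: "AE v in lborel. U t f v = g v"
      using U_nonneg[OF t f] by (auto elim!: eventually_mono simp: g_def)
    have "(\<integral>v. g v \<partial>lborel) = (\<integral>v. U t f v \<partial>lborel)"
    proof (rule integral_cong_AE)
      show "AE v in lborel. g v = U t f v" using gU by eventually_elim simp
    qed (use gm t f(1) in simp_all)
    then have KA: "(\<integral>v. \<phi> v * A g v \<partial>lborel) \<le> K"
      using t f(1) gm gi by (intro le) (auto simp: U_mass g_def)
    note [measurable] = gm measurable_U[OF t f(1)]
    have Gt: "G t = (\<integral>v. \<phi> v * g v \<partial>lborel)"
      unfolding G_def
    proof (rule integral_cong_AE)
      show "AE v in lborel. \<phi> v * U t f v = \<phi> v * g v" using gU by eventually_elim simp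
    qed measurable
    have "((\<lambda>h. R * L1_norm (\<lambda>v. (U h g v - g v) / h - A g v)) \<longlongrightarrow> 0) (at_right 0)"
      using tendsto_mult_right_zero[OF generator(2)[OF gi]] .
    then have "\<forall>\<^sub>F h in at_right 0. R * L1_norm (\<lambda>v. (U h g v - g v) / h - A g v) < \<epsilon>"
      using \<epsilon> by (rule order_tendstoD)
    with eventually_at_right_less[of "0::real"]
    show "\<forall>\<^sub>F h in at_right 0. G (t + h) \<le> G t + (K + \<epsilon>) * h"
    proof eventually_elim
      case (elim h)
      have [measurable]: "U (t + h) f \<in> borel_measurable borel" "U h g \<in> borel_measurable borel"
        using elim t f gi by simp_all
      have "AE v in lborel. U (t + h) f v = U h g v"
        using U_add[of h t f] U_cong[of h "U t f" g] elim t f gi gU by (auto simp: add.commute)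
      then have "AE v in lborel. \<phi> v * U (t + h) f v = \<phi> v * U h g v" by eventually_elim simp
      then have "G (t + h) = (\<integral>v. \<phi> v * U h g v \<partial>lborel)"
        unfolding G_def
        by (rule integral_cong_AE[rotated 2]) measurable
      also have "\<dots> = (\<integral>v. \<phi> v * g v + (h * (\<phi> v * ((U h g v - g v) / h - A g v)) + h * (\<phi> v * A g v)) \<partial>lborel)"
        using elim by (intro Bochner_Integration.integral_cong) (auto simp: field_simps)
      also have "\<dots> = G t + (h * (\<integral>v. \<phi> v * ((U h g v - g v) / h - A g v) \<partial>lborel) + h * (\<integral>v. \<phi> v * A g v \<partial>lborel))"
      proof -
        have i: "integrable lborel (\<lambda>v. \<phi> v * ((U h g v - g v) / h - A g v))" "integrable lborel (\<lambda>v. \<phi> v * A g v)"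
          "integrable lborel (\<lambda>v. \<phi> v * g v)"
          using elim gi generator(1)[OF gi] by (auto intro!: int)
        show ?thesis unfolding Gt using i
          by (subst Bochner_Integration.integral_add, simp, simp, subst Bochner_Integration.integral_add) simp_all
      qed
      also have "\<dots> \<le> G t + (h * \<epsilon> + h * K)"
      proof -
        have "(\<integral>v. \<phi> v * ((U h g v - g v) / h - A g v) \<partial>lborel) \<le> R * L1_norm (\<lambda>v. (U h g v - g v) / h - A g v)"
          using elim gi generator(1)[OF gi] by (intro order_trans[OF abs_ge_self bnd]) auto
        then show ?thesis using elim KA by (intro add_mono mult_left_mono) auto
      qed
      finally show ?case by (simp add: algebra_simps)
    qed
  qed
  moreover note [measurable] = measurable_U[OF order_refl f(1)] borel_measurable_integrable[OF f(1)]
  have "G 0 = (\<integral>v. \<phi> v * f v \<partial>lborel)"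
    unfolding G_def
  proof (rule integral_cong_AE)
    show "AE v in lborel. \<phi> v * U 0 f v = \<phi> v * f v" using U_0[OF f(1)] by eventually_elim simp
  qed measurable
  ultimately show ?thesis by (simp add: G_def)
qed

end

text \<open>With \<open>g = V(t) f\<close>, both \<open>U(h) g\<close> and \<open>V(h) g\<close> are \<open>g + h A g\<close> up to \<open>o(h)\<close>, so
  \<open>U(h) U(t) f - V(h) V(t) f\<close> is \<open>U(h) (U(t) f - V(t) f)\<close> up to \<open>o(h)\<close>, and \<open>U(h)\<close> is a contraction.
  The distance of both orbits thus has non-positive upper right derivative, and it vanishes at
  time \<open>0\<close>.\<close>

lemma stochastic_semigroup_unique:
  fixes U V :: "real \<Rightarrow> (real ^ 'n \<Rightarrow> real) \<Rightarrow> (real ^ 'n \<Rightarrow> real)"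
  assumes "stochastic_semigroup U A" and "stochastic_semigroup V A"
    and f: "integrable lborel f" and T: "0 \<le> T"
  shows "AE v in lborel. U T f v = V T f v"
proof -
  interpret U: stochastic_semigroup U A by fact
  interpret V: stochastic_semigroup V A by fact
  define D where "D t = L1_norm (\<lambda>v. U t f v - V t f v)" for t
  have "continuous_on {0..T} D"
  proof (rule continuous_on_of_right_modulus)
    show "((\<lambda>h. L1_norm (\<lambda>v. U h f v - f v) + L1_norm (\<lambda>v. V h f v - f v)) \<longlongrightarrow> 0) (at_right 0)"
      using tendsto_add[OF U.strong_continuity[OF f] V.strong_continuity[OF f]] by simp
    fix s h :: real assume s: "0 \<le> s" "0 < h"
    let ?a = "\<lambda>v. U (s + h) f v - U s f v" and ?b = "\<lambda>v. V s f v - V (s + h) f v"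
    have i: "integrable lborel ?a" "integrable lborel ?b" "integrable lborel (U (s + h) f)"
       "integrable lborel (U s f)" "integrable lborel (V (s + h) f)" "integrable lborel (V s f)"
      using s f by auto
    have "\<bar>D (s + h) - D s\<bar> \<le> L1_norm ?a + L1_norm ?b"
    proof -
      have "D (s + h) \<le> D s + (L1_norm ?a + L1_norm ?b)"
      proof -
        have "D (s + h) = L1_norm (\<lambda>v. (U s f v - V s f v) + (?a v + ?b v))"
          by (simp add: D_def)
        also have "\<dots> \<le> D s + L1_norm (\<lambda>v. ?a v + ?b v)"
          unfolding D_def using i by (intro L1_norm_triangle) auto
        also have "L1_norm (\<lambda>v. ?a v + ?b v) \<le> L1_norm ?a + L1_norm ?b"
          using i by (intro L1_norm_triangle)
        finally show ?thesis by simp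
      qed
      moreover have "D s \<le> D (s + h) + (L1_norm ?a + L1_norm ?b)"
      proof -
        have "D s = L1_norm (\<lambda>v. (U (s + h) f v - V (s + h) f v) + ((- 1) * ?a v + (- 1) * ?b v))"
          by (simp add: D_def)
        also have "\<dots> \<le> D (s + h) + L1_norm (\<lambda>v. (- 1) * ?a v + (- 1) * ?b v)"
          unfolding D_def using i by (intro L1_norm_triangle) auto
        also have "L1_norm (\<lambda>v. (- 1) * ?a v + (- 1) * ?b v) \<le> L1_norm (\<lambda>v. (- 1) * ?a v) + L1_norm (\<lambda>v. (- 1) * ?b v)"
          using i by (intro L1_norm_triangle) auto
        finally show ?thesis unfolding L1_norm_scale by simp
      qed
      ultimately show ?thesis by linarith
    qed
    also have "\<dots> \<le> L1_norm (\<lambda>v. U h f v - f v) + L1_norm (\<lambda>v. V h f v - f v)"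
      using s f U.time_modulus[of s h f] V.time_modulus[of s h f] L1_norm_minus_commute[of "V (s + h) f" "V s f"]
      by simp
    finally show "\<bar>D (s + h) - D s\<bar> \<le> L1_norm (\<lambda>v. U h f v - f v) + L1_norm (\<lambda>v. V h f v - f v)" .
  qed
  then have "D T \<le> D 0 + 0 * T"
  proof (rule right_dini_growth[OF _ T])
    fix t \<epsilon> :: real assume t: "0 \<le> t" and \<epsilon>: "0 < \<epsilon>"
    define g where "g = V t f"
    have g: "integrable lborel g" unfolding g_def using t f by auto
    let ?eU = "\<lambda>h v. (U h g v - g v) / h - A g v" and ?eV = "\<lambda>h v. (V h g v - g v) / h - A g v"
    have "((\<lambda>h. L1_norm (?eU h) + L1_norm (?eV h)) \<longlongrightarrow> 0) (at_right 0)"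
      using tendsto_add[OF U.generator(2)[OF g] V.generator(2)[OF g]] by simp
    then have "\<forall>\<^sub>F h in at_right 0. L1_norm (?eU h) + L1_norm (?eV h) < \<epsilon>"
      using \<epsilon> by (rule order_tendstoD)
    with eventually_at_right_less[of "0::real"]
    show "\<forall>\<^sub>F h in at_right 0. D (t + h) \<le> D t + (0 + \<epsilon>) * h"
    proof eventually_elim
      case (elim h)
      have i: "integrable lborel (U (t + h) f)" "integrable lborel (V (t + h) f)" "integrable lborel (U h (U t f))"
        "integrable lborel (U h g)" "integrable lborel (V h g)" "integrable lborel (?eU h)" "integrable lborel (?eV h)"
        "integrable lborel (U t f)"
        using t elim f g U.generator(1)[OF g] by auto
      have "AE v in lborel. U (t + h) f v = U h (U t f) v" "AE v in lborel. V (t + h) f v = V h g v"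
        using U.U_add[of h t f] V.U_add[of h t f] elim t f by (simp_all add: add.commute g_def)
      then have "AE v in lborel. U (t + h) f v - V (t + h) f v
         = (U h (U t f) v - U h g v) + (h * ?eU h v + (- h) * ?eV h v)"
        by eventually_elim (use elim in \<open>simp add: field_simps\<close>)
      then have "D (t + h) = L1_norm (\<lambda>v. (U h (U t f) v - U h g v) + (h * ?eU h v + (- h) * ?eV h v))"
        unfolding D_def using i by (intro L1_norm_cong_AE) auto
      also have "\<dots> \<le> L1_norm (\<lambda>v. U h (U t f) v - U h g v) + L1_norm (\<lambda>v. h * ?eU h v + (- h) * ?eV h v)"
        using i by (intro L1_norm_triangle) auto
      also have "L1_norm (\<lambda>v. U h (U t f) v - U h g v) \<le> D t"
        unfolding D_def g_def using elim t f by (intro U.contraction_diff) auto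
      also have "L1_norm (\<lambda>v. h * ?eU h v + (- h) * ?eV h v) \<le> L1_norm (\<lambda>v. h * ?eU h v) + L1_norm (\<lambda>v. (- h) * ?eV h v)"
        using i by (intro L1_norm_triangle) auto
      also have "\<dots> = h * (L1_norm (?eU h) + L1_norm (?eV h))"
        unfolding L1_norm_scale using elim by (simp add: algebra_simps)
      also have "\<dots> \<le> h * \<epsilon>" using elim by (intro mult_left_mono) auto
      finally show ?case by (simp add: algebra_simps)
    qed
  qed
  moreover have "D 0 = 0"
  proof -
    have "AE v in lborel. U 0 f v - V 0 f v = 0"
      using U.U_0[OF f] V.U_0[OF f] by eventually_elim simp
    then have "D 0 = L1_norm (\<lambda>v::real^'n. 0 :: real)"
      unfolding D_def using f by (intro L1_norm_cong_AE) auto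
    then show ?thesis by (simp add: L1_norm_def)
  qed
  moreover have "0 \<le> D T" by (simp add: D_def L1_norm_nonneg)
  ultimately have "D T = 0" by simp
  then have "(\<integral>v. \<bar>U T f v - V T f v\<bar> \<partial>lborel) = 0" by (simp add: D_def L1_norm_def)
  then have "AE v in lborel. \<bar>U T f v - V T f v\<bar> = 0"
    using T f by (subst (asm) integral_nonneg_eq_0_iff_AE) auto
  then show ?thesis by eventually_elim simp
qed

section \<open>Linear growth of high moments\<close>

text \<open>High moments grow at most linearly in time, whatever their order: this holds for the truncated
  weights, uniformly in the truncation, and passes to the limit by monotone convergence.\<close>

lemma finite_moment_growth:
  fixes \<gamma> \<beta> :: real
  assumes \<gamma>: "- real CARD('n::finite) < \<gamma>" "\<gamma> < 0" and \<beta>: "2 \<le> \<beta>"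
  obtains L where "0 \<le> L"
    "\<And>b U f t. angular_kernel TYPE('n) b \<Longrightarrow> stochastic_semigroup U (linear_Boltzmann \<gamma> b) \<Longrightarrow>
       nonneg_unit_mass (f :: real^'n \<Rightarrow> real) \<Longrightarrow> finite_moment \<beta> f \<Longrightarrow> 0 \<le> t \<Longrightarrow>
       finite_moment \<beta> (U t f) \<and> moment \<beta> (U t f) \<le> moment \<beta> f + L * t"
proof -
  obtain C where C: "0 < C"
    "\<And>R v vs (\<sigma> :: real^'n). norm \<sigma> = 1 \<Longrightarrow>
       min R (bracket (post_v v vs \<sigma>) powr \<beta>) + min R (bracket (post_vs v vs \<sigma>) powr \<beta>)
       \<le> 2 * min R (bracket v powr \<beta>) + 2 * (C * bracket vs powr \<beta>)"
    using truncated_weight_collision[OF \<beta>] by blast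
  have \<beta>0: "0 < \<beta>" using \<beta> by simp
  obtain K where K: "0 \<le> K"
    "\<And>v :: real^'n. (\<integral>\<^sup>+x. ennreal (norm (v - x) powr \<gamma> * (bracket x powr \<beta> * Maxwellian x)) \<partial>lborel) \<le> ennreal K"
    using weighted_Maxwellian_kernel[OF \<gamma> \<beta>0] by blast
  show ?thesis
  proof (rule that[of "C * K"])
    show "0 \<le> C * K" using C K by simp
    fix b and U :: "real \<Rightarrow> (real^'n \<Rightarrow> real) \<Rightarrow> real^'n \<Rightarrow> real" and f :: "real^'n \<Rightarrow> real" and t :: real
    assume b: "angular_kernel TYPE('n) b" and U: "stochastic_semigroup U (linear_Boltzmann \<gamma> b)"
      and f: "nonneg_unit_mass f" and fm: "finite_moment \<beta> f" and t: "0 \<le> t"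
    interpret U: stochastic_semigroup U "linear_Boltzmann \<gamma> b" by fact
    have fi: "integrable lborel f" "AE v in lborel. 0 \<le> f v" "(\<integral>v. f v \<partial>lborel) = 1"
      using f by (auto simp: nonneg_unit_mass_def)
    define B where "B = moment \<beta> f + C * K * t"
    define u where "u v = max 0 (U t f v)" for v
    have Ui: "integrable lborel (U t f)" using t fi by simp
    note [measurable] = U.measurable_U[OF t fi(1)]
    have um [measurable]: "u \<in> borel_measurable borel" unfolding u_def[abs_def] by measurable
    have uU: "AE v in lborel. u v = U t f v"
      using U.U_nonneg[OF t fi(1,2)] by eventually_elim (simp add: u_def)
    have u0: "0 \<le> u v" for v by (simp add: u_def)
    have trunc: "(\<integral>\<^sup>+v. ennreal (min (real m) (bracket v powr \<beta>) * u v) \<partial>lborel) \<le> ennreal B" for m :: nat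
    proof -
      have i: "integrable lborel (\<lambda>v. min (real m) (bracket v powr \<beta>) * u v)"
      proof (rule Bochner_Integration.integrable_bound)
        show "integrable lborel (\<lambda>v. real m * U t f v)" using Ui by simp
        show "AE v in lborel. norm (min (real m) (bracket v powr \<beta>) * u v) \<le> norm (real m * U t f v)"
          using uU by eventually_elim (auto simp: abs_mult intro!: mult_right_mono)
      qed measurable
      have "(\<integral>v. min (real m) (bracket v powr \<beta>) * u v \<partial>lborel)
        = (\<integral>v. min (real m) (bracket v powr \<beta>) * U t f v \<partial>lborel)"
      proof (rule integral_cong_AE)
        show "AE v in lborel. min (real m) (bracket v powr \<beta>) * u v = min (real m) (bracket v powr \<beta>) * U t f v"
          using uU by eventually_elim simp
        note [measurable] = borel_measurable_integrable[OF Ui]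
        show "(\<lambda>v. min (real m) (bracket v powr \<beta>) * U t f v) \<in> borel_measurable lborel" by measurable
      qed measurable
      also have "\<dots> \<le> (\<integral>v. min (real m) (bracket v powr \<beta>) * f v \<partial>lborel) + C * K * t"
      proof (rule U.weighted_integral_growth[where R="real m", OF _ _ _ fi(1,2) _ t])
        fix g :: "real^'n \<Rightarrow> real"
        assume g: "g \<in> borel_measurable borel" "\<And>v. 0 \<le> g v" "integrable lborel g"
          "(\<integral>v. g v \<partial>lborel) = (\<integral>v. f v \<partial>lborel)"
        have "(\<integral>v. min (real m) (bracket v powr \<beta>) * linear_Boltzmann \<gamma> b g v \<partial>lborel) \<le> C * K * (\<integral>v. g v \<partial>lborel)"
          using C K by (intro weighted_linear_Boltzmann_le b g \<beta>0) auto
        then show "(\<integral>v. min (real m) (bracket v powr \<beta>) * linear_Boltzmann \<gamma> b g v \<partial>lborel) \<le> C * K"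
          using g fi by simp
      qed auto
      also have "(\<integral>v. min (real m) (bracket v powr \<beta>) * f v \<partial>lborel) \<le> moment \<beta> f"
        unfolding moment_def
      proof (rule integral_mono_AE)
        show "integrable lborel (\<lambda>v. bracket v powr \<beta> * f v)" using fm by (simp add: finite_moment_def)
        show "integrable lborel (\<lambda>v. min (real m) (bracket v powr \<beta>) * f v)"
        proof (rule Bochner_Integration.integrable_bound)
          show "integrable lborel (\<lambda>v. real m * f v)" using fi by simp
          note [measurable] = borel_measurable_integrable[OF fi(1)]
          show "(\<lambda>v. min (real m) (bracket v powr \<beta>) * f v) \<in> borel_measurable lborel" by measurable
          show "AE v in lborel. norm (min (real m) (bracket v powr \<beta>) * f v) \<le> norm (real m * f v)"
            by (auto simp: abs_mult intro!: mult_right_mono)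
        qed
        show "AE v in lborel. min (real m) (bracket v powr \<beta>) * f v \<le> bracket v powr \<beta> * f v"
          using fi(2) by eventually_elim (auto intro!: mult_right_mono)
      qed
      finally show ?thesis
        using i u0 by (subst nn_integral_eq_integral) (auto simp: B_def intro!: ennreal_leI)
    qed
    have "ennreal (bracket v powr \<beta> * u v) = (SUP m::nat. ennreal (min (real m) (bracket v powr \<beta>) * u v))" for v
    proof (rule antisym)
      obtain m :: nat where "bracket v powr \<beta> \<le> real m" using real_arch_simple by blast
      then have "ennreal (bracket v powr \<beta> * u v) = ennreal (min (real m) (bracket v powr \<beta>) * u v)"
        by (simp add: min_def)
      also have "\<dots> \<le> (SUP m::nat. ennreal (min (real m) (bracket v powr \<beta>) * u v))"
        by (rule SUP_upper) simp
      finally show "ennreal (bracket v powr \<beta> * u v) \<le> (SUP m::nat. ennreal (min (real m) (bracket v powr \<beta>) * u v))" .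
    qed (use u0 in \<open>auto intro!: SUP_least ennreal_leI mult_right_mono\<close>)
    then have "(\<integral>\<^sup>+v. ennreal (bracket v powr \<beta> * u v) \<partial>lborel)
      = (\<integral>\<^sup>+v. (SUP m::nat. ennreal (min (real m) (bracket v powr \<beta>) * u v)) \<partial>lborel)"
      by simp
    also have "\<dots> = (SUP m::nat. (\<integral>\<^sup>+v. ennreal (min (real m) (bracket v powr \<beta>) * u v) \<partial>lborel))"
      using u0 by (intro nn_integral_monotone_convergence_SUP)
        (auto simp: incseq_def le_fun_def intro!: ennreal_leI mult_right_mono)
    also have "\<dots> \<le> ennreal B" by (intro SUP_least trunc)
    finally have nn: "(\<integral>\<^sup>+v. ennreal (bracket v powr \<beta> * u v) \<partial>lborel) \<le> ennreal B" .
    have B0: "0 \<le> B"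
    proof -
      have "0 \<le> moment \<beta> f" unfolding moment_def
        by (rule integral_nonneg_AE) (use fi(2) in \<open>eventually_elim, simp\<close>)
      then show ?thesis using C K t by (simp add: B_def)
    qed
    have i: "integrable lborel (\<lambda>v. bracket v powr \<beta> * u v)"
      using nn u0 by (intro integrableI_nonneg) (auto simp: le_less_trans)
    have "ennreal (\<integral>v. bracket v powr \<beta> * u v \<partial>lborel) \<le> ennreal B"
      using nn i u0 by (subst nn_integral_eq_integral[symmetric]) auto
    then have le: "(\<integral>v. bracket v powr \<beta> * u v \<partial>lborel) \<le> B" using B0 by simp
    note [measurable] = borel_measurable_integrable[OF Ui]
    have eq: "AE v in lborel. bracket v powr \<beta> * u v = bracket v powr \<beta> * U t f v"
      using uU by eventually_elim simp
    have "finite_moment \<beta> (U t f)"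
      unfolding finite_moment_def using i by (subst (asm) integrable_cong_AE[OF _ _ eq]) measurable
    moreover have "moment \<beta> (U t f) = (\<integral>v. bracket v powr \<beta> * u v \<partial>lborel)"
      unfolding moment_def by (rule integral_cong_AE[OF _ _ eq, symmetric]) measurable
    ultimately show "finite_moment \<beta> (U t f) \<and> moment \<beta> (U t f) \<le> moment \<beta> f + C * K * t"
      using le by (simp add: B_def)
  qed
qed

section \<open>Interpolation between entropy and high moments\<close>

text \<open>A linearised form of the Csiszar-Kullback-Pinsker inequality, pointwise and with a free
  parameter. It goes through the Hellinger distance: \<open>f ln (f / M) - f + M \<ge> (\<surd>f - \<surd>M)\<^sup>2\<close> by
  \<open>ln x \<le> x - 1\<close>, and \<open>|f - M| = |\<surd>f - \<surd>M| (\<surd>f + \<surd>M)\<close> is split by Young's inequality with weight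
  \<open>l\<close>.\<close>

lemma abs_diff_le_entropy:
  fixes f M l :: real
  assumes f: "0 \<le> f" and M: "0 < M" and l: "0 < l"
  shows "\<bar>f - M\<bar> \<le> l / 2 * (f * ln (f / M) - f + M) + (f + M) / l"
proof -
  define a b where "a = sqrt f" and "b = sqrt M"
  have ab: "f = a\<^sup>2" "M = b\<^sup>2" "0 \<le> a" "0 < b" using f M by (auto simp: a_def b_def)
  have hell: "(a - b)\<^sup>2 \<le> f * ln (f / M) - f + M"
  proof (cases "a = 0")
    case False
    then have a: "0 < a" using ab by simp
    have "ln (b / a) \<le> b / a - 1" using a ab by (intro ln_le_minus_one) auto
    moreover have "ln (f / M) = - 2 * ln (b / a)"
      using a ab by (simp add: ln_div ln_realpow)
    ultimately have "2 * (1 - b / a) \<le> ln (f / M)" by simp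
    then have "a\<^sup>2 * (2 * (1 - b / a)) \<le> f * ln (f / M)"
      unfolding ab(1)[symmetric] using f by (intro mult_left_mono)
    moreover have "a\<^sup>2 * (2 * (1 - b / a)) = 2 * a\<^sup>2 - 2 * a * b"
      using a by (simp add: field_simps power2_eq_square)
    ultimately show ?thesis using ab by (simp add: power2_diff)
  qed (use ab in simp)
  have "\<bar>f - M\<bar> = \<bar>a - b\<bar> * (a + b)"
    using ab by (simp add: power2_eq_square square_diff_square_factored abs_mult)
  also have "\<dots> \<le> l / 2 * (a - b)\<^sup>2 + (a + b)\<^sup>2 / (2 * l)"
  proof -
    have "0 \<le> (l * \<bar>a - b\<bar> - (a + b))\<^sup>2 / (2 * l)" using l by simp
    also have "\<dots> = l / 2 * (a - b)\<^sup>2 + (a + b)\<^sup>2 / (2 * l) - \<bar>a - b\<bar> * (a + b)"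
      using l by (simp add: power2_diff power_mult_distrib field_simps power2_eq_square)
    finally show ?thesis by simp
  qed
  also have "(a + b)\<^sup>2 / (2 * l) \<le> (f + M) / l"
  proof -
    have "(a + b)\<^sup>2 \<le> 2 * (f + M)"
      unfolding ab(1,2) using sum_squares_bound[of a b] by (simp add: power2_sum)
    then show ?thesis using l by (simp add: field_simps)
  qed
  also have "l / 2 * (a - b)\<^sup>2 \<le> l / 2 * (f * ln (f / M) - f + M)"
    using hell l by (intro mult_left_mono) auto
  finally show ?thesis by simp
qed

text \<open>Write \<open>f \<le> M + |f - M|\<close>. Where \<open>w \<le> R\<close> the weight is at most \<open>R powr k\<close> and the entropy bounds
  \<open>|f - M|\<close>; elsewhere \<open>w powr k\<close> is at most \<open>R powr (k - \<beta>) w powr \<beta>\<close> and \<open>|f - M| \<le> f + M\<close>.\<close>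

lemma moment_interpolation_pointwise:
  fixes f M w R l k \<beta> :: real
  assumes f: "0 \<le> f" and M: "0 < M" and l: "0 < l" and w: "1 \<le> w" and R: "1 \<le> R" and k: "0 < k" "k < \<beta>"
  shows "w powr k * f \<le> w powr k * M + R powr k * (l / 2 * (f * ln (f / M) - f + M) + (f + M) / l)
     + R powr (k - \<beta>) * (w powr \<beta> * (f + M))"
proof -
  have "w powr k * \<bar>f - M\<bar> \<le> R powr k * \<bar>f - M\<bar> + R powr (k - \<beta>) * (w powr \<beta> * (f + M))"
  proof (cases "w \<le> R")
    case True
    then have "w powr k * \<bar>f - M\<bar> \<le> R powr k * \<bar>f - M\<bar>"
      using k w by (intro mult_right_mono powr_mono2) auto
    moreover have "0 \<le> R powr (k - \<beta>) * (w powr \<beta> * (f + M))" using f M by simp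
    ultimately show ?thesis by simp
  next
    case False
    have "w powr k * \<bar>f - M\<bar> \<le> w powr k * (f + M)"
      using f M by (intro mult_left_mono) auto
    also have "w powr k * (f + M) = w powr (k - \<beta>) * (w powr \<beta> * (f + M))"
      by (simp add: powr_add[symmetric] mult.assoc[symmetric])
    also have "\<dots> \<le> R powr (k - \<beta>) * (w powr \<beta> * (f + M))"
      using False f M R k by (intro mult_right_mono powr_mono2') auto
    finally have "w powr k * \<bar>f - M\<bar> \<le> R powr (k - \<beta>) * (w powr \<beta> * (f + M))" .
    moreover have "0 \<le> R powr k * \<bar>f - M\<bar>" by simp
    ultimately show ?thesis by linarith
  qed
  moreover have "R powr k * \<bar>f - M\<bar> \<le> R powr k * (l / 2 * (f * ln (f / M) - f + M) + (f + M) / l)"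
    using abs_diff_le_entropy[OF f M l] by (intro mult_left_mono) auto
  moreover have "w powr k * f \<le> w powr k * (M + \<bar>f - M\<bar>)"
    by (intro mult_left_mono) auto
  ultimately show ?thesis by (simp add: distrib_left)
qed

lemma finite_moment_Maxwellian: "0 < \<beta> \<Longrightarrow> finite_moment \<beta> (Maxwellian :: real^'n \<Rightarrow> real)"
  unfolding finite_moment_def
  using nn_integral_weighted_Maxwellian[of \<beta>, where 'n='n]
  by (intro integrableI_nonneg) (auto simp: less_imp_le[OF Maxwellian_pos])

lemma moment_interpolation:
  fixes f :: "real^'n \<Rightarrow> real"
  assumes f: "nonneg_unit_mass f" and ent: "finite_entropy f" and fin: "finite_moment \<beta> f"
    and l: "0 < l" and R: "1 \<le> R" and k: "0 < k" "k < \<beta>"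
  shows "finite_moment k f"
    and "moment k f \<le> moment k (Maxwellian :: real^'n \<Rightarrow> real) + R powr k * (l / 2 * rel_entropy f + 2 / l)
      + R powr (k - \<beta>) * (moment \<beta> f + moment \<beta> (Maxwellian :: real^'n \<Rightarrow> real))"
proof -
  let ?M = "Maxwellian :: real^'n \<Rightarrow> real"
  have fi: "integrable lborel f" "AE v in lborel. 0 \<le> f v" "(\<integral>v. f v \<partial>lborel) = 1"
    using f by (auto simp: nonneg_unit_mass_def)
  note [measurable] = borel_measurable_integrable[OF fi(1)]
  have Mi: "integrable lborel ?M" "(\<integral>v. ?M v \<partial>lborel) = 1"
    using has_bochner_integral_Maxwellian[where 'a='n] by (auto simp: has_bochner_integral_iff)
  have mi: "integrable lborel (\<lambda>v. bracket v powr k * ?M v)" "integrable lborel (\<lambda>v. bracket v powr \<beta> * ?M v)"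
    "integrable lborel (\<lambda>v. bracket v powr \<beta> * f v)" "integrable lborel (\<lambda>v. f v * ln (f v / ?M v))"
    using finite_moment_Maxwellian[of k, where 'n='n] finite_moment_Maxwellian[of \<beta>, where 'n='n] k fin ent
    by (auto simp: finite_moment_def finite_entropy_def)
  show fk: "finite_moment k f"
    unfolding finite_moment_def
  proof (rule Bochner_Integration.integrable_bound[OF mi(3)])
    show "AE v in lborel. norm (bracket v powr k * f v) \<le> norm (bracket v powr \<beta> * f v)"
      using k bracket_ge_1 by (auto simp: abs_mult intro!: AE_I2 mult_right_mono powr_mono)
  qed measurable
  let ?rhs = "\<lambda>v. bracket v powr k * ?M v + R powr k * (l / 2 * (f v * ln (f v / ?M v) - f v + ?M v) + (f v + ?M v) / l)
     + R powr (k - \<beta>) * (bracket v powr \<beta> * f v + bracket v powr \<beta> * ?M v)"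
  have "moment k f \<le> (\<integral>v. ?rhs v \<partial>lborel)"
    unfolding moment_def
  proof (rule integral_mono_AE)
    show "integrable lborel (\<lambda>v. bracket v powr k * f v)" using fk by (simp add: finite_moment_def)
    show "integrable lborel ?rhs" using mi fi Mi by simp
    show "AE v in lborel. bracket v powr k * f v \<le> ?rhs v"
      using fi(2)
    proof eventually_elim
      case (elim v)
      then show ?case
        using moment_interpolation_pointwise[OF elim Maxwellian_pos l bracket_ge_1 R k, of v v]
        by (simp add: distrib_left)
    qed
  qed
  also have "\<dots> = moment k ?M + R powr k * (l / 2 * (rel_entropy f - 1 + 1) + (1 + 1) / l)
     + R powr (k - \<beta>) * (moment \<beta> f + moment \<beta> ?M)"
    using mi fi Mi by (simp add: moment_def rel_entropy_def)
  finally show "moment k f \<le> moment k ?M + R powr k * (l / 2 * rel_entropy f + 2 / l)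
      + R powr (k - \<beta>) * (moment \<beta> f + moment \<beta> ?M)" by simp
qed

text \<open>Choose \<open>R powr k = l = (1 + t) powr (\<sigma> / 2)\<close>. Then the entropy term is of order
  \<open>l\<^sup>2 (1 + t) powr (- \<sigma>) = 1\<close>, and the condition on \<open>\<beta>\<close> says that \<open>R powr (k - \<beta>) \<le> 1 / (1 + t)\<close>, which
  compensates the linear growth of the moment of order \<open>\<beta>\<close>.\<close>

lemma moment_bound_of_decay:
  fixes f :: "real^'n \<Rightarrow> real"
  assumes f: "nonneg_unit_mass f" and ent: "finite_entropy f" and fin: "finite_moment \<beta> f"
    and k: "0 < k" and \<sigma>: "0 < \<sigma>" and \<beta>: "k + 2 * k / \<sigma> \<le> \<beta>" and t: "0 \<le> t"
    and C0: "rel_entropy f \<le> C0 * (1 + t) powr (- \<sigma>)"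
    and m: "moment \<beta> f \<le> m + L * t" and "0 \<le> m" "0 \<le> L"
  shows "moment k f \<le> moment k (Maxwellian :: real^'n \<Rightarrow> real) + (C0 / 2 + 2)
     + (m + L + moment \<beta> (Maxwellian :: real^'n \<Rightarrow> real))"
proof -
  let ?M = "Maxwellian :: real^'n \<Rightarrow> real"
  define l where "l = (1 + t) powr (\<sigma> / 2)"
  define R where "R = (1 + t) powr (\<sigma> / (2 * k))"
  have l: "0 < l" using t by (simp add: l_def)
  have R: "1 \<le> R" unfolding R_def using t k \<sigma> by (intro ge_one_powr_ge_zero) auto
  have k\<beta>: "k < \<beta>" using \<beta> k \<sigma> by (smt (verit) divide_pos_pos)
  have M0: "0 \<le> moment \<beta> ?M" unfolding moment_def
    by (intro integral_nonneg_AE) (auto simp: less_imp_le[OF Maxwellian_pos])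
  have Rk: "R powr k = l" using k by (simp add: R_def l_def powr_powr)
  have "l * (l / 2 * rel_entropy f + 2 / l) = (l * l) / 2 * rel_entropy f + 2"
    using l by (simp add: field_simps)
  also have "\<dots> \<le> (l * l) / 2 * (C0 * (1 + t) powr (- \<sigma>)) + 2"
    using C0 l by (intro add_mono mult_left_mono) auto
  also have "(l * l) / 2 * (C0 * (1 + t) powr (- \<sigma>)) = C0 / 2 * ((l * l) * (1 + t) powr (- \<sigma>))" by simp
  also have "(l * l) * (1 + t) powr (- \<sigma>) = 1"
    using t by (simp add: l_def powr_add[symmetric])
  finally have 1: "R powr k * (l / 2 * rel_entropy f + 2 / l) \<le> C0 / 2 + 2" by (simp add: Rk)
  have "R powr (k - \<beta>) \<le> R powr (- (2 * k / \<sigma>))" using R \<beta> by (intro powr_mono) auto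
  also have "\<dots> = 1 / (1 + t)"
    unfolding R_def powr_powr using k \<sigma> t by (simp add: powr_minus_divide)
  finally have "R powr (k - \<beta>) * (moment \<beta> f + moment \<beta> ?M) \<le> 1 / (1 + t) * ((m + L * t) + moment \<beta> ?M)"
    using m M0 assms(10,11) t 
    by (intro order_trans[OF mult_left_mono mult_right_mono]) auto
  also have "\<dots> \<le> m + L + moment \<beta> ?M"
    using t M0 assms(10,11) by (simp add: field_simps)
  finally have 2: "R powr (k - \<beta>) * (moment \<beta> f + moment \<beta> ?M) \<le> m + L + moment \<beta> ?M" .
  show ?thesis using moment_interpolation(2)[OF f ent fin l R k k\<beta>] 1 2 by simp
qed

section \<open>Moment bounds for a single datum\<close>

lemma solution_semigroup:
  assumes "linear_Boltzmann_solution \<gamma> b f0 f"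
  shows "\<exists>U. stochastic_semigroup U (linear_Boltzmann \<gamma> b) \<and>
    (\<forall>t\<ge>0. f t \<in> borel_measurable borel \<and> (AE v in lborel. f t v = U t f0 v))"
  using assms unfolding linear_Boltzmann_solution_def stochastic_semigroup_def by auto

lemma moment_cong_AE:
  assumes [measurable]: "f \<in> borel_measurable borel" "g \<in> borel_measurable borel"
    and eq: "AE v in lborel. f v = g v"
  shows "finite_moment k f \<longleftrightarrow> finite_moment k g" and "moment k f = moment k g"
proof -
  have "AE v in lborel. bracket v powr k * f v = bracket v powr k * g v"
    using eq by eventually_elim simp
  then show "finite_moment k f \<longleftrightarrow> finite_moment k g" "moment k f = moment k g"
    unfolding finite_moment_def moment_def by (intro integrable_cong_AE integral_cong_AE; measurable)+
qed

lemma (in stochastic_semigroup) nonneg_unit_mass_U: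
  "0 \<le> t \<Longrightarrow> nonneg_unit_mass f \<Longrightarrow> nonneg_unit_mass (U t f)"
  using U_nonneg U_mass by (auto simp: nonneg_unit_mass_def)

lemma moment_nonneg: "AE v in lborel. 0 \<le> f v \<Longrightarrow> 0 \<le> moment k f"
  unfolding moment_def by (intro integral_nonneg_AE) (auto elim!: eventually_mono)

text \<open>For one fixed datum the decay of entropy comes with one constant \<open>C0\<close>, so the bound is uniform
  in time and over all solutions with that datum. Nothing is said about its dependence on the
  datum.\<close>

lemma moments_bounded_for_datum:
  fixes f0 :: "real^'n \<Rightarrow> real"
  assumes \<gamma>: "- real CARD('n) < \<gamma>" "\<gamma> < 0" and k: "0 < k"
    and \<sigma>: "0 < \<sigma>" "\<sigma> < - 1 + (s - 2) / \<bar>\<gamma>\<bar>" and \<beta>: "2 \<le> \<beta>" "k + 2 * k / \<sigma> \<le> \<beta>"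
    and thr: "entropy_decay_threshold TYPE('n) p \<gamma> s0" "s0 \<le> s"
    and b: "angular_kernel TYPE('n) b" "bounded (b ` {-1..1})"
    and f0: "f0 \<in> L1w s \<inter> Lp p" "nonneg_unit_mass f0" "finite_moment \<beta> f0"
  shows "\<exists>C. \<forall>f. linear_Boltzmann_solution \<gamma> b f0 f \<longrightarrow> (\<forall>t\<ge>0. finite_moment k (f t) \<and> moment k (f t) \<le> C)"
proof -
  obtain C0 where C0: "\<And>f. linear_Boltzmann_solution \<gamma> b f0 f \<Longrightarrow>
      (\<forall>t\<ge>0. finite_entropy (f t) \<and> rel_entropy (f t) \<le> C0 * (1 + t) powr (- \<sigma>))"
  proof -
    have "\<exists>C0>0. \<forall>(g0 :: real ^ 'n \<Rightarrow> real) f.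
            g0 \<in> L1w s \<inter> Lp p \<longrightarrow> nonneg_unit_mass g0 \<longrightarrow>
            L1w_norm s g0 = L1w_norm s f0 \<longrightarrow> Lp_norm p g0 = Lp_norm p f0 \<longrightarrow> rel_entropy g0 = rel_entropy f0 \<longrightarrow>
            linear_Boltzmann_solution \<gamma> b g0 f \<longrightarrow>
            (\<forall>t\<ge>0. finite_entropy (f t) \<and>
               rel_entropy (f t) \<le> C0 * (1 + t) powr (- \<sigma>))"
      using thr(1)[unfolded entropy_decay_threshold_def] b thr(2) \<sigma>(2) by blast
    then show ?thesis using that f0 by blast
  qed
  obtain L where L: "0 \<le> L"
    "\<And>b U f t. angular_kernel TYPE('n) b \<Longrightarrow> stochastic_semigroup U (linear_Boltzmann \<gamma> b) \<Longrightarrow>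
       nonneg_unit_mass (f :: real^'n \<Rightarrow> real) \<Longrightarrow> finite_moment \<beta> f \<Longrightarrow> 0 \<le> t \<Longrightarrow>
       finite_moment \<beta> (U t f) \<and> moment \<beta> (U t f) \<le> moment \<beta> f + L * t"
    using finite_moment_growth[OF \<gamma> \<beta>(1)] by blast
  have f0i: "integrable lborel f0" "AE v in lborel. 0 \<le> f0 v"
    using f0 by (auto simp: nonneg_unit_mass_def)
  define C where "C = moment k (Maxwellian :: real^'n \<Rightarrow> real) + (C0 / 2 + 2)
     + (moment \<beta> f0 + L + moment \<beta> (Maxwellian :: real^'n \<Rightarrow> real))"
  have "finite_moment k (f t) \<and> moment k (f t) \<le> C"
    if sol: "linear_Boltzmann_solution \<gamma> b f0 f" and t: "0 \<le> t" for f t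
  proof -
    obtain U where U: "stochastic_semigroup U (linear_Boltzmann \<gamma> b)"
      and fU: "\<And>t. 0 \<le> t \<Longrightarrow> f t \<in> borel_measurable borel" "\<And>t. 0 \<le> t \<Longrightarrow> AE v in lborel. f t v = U t f0 v"
      using solution_semigroup[OF sol] by blast
    interpret U: stochastic_semigroup U "linear_Boltzmann \<gamma> b" by fact
    have Um: "U t f0 \<in> borel_measurable borel" using t f0i by simp
    have fin: "finite_moment \<beta> (f t)" "moment \<beta> (f t) \<le> moment \<beta> f0 + L * t"
      using L(2)[OF b(1) U f0(2,3) t] moment_cong_AE[OF fU(1)[OF t] Um fU(2)[OF t]] by simp_all
    have unit: "nonneg_unit_mass (f t)"
    proof -
      have "nonneg_unit_mass (U t f0)" using t f0 by (intro U.nonneg_unit_mass_U)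
      moreover have "(\<integral>v. f t v \<partial>lborel) = (\<integral>v. U t f0 v \<partial>lborel)"
        using fU[OF t] Um by (intro integral_cong_AE) simp_all
      moreover have "integrable lborel (f t) \<longleftrightarrow> integrable lborel (U t f0)"
        using fU[OF t] Um by (intro integrable_cong_AE) simp_all
      moreover have "AE v in lborel. 0 \<le> f t v" if "AE v in lborel. 0 \<le> U t f0 v"
        using that fU(2)[OF t] by eventually_elim simp
      ultimately show ?thesis by (auto simp: nonneg_unit_mass_def)
    qed
    have ent: "finite_entropy (f t)" "rel_entropy (f t) \<le> C0 * (1 + t) powr (- \<sigma>)"
      using C0[OF sol] t by auto
    have k\<beta>: "k < \<beta>" using \<beta>(2) k \<sigma>(1) by (smt (verit) divide_pos_pos)
    show ?thesis
      unfolding C_def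
      using moment_interpolation(1)[OF unit ent(1) fin(1) zero_less_one order_refl k k\<beta>]
        moment_bound_of_decay[OF unit ent(1) fin(1) k \<sigma>(1) \<beta>(2) t ent(2) fin(2) moment_nonneg[OF f0i(2)] L(1)]
      by simp
  qed
  then show ?thesis by blast
qed

section \<open>Uniformity in the datum\<close>

text \<open>Weights of sum \<open>1\<close>, so that a weighted series of probability densities is one. The ratio \<open>1 / 4\<close>
  leaves room for a factor \<open>2 ^ n\<close> in the \<open>L\<^sup>p\<close> estimate.\<close>

definition condensation_weight :: "nat \<Rightarrow> real" where
  "condensation_weight n = 3 / 4 * (1 / 4) ^ n"

lemma condensation_weight_pos: "0 < condensation_weight n"
  by (simp add: condensation_weight_def)

lemma condensation_weight_sums: "condensation_weight sums 1"
  unfolding condensation_weight_def using sums_mult[OF geometric_sums[of "1/4 :: real"], of "3/4"] by simp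

lemma summable_condensation_weight: "summable condensation_weight"
  using condensation_weight_sums by (rule sums_summable)

lemma weighted_series_integrable:
  fixes h :: "nat \<Rightarrow> 'a \<Rightarrow> real"
  assumes h: "\<And>n. integrable M (h n)" "\<And>n x. 0 \<le> h n x" "\<And>n. (\<integral>x. h n x \<partial>M) \<le> B"
  shows "AE x in M. summable (\<lambda>n. condensation_weight n * h n x)"
    and "integrable M (\<lambda>x. \<Sum>n. condensation_weight n * h n x)"
    and "(\<integral>x. (\<Sum>n. condensation_weight n * h n x) \<partial>M) = (\<Sum>n. condensation_weight n * (\<integral>x. h n x \<partial>M))"
proof -
  let ?w = condensation_weight
  have w: "0 \<le> ?w n" for n using condensation_weight_pos[of n] by simp
  have int0: "0 \<le> (\<integral>x. h n x \<partial>M)" for n using h(2) by (intro integral_nonneg_AE) auto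
  have sI: "summable (\<lambda>n. ?w n * (\<integral>x. h n x \<partial>M))"
  proof (rule summable_comparison_test')
    show "summable (\<lambda>n. ?w n * B)" using summable_condensation_weight by (rule summable_mult2)
    show "norm (?w n * (\<integral>x. h n x \<partial>M)) \<le> ?w n * B" for n
      using w h(3) int0 by (auto simp: abs_mult intro!: mult_left_mono)
  qed
  have [measurable]: "h n \<in> borel_measurable M" for n using h(1) by auto
  have "(\<integral>\<^sup>+x. (\<Sum>n. ennreal (?w n * h n x)) \<partial>M) = (\<Sum>n. (\<integral>\<^sup>+x. ennreal (?w n * h n x) \<partial>M))"
    by (rule nn_integral_suminf) measurable
  also have "\<dots> = (\<Sum>n. ennreal (?w n * (\<integral>x. h n x \<partial>M)))"
    using h w by (intro suminf_cong) (subst nn_integral_eq_integral, auto)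
  also have "\<dots> = ennreal (\<Sum>n. ?w n * (\<integral>x. h n x \<partial>M))"
    using sI w int0 by (intro suminf_ennreal2) auto
  also have "\<dots> < \<infinity>" by simp
  finally have "AE x in M. (\<Sum>n. ennreal (?w n * h n x)) \<noteq> \<infinity>"
    by (intro nn_integral_PInf_AE) auto
  then show s: "AE x in M. summable (\<lambda>n. ?w n * h n x)"
  proof eventually_elim
    case (elim x)
    then show ?case using w h(2) by (intro summable_suminf_not_top) auto
  qed
  have s': "AE x in M. summable (\<lambda>n. norm (?w n * h n x))"
    using s by eventually_elim (simp add: w h(2) abs_mult)
  have i: "integrable M (\<lambda>x. ?w n * h n x)" for n using h(1) by simp
  have si: "summable (\<lambda>n. (\<integral>x. norm (?w n * h n x) \<partial>M))"
    using sI w h(2) by (simp add: abs_mult)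
  show "integrable M (\<lambda>x. \<Sum>n. ?w n * h n x)"
    by (rule integrable_suminf[OF i s' si])
  show "(\<integral>x. (\<Sum>n. ?w n * h n x) \<partial>M) = (\<Sum>n. ?w n * (\<integral>x. h n x \<partial>M))"
    using integral_suminf[OF i s' si] by simp
qed

text \<open>If \<open>T\<close> is the sum on the right-hand side, every \<open>(1 / 2) ^ n * x n\<close> is at most \<open>T powr (1 / p)\<close>;
  since \<open>(1 / 4) ^ n * x n\<close> is this quantity times \<open>(1 / 2) ^ n\<close>, the series is at most
  \<open>2 T powr (1 / p)\<close>. The sum \<open>T\<close> may be infinite, hence the values in \<open>ennreal\<close>.\<close>

lemma powr_weighted_series_le:
  fixes x :: "nat \<Rightarrow> real"
  assumes x: "\<And>n. 0 \<le> x n" and s: "summable (\<lambda>n. condensation_weight n * x n)" and p: "1 < p"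
  shows "ennreal ((\<Sum>n. condensation_weight n * x n) powr p)
    \<le> ennreal (2 powr p) * (\<Sum>n. ennreal ((1 / 2) ^ n * x n powr p))"
proof (cases "(\<Sum>n. ennreal ((1 / 2) ^ n * x n powr p)) = \<top>")
  case True
  then show ?thesis by (simp add: ennreal_mult_top)
next
  case False
  let ?y = "\<lambda>n. (1 / 2) ^ n * x n powr p"
  have sy: "summable ?y" using False by (intro summable_suminf_not_top) auto
  define T where "T = (\<Sum>n. ?y n)"
  have T0: "0 \<le> T" unfolding T_def using sy by (intro suminf_nonneg) auto
  have le: "(1 / 2) ^ n * x n \<le> T powr (1 / p)" for n
  proof -
    have "((1 / 2) ^ n * x n) powr p = ((1 / 2) ^ n) powr p * x n powr p"
      using x by (simp add: powr_mult)
    also have "\<dots> \<le> ((1 / 2) ^ n) powr 1 * x n powr p"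
      using p by (intro mult_right_mono powr_mono') (auto simp: power_le_one)
    also have "\<dots> = ?y n" by simp
    also have "\<dots> \<le> T"
      unfolding T_def using sum_le_suminf[OF sy, of "{n}"] by simp
    finally have "(((1 / 2) ^ n * x n) powr p) powr (1 / p) \<le> T powr (1 / p)"
      using p by (intro powr_mono2) auto
    then show ?thesis using p x by (simp add: powr_powr)
  qed
  have geo: "(\<lambda>n. (1 / 2) ^ n * T powr (1 / p)) sums (2 * T powr (1 / p))"
    using sums_mult2[OF geometric_sums[of "1/2 :: real"], of "T powr (1 / p)"] by simp
  have "(\<Sum>n. condensation_weight n * x n) \<le> (\<Sum>n. (1 / 2) ^ n * T powr (1 / p))"
  proof (rule suminf_le[OF _ s sums_summable[OF geo]])
    fix n
    have "condensation_weight n * x n = 3 / 4 * ((1 / 2) ^ n * ((1 / 2) ^ n * x n))"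
      by (simp add: condensation_weight_def power_mult_distrib[symmetric] mult.assoc[symmetric])
    also have "\<dots> \<le> 1 * ((1 / 2) ^ n * ((1 / 2) ^ n * x n))"
      using x by (intro mult_right_mono) auto
    also have "\<dots> \<le> (1 / 2) ^ n * T powr (1 / p)"
      unfolding mult_1 using le by (intro mult_left_mono) auto
    finally show "condensation_weight n * x n \<le> (1 / 2) ^ n * T powr (1 / p)" .
  qed
  also have "\<dots> = 2 * T powr (1 / p)" using geo by (rule sums_unique[symmetric])
  finally have "(\<Sum>n. condensation_weight n * x n) powr p \<le> (2 * T powr (1 / p)) powr p"
    using p x s less_imp_le[OF condensation_weight_pos] by (intro powr_mono2 suminf_nonneg) auto
  also have "\<dots> = 2 powr p * T" using p T0 by (simp add: powr_mult powr_powr)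
  finally have "ennreal ((\<Sum>n. condensation_weight n * x n) powr p) \<le> ennreal (2 powr p * T)"
    by (rule ennreal_leI)
  also have "\<dots> = ennreal (2 powr p) * (\<Sum>n. ennreal (?y n))"
  proof -
    have "(\<Sum>n. ennreal (?y n)) = ennreal T"
      unfolding T_def using sy by (intro suminf_ennreal2) auto
    then show ?thesis using T0 by (simp only: ennreal_mult powr_ge_zero)
  qed
  finally show ?thesis .
qed

definition admissible_datum :: "real \<Rightarrow> real \<Rightarrow> real \<Rightarrow> (real ^ 'n \<Rightarrow> real) \<Rightarrow> bool" where
  "admissible_datum s p \<beta> f \<longleftrightarrow> f \<in> L1w s \<inter> Lp p \<and> nonneg_unit_mass f \<and> finite_moment \<beta> f"

text \<open>The class of data is closed under the weighted series. Because \<open>s \<le> \<beta>\<close>, the common value \<open>m\<close> of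
  the moment of order \<open>\<beta>\<close> also bounds the norms in \<open>L\<^sup>1\<^sub>s\<close>. The absolute value in the proof
  removes the exceptional null sets on which a datum may be negative.\<close>

lemma admissible_datum_series:
  fixes F :: "nat \<Rightarrow> real^'n \<Rightarrow> real"
  assumes F: "\<And>n. admissible_datum s p \<beta> (F n)" "\<And>n. moment \<beta> (F n) = m" "\<And>n. Lp_norm p (F n) = N"
    and s: "s \<le> \<beta>" and p: "1 < p"
  shows "\<exists>g. admissible_datum s p \<beta> g \<and> (\<forall>n. AE v in lborel. condensation_weight n * F n v \<le> g v)"
proof -
  let ?w = condensation_weight
  define h where "h n v = \<bar>F n v\<bar>" for n v
  have Fi: "F n \<in> borel_measurable borel" "integrable lborel (F n)" "AE v in lborel. 0 \<le> F n v" "(\<integral>v. F n v \<partial>lborel) = 1" for n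
    using F(1)[of n] by (auto simp: admissible_datum_def nonneg_unit_mass_def L1w_def)
  have hm [measurable]: "h n \<in> borel_measurable borel" for n using Fi(1)[of n] by (simp add: h_def[abs_def])
  have hF: "AE v in lborel. h n v = F n v" for n using Fi(3)[of n] by eventually_elim (simp add: h_def)
  have h0: "0 \<le> h n v" for n v by (simp add: h_def)
  define g where "g v = (\<Sum>n. ?w n * h n v)" for v
  have hi: "integrable lborel (h n)" "(\<integral>v. h n v \<partial>lborel) = 1" for n
  proof -
    show "integrable lborel (h n)" using Fi(2)[of n] by (simp add: h_def[abs_def])
    have "(\<integral>v. h n v \<partial>lborel) = (\<integral>v. F n v \<partial>lborel)"
      using hF[of n] Fi(1)[of n] by (intro integral_cong_AE) simp_all
    then show "(\<integral>v. h n v \<partial>lborel) = 1" using Fi(4) by simp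
  qed
  have summ: "AE v in lborel. summable (\<lambda>n. ?w n * h n v)"
    by (rule weighted_series_integrable(1)[where B=1]) (simp_all add: hi h0)
  have gi: "integrable lborel g"
    unfolding g_def[abs_def] by (rule weighted_series_integrable(2)[where B=1]) (simp_all add: hi h0)
  have gmass: "(\<integral>v. g v \<partial>lborel) = 1"
    unfolding g_def using condensation_weight_sums
    by (subst weighted_series_integrable(3)[where B=1]) (simp_all add: hi h0 sums_unique[symmetric])
  have gm: "g \<in> borel_measurable borel" using borel_measurable_integrable[OF gi] by simp
  have wh: "0 \<le> ?w n * h n v" for n v using h0 condensation_weight_pos[of n] by simp
  have g0: "AE v in lborel. 0 \<le> g v"
    using summ by eventually_elim (simp add: g_def suminf_nonneg wh)
  have fin\<beta>: "integrable lborel (\<lambda>v. bracket v powr \<beta> * h n v)" "(\<integral>v. bracket v powr \<beta> * h n v \<partial>lborel) = m" for n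
    using moment_cong_AE[OF hm[of n] Fi(1)[of n] hF[of n], of \<beta>] F(1,2)[of n]
    by (auto simp: admissible_datum_def finite_moment_def moment_def)
  have fin: "finite_moment q g" if q: "q \<le> \<beta>" for q
  proof -
    have le: "bracket v powr q * h n v \<le> bracket v powr \<beta> * h n v" for n v
      using q bracket_ge_1 h0 by (intro mult_right_mono powr_mono)
    have i: "integrable lborel (\<lambda>v. bracket v powr q * h n v)" for n
    proof (rule Bochner_Integration.integrable_bound[OF fin\<beta>(1)])
      show "AE v in lborel. norm (bracket v powr q * h n v) \<le> norm (bracket v powr \<beta> * h n v)"
        using le h0 by (auto intro!: AE_I2 simp: abs_mult)
    qed measurable
    have "(\<integral>v. bracket v powr q * h n v \<partial>lborel) \<le> m" for n
      using integral_mono[OF i fin\<beta>(1) le] fin\<beta>(2) by simp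
    then have "integrable lborel (\<lambda>v. \<Sum>n. ?w n * (bracket v powr q * h n v))"
      using i h0 by (intro weighted_series_integrable(2)[where B=m]) auto
    moreover have "AE v in lborel. (\<Sum>n. ?w n * (bracket v powr q * h n v)) = bracket v powr q * g v"
      using summ by eventually_elim (simp add: g_def suminf_mult[symmetric] mult.left_commute)
    ultimately show ?thesis
      unfolding finite_moment_def
      using gm by (subst (asm) integrable_cong_AE) simp_all
  qed
  have gL1w: "g \<in> L1w s"
  proof -
    have "AE v in lborel. g v = \<bar>g v\<bar>" using g0 by eventually_elim simp
    then show ?thesis
      using moment_cong_AE(1)[of g "\<lambda>v. \<bar>g v\<bar>" s] fin[OF s] gm by (simp add: L1w_def)
  qed
  have gLp: "g \<in> Lp p"
  proof -
    have Np: "integrable lborel (\<lambda>v. h n v powr p)" "(\<integral>v. h n v powr p \<partial>lborel) = N powr p" for n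
    proof -
      show i: "integrable lborel (\<lambda>v. h n v powr p)"
        using F(1)[of n] by (simp add: h_def admissible_datum_def Lp_def)
      have "0 \<le> (\<integral>v. h n v powr p \<partial>lborel)" by (intro integral_nonneg_AE) simp
      then show "(\<integral>v. h n v powr p \<partial>lborel) = N powr p"
        using F(3)[of n] p by (auto simp: Lp_norm_def h_def powr_powr)
    qed
    have "(\<integral>\<^sup>+v. ennreal (\<bar>g v\<bar> powr p) \<partial>lborel)
      \<le> (\<integral>\<^sup>+v. ennreal (2 powr p) * (\<Sum>n. ennreal ((1 / 2) ^ n * h n v powr p)) \<partial>lborel)"
    proof (rule nn_integral_mono_AE)
      show "AE v in lborel. ennreal (\<bar>g v\<bar> powr p) \<le> ennreal (2 powr p) * (\<Sum>n. ennreal ((1 / 2) ^ n * h n v powr p))"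
        using summ g0
      proof eventually_elim
        case (elim v)
        then show ?case using powr_weighted_series_le[of "\<lambda>n. h n v" p, OF h0 elim(1) p] by (simp only: g_def abs_of_nonneg)
      qed
    qed
    also have "\<dots> = ennreal (2 powr p) * (\<Sum>n. (\<integral>\<^sup>+v. ennreal ((1 / 2) ^ n * h n v powr p) \<partial>lborel))"
      by (subst nn_integral_cmult, measurable, subst nn_integral_suminf) measurable
    also have "\<dots> = ennreal (2 powr p) * (\<Sum>n. ennreal ((1 / 2) ^ n * N powr p))"
    proof -
      have "(\<integral>\<^sup>+v. ennreal ((1 / 2) ^ n * h n v powr p) \<partial>lborel) = ennreal ((1 / 2) ^ n * N powr p)" for n
        using Np[of n] by (subst nn_integral_eq_integral) auto
      then show ?thesis by simp
    qed
    also have "\<dots> < \<infinity>"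
    proof -
      have "summable (\<lambda>n. (1 / 2) ^ n * N powr p)"
        by (intro summable_mult2 summable_geometric) simp
      then have eq: "(\<Sum>n. ennreal ((1 / 2) ^ n * N powr p)) = ennreal (\<Sum>n. (1 / 2) ^ n * N powr p)"
        by (intro suminf_ennreal2) auto
      show ?thesis unfolding eq by (simp add: ennreal_mult_less_top)
    qed
    finally show ?thesis using gm by (auto simp: Lp_def intro!: integrableI_nonneg)
  qed
  show ?thesis
  proof (intro exI[of _ g] conjI allI)
    show "admissible_datum s p \<beta> g"
      using gL1w gLp gi gmass g0 fin[OF order_refl] by (simp add: admissible_datum_def nonneg_unit_mass_def)
    show "AE v in lborel. ?w n * F n v \<le> g v" for n
      using summ hF[of n]
    proof eventually_elim
      case (elim v)
      then show ?case
        unfolding g_def using sum_le_suminf[OF elim(1), of "{n}"] wh by simp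
    qed
  qed
qed

text \<open>Condensation of singularities. If no bound is common to all data with the given \<open>m\<close> and \<open>N\<close>,
  there are data \<open>F n\<close> and times \<open>t n\<close> at which the moment exceeds \<open>8 ^ n\<close>. Their weighted series
  \<open>g\<close> is again an admissible datum, and it dominates each \<open>F n\<close> times its weight. By linearity and
  positivity the solution with datum \<open>g\<close> has a moment of at least \<open>3 / 4 * 2 ^ n\<close> at time \<open>t n\<close>,
  against the bound for the single datum \<open>g\<close>. The solutions may come from different semigroups;
  uniqueness identifies them.\<close>

lemma moment_bound_condensation:
  fixes m N :: real
  assumes single: "\<And>f0 :: real^'n \<Rightarrow> real. admissible_datum s p \<beta> f0 \<Longrightarrow>
      \<exists>C. \<forall>f. linear_Boltzmann_solution \<gamma> b f0 f \<longrightarrow> (\<forall>t\<ge>0. finite_moment k (f t) \<and> moment k (f t) \<le> C)"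
    and s: "s \<le> \<beta>" and p: "1 < p"
  shows "\<exists>C>0. \<forall>(f0 :: real^'n \<Rightarrow> real) f. admissible_datum s p \<beta> f0 \<longrightarrow> moment \<beta> f0 = m \<longrightarrow> Lp_norm p f0 = N \<longrightarrow>
     linear_Boltzmann_solution \<gamma> b f0 f \<longrightarrow> (\<forall>t\<ge>0. finite_moment k (f t) \<and> moment k (f t) \<le> C)"
proof (rule ccontr)
  let ?w = condensation_weight
  assume contr: "\<not> ?thesis"
  define bad where "bad n x \<longleftrightarrow> (case x of (f0, f, t) \<Rightarrow>
      admissible_datum s p \<beta> f0 \<and> moment \<beta> f0 = m \<and> Lp_norm p f0 = N \<and>
      linear_Boltzmann_solution \<gamma> b f0 f \<and> 0 \<le> t \<and> 8 ^ n < moment k (f t))"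
    for n :: nat and x :: "(real^'n \<Rightarrow> real) \<times> (real \<Rightarrow> real^'n \<Rightarrow> real) \<times> real"
  have "\<exists>x. bad n x" for n :: nat
  proof -
    have "(0::real) < 8 ^ n" by simp
    with contr obtain f0 :: "real^'n \<Rightarrow> real" and f t where f: "admissible_datum s p \<beta> f0" "moment \<beta> f0 = m" "Lp_norm p f0 = N"
      "linear_Boltzmann_solution \<gamma> b f0 f" "0 \<le> t" "\<not> (finite_moment k (f t) \<and> moment k (f t) \<le> 8 ^ n)"
      by blast
    then have "finite_moment k (f t)" using single[OF f(1)] by blast
    then have "8 ^ n < moment k (f t)" using f(6) by simp
    then have "bad n (f0, f, t)" using f by (simp add: bad_def)
    then show ?thesis ..
  qed
  then have "\<exists>X. \<forall>n. bad n (X n)" by (intro choice allI)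
  then obtain X where X: "\<And>n. bad n (X n)" by blast
  define F f t where "F n = fst (X n)" and "f n = fst (snd (X n))" and "t n = snd (snd (X n))" for n
  have F: "\<And>n. admissible_datum s p \<beta> (F n)" "\<And>n. moment \<beta> (F n) = m" "\<And>n. Lp_norm p (F n) = N"
    and f: "\<And>n. linear_Boltzmann_solution \<gamma> b (F n) (f n)"
    and t: "\<And>n. 0 \<le> t n" and big: "\<And>n. 8 ^ n < moment k (f n (t n))"
    using X by (simp_all add: bad_def F_def f_def t_def case_prod_beta)
  obtain g where g: "admissible_datum s p \<beta> g" "\<And>n. AE v in lborel. ?w n * F n v \<le> g v"
    using admissible_datum_series[of s p \<beta> F m N, OF F s p] by blast
  obtain U :: "real \<Rightarrow> (real^'n \<Rightarrow> real) \<Rightarrow> real^'n \<Rightarrow> real"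
    where U: "stochastic_semigroup U (linear_Boltzmann \<gamma> b)"
    using solution_semigroup[OF f[of 0]] by blast
  interpret U: stochastic_semigroup U "linear_Boltzmann \<gamma> b" by fact
  have Fi: "integrable lborel (F n)" for n using F(1)[of n] by (simp add: admissible_datum_def nonneg_unit_mass_def)
  have gi: "integrable lborel g" using g(1) by (simp add: admissible_datum_def nonneg_unit_mass_def)
  have "linear_Boltzmann_solution \<gamma> b g (\<lambda>t. U t g)"
    unfolding linear_Boltzmann_solution_def
    using U.C0 U.pos U.mass U.gen gi by (intro exI[of _ U]) auto
  then obtain C where C: "\<And>t. 0 \<le> t \<Longrightarrow> finite_moment k (U t g) \<and> moment k (U t g) \<le> C"
    using single[OF g(1)] by blast
  have lower: "3 / 4 * 2 ^ n < C" for n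
  proof -
    have tn: "0 \<le> t n" by (rule t)
    obtain V where V: "stochastic_semigroup V (linear_Boltzmann \<gamma> b)" "f n (t n) \<in> borel_measurable borel"
      "AE v in lborel. f n (t n) v = V (t n) (F n) v"
      using solution_semigroup[OF f[of n]] tn by blast
    have fU: "AE v in lborel. f n (t n) v = U (t n) (F n) v"
      using V(3) stochastic_semigroup_unique[OF U V(1) Fi[of n] tn] by eventually_elim simp
    have "AE v in lborel. U (t n) (\<lambda>v. ?w n * F n v) v \<le> U (t n) g v"
      using tn Fi gi g(2) by (intro U.U_mono) auto
    moreover have "AE v in lborel. U (t n) (\<lambda>v. ?w n * F n v) v = ?w n * U (t n) (F n) v"
      using U.U_linear[OF tn Fi[of n] Fi[of n], where x="?w n" and y=0] by simp
    ultimately have le: "AE v in lborel. ?w n * f n (t n) v \<le> U (t n) g v"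
      using fU by eventually_elim simp
    have fin: "finite_moment k (f n (t n))" using single[OF F(1)[of n]] f[of n] tn by blast
    have "?w n * moment k (f n (t n)) = (\<integral>v. bracket v powr k * (?w n * f n (t n) v) \<partial>lborel)"
      by (simp add: moment_def mult.left_commute)
    also have "\<dots> \<le> (\<integral>v. bracket v powr k * U (t n) g v \<partial>lborel)"
    proof (rule integral_mono_AE)
      show "integrable lborel (\<lambda>v. bracket v powr k * (?w n * f n (t n) v))"
        using fin by (simp add: finite_moment_def mult.left_commute)
      show "integrable lborel (\<lambda>v. bracket v powr k * U (t n) g v)"
        using C[OF tn] by (simp add: finite_moment_def)
      show "AE v in lborel. bracket v powr k * (?w n * f n (t n) v) \<le> bracket v powr k * U (t n) g v"
        using le by eventually_elim (rule mult_left_mono, auto)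
    qed
    also have "\<dots> \<le> C" using C[OF tn] by (simp add: moment_def)
    finally have "?w n * moment k (f n (t n)) \<le> C" .
    moreover have "?w n * 8 ^ n < ?w n * moment k (f n (t n))"
      using big condensation_weight_pos by (intro mult_strict_left_mono)
    moreover have "?w n * 8 ^ n = 3 / 4 * 2 ^ n"
      by (simp add: condensation_weight_def power_mult_distrib[symmetric])
    ultimately show ?thesis by simp
  qed
  obtain n :: nat where "C / (3 / 4) < 2 ^ n" using real_arch_pow[of 2 "C / (3 / 4)"] by auto
  then show False using lower[of n] by simp
qed

theorem theorem3p4:
  fixes \<gamma> k s :: real
  assumes "2 \<le> CARD('n::finite)"
    and "- real CARD('n) < \<gamma>" and "\<gamma> < 0"
    and "0 < k"
  shows "\<exists>\<beta>>k. \<forall>p>1. \<forall>s_pd\<gamma>.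
    entropy_decay_threshold TYPE('n) p \<gamma> s_pd\<gamma> \<longrightarrow> s_pd\<gamma> \<le> s \<longrightarrow>
    (\<forall>b. angular_kernel TYPE('n) b \<longrightarrow> bounded (b ` {-1..1}) \<longrightarrow>
      (\<forall>m N. \<exists>C>0. \<forall>(f0 :: real ^ 'n \<Rightarrow> real) f.
        f0 \<in> L1w s \<inter> Lp p \<longrightarrow> nonneg_unit_mass f0 \<longrightarrow>
        finite_moment \<beta> f0 \<longrightarrow> moment \<beta> f0 = m \<longrightarrow> Lp_norm p f0 = N \<longrightarrow>
        linear_Boltzmann_solution \<gamma> b f0 f \<longrightarrow>
        (\<forall>t\<ge>0. finite_moment k (f t) \<and> moment k (f t) \<le> C)))"
proof -
  \<comment> \<open>An admissible decay rate, positive as soon as \<open>s > 2 + |\<gamma>|\<close>.\<close>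
  define \<sigma> where "\<sigma> = (- 1 + (s - 2) / \<bar>\<gamma>\<bar>) / 2"
  \<comment> \<open>\<open>2\<close> is for the collision estimate, \<open>s\<close> for the condensation, \<open>k + 2 k / \<sigma>\<close> for the interpolation.\<close>
  define \<beta> where "\<beta> = max (max 2 s) (max (k + 2 * k / \<sigma>) (k + 1))"
  have \<beta>: "2 \<le> \<beta>" "s \<le> \<beta>" "k + 2 * k / \<sigma> \<le> \<beta>" "k < \<beta>" by (auto simp: \<beta>_def less_max_iff_disj)
  show ?thesis
  proof (rule exI[of _ \<beta>], intro conjI allI impI)
    fix p s0 :: real and b :: "real \<Rightarrow> real" and m N :: real
    assume p: "1 < p" and thr: "entropy_decay_threshold TYPE('n) p \<gamma> s0" "s0 \<le> s"
      and b: "angular_kernel TYPE('n) b" "bounded (b ` {-1..1})"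
    have "2 + \<bar>\<gamma>\<bar> < s" using thr by (auto simp: entropy_decay_threshold_def)
    then have "1 < (s - 2) / \<bar>\<gamma>\<bar>" using \<open>\<gamma> < 0\<close> by (simp add: field_simps)
    moreover have "x < y \<Longrightarrow> 0 < (- x + y) / 2 \<and> (- x + y) / 2 < - x + y" for x y :: real by simp
    ultimately have \<sigma>: "0 < \<sigma>" "\<sigma> < - 1 + (s - 2) / \<bar>\<gamma>\<bar>" unfolding \<sigma>_def by blast+
    have "\<exists>C. \<forall>f. linear_Boltzmann_solution \<gamma> b f0 f \<longrightarrow> (\<forall>t\<ge>0. finite_moment k (f t) \<and> moment k (f t) \<le> C)"
      if "admissible_datum s p \<beta> f0" for f0 :: "real^'n \<Rightarrow> real"
      using that unfolding admissible_datum_def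
      by (intro moments_bounded_for_datum[OF assms(2-4) \<sigma> \<beta>(1,3) thr b]) auto
    from moment_bound_condensation[OF this \<beta>(2) p, of m N]
    show "\<exists>C>0. \<forall>(f0 :: real ^ 'n \<Rightarrow> real) f.
        f0 \<in> L1w s \<inter> Lp p \<longrightarrow> nonneg_unit_mass f0 \<longrightarrow>
        finite_moment \<beta> f0 \<longrightarrow> moment \<beta> f0 = m \<longrightarrow> Lp_norm p f0 = N \<longrightarrow>
        linear_Boltzmann_solution \<gamma> b f0 f \<longrightarrow>
        (\<forall>t\<ge>0. finite_moment k (f t) \<and> moment k (f t) \<le> C)"
      unfolding admissible_datum_def by blast
  qed (rule \<beta>(4))
qed

end
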